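(* Let $q$ be an odd prime and let $k\ge 1$ be a natural number. Let $S=\{s_j\}_{j=1}^{\ell}$ be a finite subset of $\mathbb{Z}$ not containing any perfect $q$-th power, and let $n$ be the number of distinct primes that divide $\prod_{j=1}^{\ell}\mathrm{rad}_q(|s_j|)$. Then the following two statements are equivalent: (1) $S$ belongs to the collection $\mathcal{T}_{k,q}$. (2) The set of projective points associated with $S$ is a $k$-blocking set of $\mathrm{PG}(\mathbb{F}_q^n)$.
   Context: An integer is a perfect $q$-th power if it equals $r^q$ for some $r\in\mathbb{Q}$. For a positive integer $r=\prod_i p_i^{a_i}$ (prime factorization), $\mathrm{rad}_q(r):=\prod_i p_i^{a_i \bmod q}$, where $a_i \bmod q\in\{0,\dots,q-1\}$; this is the $q$-free part of $r$. For a natural number $N$, $\Omega(N)$ is the number of prime factors of $N$ counted with multiplicity. A finite set $S\subset\mathbb{Z}$ contains a $q$-th power modulo $N$ if there are $s\in S$ and $x\in\mathbb{Z}$ with $x^q\equiv s \pmod N$. $S$ contains a $q$-th power modulo almost every natural number $N$ with $\Omega(N)\le k$ if there exists a natural number $\Delta$ (depending on $S$) such that for every natural number $N$ with $\Omega(N)\le k$ and $\gcd(N,\Delta)=1$, $S$ contains a $q$-th power modulo $N$. $\mathcal{T}_{k,q}$ is the collection of all finite subsets $S\subset\mathbb{Z}$ that contain a $q$-th power modulo almost every natural number $N$ with $\Omega(N)\le k$. For a vector space $V$ over $\mathbb{F}_q$, $\mathrm{PG}(V)$ is the projective space of one-dimensional subspaces of $V$; for nonzero $v$, $\langle v\rangle$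 denotes the corresponding point. Set of projective points associated with $S$: let $p_1<\dots<p_n$ be all the distinct primes dividing $\prod_{j}\mathrm{rad}_q(|s_j|)$, and let $a_{ij}\ge 0$ be the exact exponent of $p_i$ in $\mathrm{rad}_q(|s_j|)$. Since no $s_j$ is a perfect $q$-th power, the vector $(a_{1j},\dots,a_{nj})\in\mathbb{F}_q^n$ is nonzero, and the associated set is $\{\langle(a_{1j},\dots,a_{nj})\rangle : 1\le j\le \ell\}\subseteq \mathrm{PG}(\mathbb{F}_q^n)$. $k$-blocking set: for $n>k\ge1$, a subset $\mathcal{S}\subseteq\mathrm{PG}(\mathbb{F}_q^n)$ is a $k$-blocking set if $\mathrm{PG}(W)\cap\mathcal{S}\ne\emptyset$ for every subspace $W$ of $\mathbb{F}_q^n$ of codimension $k$. The notion is only defined when $n>k$, so asserting that a set is a $k$-blocking set of $\mathrm{PG}(\mathbb{F}_q^n)$ includes the assertion $n>k$. *)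

theory Defs
  imports
    "HOL-Number_Theory.Number_Theory"
    "Jordan_Normal_Form.Missing_VectorSpace"
begin

definition perfect_power :: "nat \<Rightarrow> int \<Rightarrow> bool" where
  "perfect_power q s \<longleftrightarrow> (\<exists>r::rat. of_int s = r ^ q)"

definition rad :: "nat \<Rightarrow> nat \<Rightarrow> nat" where
  "rad q r = (\<Prod>p\<in>prime_factors r. p ^ (multiplicity p r mod q))"

definition Omega :: "nat \<Rightarrow> nat" where
  "Omega N = size (prime_factorization N)"

definition contains_power_mod :: "nat \<Rightarrow> int set \<Rightarrow> nat \<Rightarrow> bool" where
  "contains_power_mod q S N \<longleftrightarrow> (\<exists>s\<in>S. \<exists>x::int. [x ^ q = s] (mod int N))"

text \<open>Natural numbers are positive here. In particular \<open>\<Delta> = 0\<close> has to be excluded: it would be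
  coprime to \<open>N = 1\<close> only.\<close>

definition contains_power_mod_almost_every :: "nat \<Rightarrow> nat \<Rightarrow> int set \<Rightarrow> bool" where
  "contains_power_mod_almost_every k q S \<longleftrightarrow>
     (\<exists>\<Delta>::nat. \<Delta> > 0 \<and>
        (\<forall>N::nat. N > 0 \<and> Omega N \<le> k \<and> coprime N \<Delta> \<longrightarrow> contains_power_mod q S N))"

definition T_collection :: "nat \<Rightarrow> nat \<Rightarrow> int set set" where
  "T_collection k q = {S. finite S \<and> contains_power_mod_almost_every k q S}"

text \<open>The space \<open>\<F>\<^sub>q\<^sup>n\<close>, for prime \<open>q\<close>: extensional functions from \<open>{..<n}\<close> to
  \<open>\<int>/q\<int> = {0..q-1}\<close>, with pointwise operations.\<close>

definition Fq_space :: "nat \<Rightarrow> nat \<Rightarrow> (int, nat \<Rightarrow> int) module" where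
  "Fq_space q n = ring.func_space (residue_ring (int q)) {..<n}"

text \<open>Points are the one-dimensional subspaces themselves. The finiteness condition is needed
  because \<open>vectorspace.dim\<close> is unspecified on spaces that are not finite-dimensional.\<close>

definition PG :: "('a, 'm) ring_scheme \<Rightarrow> ('a, 'c, 'd) module_scheme \<Rightarrow> 'c set set" where
  "PG K V = {L. subspace K L V \<and> vectorspace.fin_dim K (V\<lparr>carrier := L\<rparr>) \<and>
                vectorspace.dim K (V\<lparr>carrier := L\<rparr>) = 1}"

definition proj_point :: "('a, 'm) ring_scheme \<Rightarrow> ('a, 'c, 'd) module_scheme \<Rightarrow> 'c \<Rightarrow> 'c set" where
  "proj_point K V v = module.span K V {v}"

definition k_blocking_set :: "nat \<Rightarrow> nat \<Rightarrow> nat \<Rightarrow> (nat \<Rightarrow> int) set set \<Rightarrow> bool" where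
  "k_blocking_set q n k P \<longleftrightarrow>
     1 \<le> k \<and> k < n \<and> P \<subseteq> PG (residue_ring (int q)) (Fq_space q n) \<and>
     (\<forall>W. subspace (residue_ring (int q)) W (Fq_space q n) \<and>
          vectorspace.dim (residue_ring (int q)) ((Fq_space q n)\<lparr>carrier := W\<rparr>) + k =
            vectorspace.dim (residue_ring (int q)) (Fq_space q n) \<longrightarrow>
          PG (residue_ring (int q)) ((Fq_space q n)\<lparr>carrier := W\<rparr>) \<inter> P \<noteq> {})"

definition rad_primes :: "nat \<Rightarrow> int set \<Rightarrow> nat set" where
  "rad_primes q S = {p. prime p \<and> p dvd (\<Prod>s\<in>S. rad q (nat \<bar>s\<bar>))}"

text \<open>Coordinate \<open>i\<close> (counted from 0) belongs to the \<open>i\<close>-th smallest prime in \<open>rad_primes q S\<close>;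
  the exponent is less than \<open>q\<close>, hence an element of \<open>residue_ring q\<close>.\<close>

definition exponent_vector :: "nat \<Rightarrow> int set \<Rightarrow> int \<Rightarrow> nat \<Rightarrow> int" where
  "exponent_vector q S s =
     (\<lambda>i\<in>{..<card (rad_primes q S)}.
        int (multiplicity (sorted_list_of_set (rad_primes q S) ! i) (rad q (nat \<bar>s\<bar>))))"

definition associated_points :: "nat \<Rightarrow> int set \<Rightarrow> (nat \<Rightarrow> int) set set" where
  "associated_points q S =
     (\<lambda>s. proj_point (residue_ring (int q)) (Fq_space q (card (rad_primes q S)))
            (exponent_vector q S s)) ` S"

end

theory Submission
  imports Defs "HOL-Analysis.Harmonic_Numbers" "HOL-Computational_Algebra.Computational_Algebra" "HOL-Real_Asymp.Real_Asymp"
begin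

text \<open>
  Write \<open>V = \<F>\<^sub>q\<^sup>n\<close> and let \<open>ev s \<in> V\<close> be the exponent vector of \<open>s \<in> S\<close>. For a prime \<open>P\<close> dividing
  neither \<open>q\<close> nor an element of \<open>S\<close>, discrete logarithms show that \<open>s\<close> is a \<open>q\<close>-th power
  modulo \<open>P\<close> exactly if \<open>ev s\<close> lies in the kernel of a linear functional on \<open>V\<close> depending only on
  \<open>P\<close> (\<open>residue_functional\<close>; the functional is zero unless \<open>q\<close> divides \<open>P - 1\<close>). By Hensel's lemma and
  the Chinese remainder theorem, \<open>s\<close> is a \<open>q\<close>-th power modulo \<open>N\<close> as soon as it is one modulo every
  prime dividing \<open>N\<close> (\<open>power_mod_composite\<close>).

  If the associated set is \<open>k\<close>-blocking and \<open>N\<close> has at most \<open>k\<close> prime factors, the at most \<open>k\<close>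
  kernels have in common a subspace of codimension \<open>k\<close>, which contains some \<open>ev s\<close>; this \<open>s\<close> is a
  \<open>q\<close>-th power modulo \<open>N\<close>. Conversely, a subspace of codimension \<open>k\<close> is an intersection of \<open>k\<close>
  hyperplanes. If every hyperplane is the kernel belonging to some prime beyond any given bound
  (\<open>prime_with_prescribed_kernel\<close>), then the product \<open>N\<close> of \<open>k\<close> distinct such primes forces
  some \<open>ev s\<close> into the subspace. For \<open>n \<le> k\<close> the same argument with the \<open>n\<close> coordinate hyperplanes
  would make some \<open>ev s\<close> zero, so that \<open>s\<close> would be a \<open>q\<close>-th power.

  That every hyperplane occurs is a case of Chebotarev's density theorem, but a count of Mertens type
  suffices. Let \<open>S(Z)\<close> be the sum of \<open>1/P\<close> over primes \<open>P \<le> Z\<close> with \<open>P \<equiv> 1 (mod q)\<close>, and restrict the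
  sum to those \<open>P\<close> modulo which a positive integer \<open>a\<close> is a \<open>q\<close>-th power. If \<open>a\<close> is not a
  \<open>q\<close>-th power, the restricted sum is \<open>S(Z)/q + O(1)\<close> (\<open>residue_sum_asymp\<close>), and \<open>S(Z)\<close> is unbounded
  (\<open>split_sum_unbounded\<close>). If no large prime \<open>P\<close> had the hyperplane \<open>H\<close> as its kernel \<open>Z\<^sub>P\<close>, then
  \<open>q |H \<inter> Z\<^sub>P| = |Z\<^sub>P|\<close> for all large \<open>P\<close>. Summing this with weights \<open>1/P\<close>, and exchanging the sums over \<open>P\<close>
  and over vectors, would keep \<open>(q-1)\<^sup>2 S(Z)/q\<close> bounded.

  Both statements about sums follow from one theorem. Let \<open>f\<close> be a monic prime polynomial over the
  integers, with simple roots modulo all large primes, and \<open>N\<^sub>p\<close> the number of its roots modulo \<open>p\<close>.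
  Then \<open>\<Sum>\<^bsub>p\<le>Z\<^esub> N\<^sub>p/p = ln (ln Z) + O(1)\<close> (\<open>mertens_upper\<close>, \<open>mertens_lower\<close>). It is applied to \<open>X\<close>, to
  \<open>X\<^sup>q - a\<close> and to \<open>((X+1)\<^sup>q - 1)/X\<close>. Its usual proof uses the zeta function of a number field. The one below
  only counts elements of \<open>A = \<int>[X]/(f)\<close> with bounded coefficients, and \<open>index_bound\<close> takes the place
  of ideal norms. The upper bound is a larger sieve: two distinct elements with small coefficients agree at few
  roots modulo primes. For the lower bound, most elements \<open>v\<close> of a suitable cone are determined, up to
  boundedly many choices, by the pairs \<open>(p, r)\<close> of a prime and a root of \<open>f\<close> modulo \<open>p\<close> with \<open>p\<close> dividing
  \<open>v(r)\<close> (\<open>card_good_set\<close>, \<open>multiplicity_bound\<close>). Hence there must be many such pairs.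
\<close>

section \<open>Integer polynomials with bounded coefficients\<close>

definition polys_over :: "int set \<Rightarrow> nat \<Rightarrow> int poly set" where
  "polys_over A n = {y. (\<forall>i<n. coeff y i \<in> A) \<and> (\<forall>i\<ge>n. coeff y i = 0)}"

lemma bij_betw_polys_over:
  "bij_betw (\<lambda>y. \<lambda>i\<in>{..<n}. coeff y i) (polys_over A n) ({..<n} \<rightarrow>\<^sub>E A)"
proof (rule bij_betw_imageI)
  show "inj_on (\<lambda>y. \<lambda>i\<in>{..<n}. coeff y i) (polys_over A n)"
  proof (rule inj_onI)
    fix x y assume x: "x \<in> polys_over A n" and y: "y \<in> polys_over A n"
      and e: "(\<lambda>i\<in>{..<n}. coeff x i) = (\<lambda>i\<in>{..<n}. coeff y i)"
    have "coeff x i = coeff y i" for i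
    proof (cases "i < n")
      case True
      then show ?thesis using fun_cong[OF e, of i] by simp
    next
      case False
      then show ?thesis using x y by (simp add: polys_over_def)
    qed
    then show "x = y" by (simp add: poly_eq_iff)
  qed
  show "(\<lambda>y. \<lambda>i\<in>{..<n}. coeff y i) ` polys_over A n = {..<n} \<rightarrow>\<^sub>E A"
  proof
    show "(\<lambda>y. \<lambda>i\<in>{..<n}. coeff y i) ` polys_over A n \<subseteq> {..<n} \<rightarrow>\<^sub>E A"
      by (intro image_subsetI) (simp add: polys_over_def PiE_iff restrict_extensional)
    show "{..<n} \<rightarrow>\<^sub>E A \<subseteq> (\<lambda>y. \<lambda>i\<in>{..<n}. coeff y i) ` polys_over A n"
    proof
      fix g assume g: "g \<in> {..<n} \<rightarrow>\<^sub>E A"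
      let ?y = "\<Sum>i<n. monom (g i) i"
      have c: "coeff ?y i = (if i < n then g i else 0)" for i
        by (simp add: coeff_sum)
      have "?y \<in> polys_over A n" using g by (auto simp: polys_over_def c)
      moreover have "(\<lambda>i\<in>{..<n}. coeff ?y i) = g"
        using g by (auto simp: c fun_eq_iff PiE_def extensional_def)
      ultimately show "g \<in> (\<lambda>y. \<lambda>i\<in>{..<n}. coeff y i) ` polys_over A n"
        by (metis (mono_tags, lifting) imageI)
    qed
  qed
qed

lemma card_polys_over: "finite A \<Longrightarrow> card (polys_over A n) = card A ^ n"
  using bij_betw_same_card[OF bij_betw_polys_over] by (simp add: card_PiE)

lemma finite_polys_over: "finite A \<Longrightarrow> finite (polys_over A n)"
  using bij_betw_finite[OF bij_betw_polys_over, of A n] by (simp add: finite_PiE)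

lemma card_polys_over_symmetric: "M \<ge> 0 \<Longrightarrow> card (polys_over {-M..M} n) = nat (2 * M + 1) ^ n"
  by (simp add: card_polys_over)

definition coeffs_le :: "int \<Rightarrow> int poly \<Rightarrow> bool" where
  "coeffs_le M y \<longleftrightarrow> (\<forall>i. \<bar>coeff y i\<bar> \<le> M)"

lemma coeffs_leD: "coeffs_le M y \<Longrightarrow> \<bar>coeff y i\<bar> \<le> M"
  by (simp add: coeffs_le_def)

lemma coeffs_le_mono: "coeffs_le M y \<Longrightarrow> M \<le> N \<Longrightarrow> coeffs_le N y"
  unfolding coeffs_le_def by (intro allI) (drule spec, erule order_trans)

lemma coeffs_le_nonneg: "coeffs_le M y \<Longrightarrow> 0 \<le> M"
  using coeffs_leD[of M y 0] by linarith

lemma coeffs_le_add: "coeffs_le M x \<Longrightarrow> coeffs_le N y \<Longrightarrow> coeffs_le (M + N) (x + y)"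
  unfolding coeffs_le_def coeff_add
  by (intro allI order_trans[OF abs_triangle_ineq] add_mono) auto

lemma coeffs_le_sum:
  "finite I \<Longrightarrow> (\<And>i. i \<in> I \<Longrightarrow> coeffs_le (M i) (x i)) \<Longrightarrow> coeffs_le (\<Sum>i\<in>I. M i) (\<Sum>i\<in>I. x i)"
proof (induction I rule: finite_induct)
  case empty
  then show ?case by (simp add: coeffs_le_def)
next
  case (insert a I)
  then show ?case by (simp add: coeffs_le_add)
qed

lemma coeffs_le_smult: "coeffs_le M x \<Longrightarrow> coeffs_le (\<bar>c\<bar> * M) (smult c x)"
  by (simp add: coeffs_le_def abs_mult mult_left_mono)

lemma coeffs_le_ex: "\<exists>M. coeffs_le M x"
proof
  show "coeffs_le (\<Sum>i\<le>degree x. \<bar>coeff x i\<bar>) x"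
    unfolding coeffs_le_def
  proof
    fix i
    show "\<bar>coeff x i\<bar> \<le> (\<Sum>i\<le>degree x. \<bar>coeff x i\<bar>)"
    proof (cases "i \<le> degree x")
      case True
      then show ?thesis by (intro member_le_sum) auto
    next
      case False
      then show ?thesis by (simp add: coeff_eq_0 sum_nonneg)
    qed
  qed
qed

text \<open>Dividing by \<open>Q ^ n\<close> and letting \<open>Q\<close> tend to infinity removes the lower-order term \<open>a\<close>.\<close>

lemma power_growth_bound:
  fixes m :: nat and a c :: int and n :: nat
  assumes "\<And>Q::nat. Q > 0 \<Longrightarrow> int m * int Q ^ n \<le> (c * int Q + a) ^ n"
  shows "int m \<le> c ^ n"
proof -
  have "(\<lambda>Q. (real_of_int c + real_of_int a * (1 / real (Suc Q))) ^ n) \<longlonglongrightarrow> (real_of_int c + real_of_int a * 0) ^ n"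
    by (intro tendsto_intros LIMSEQ_Suc lim_1_over_n)
  moreover have "real m \<le> (real_of_int c + real_of_int a * (1 / real (Suc Q))) ^ n" for Q
  proof -
    have "real_of_int (int m * int (Suc Q) ^ n) \<le> real_of_int ((c * int (Suc Q) + a) ^ n)"
      using assms[of "Suc Q"] of_int_le_iff by blast
    then have "real m * real (Suc Q) ^ n \<le> (real_of_int c * real (Suc Q) + real_of_int a) ^ n"
      by simp
    also have "real_of_int c * real (Suc Q) + real_of_int a
        = (real_of_int c + real_of_int a * (1 / real (Suc Q))) * real (Suc Q)"
      by (simp add: field_simps)
    finally show ?thesis by (simp add: power_mult_distrib del: of_nat_Suc)
  qed
  ultimately have "real m \<le> real_of_int c ^ n"
    using LIMSEQ_le_const by fastforce
  then have "real_of_int (int m) \<le> real_of_int (c ^ n)" by simp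
  then show ?thesis using of_int_le_iff by blast
qed

lemma small_int_dvd: "(m::int) dvd x \<Longrightarrow> \<bar>x\<bar> < m \<Longrightarrow> x = 0"
  using dvd_imp_le_int[of x m] by (cases "x = 0") auto

lemma dvd_poly_diff: "(a - b :: int) dvd poly g a - poly g b"
proof -
  have "poly (g - [:poly g b:]) b = 0" by simp
  then have "[:-b, 1:] dvd g - [:poly g b:]" by (simp only: poly_eq_0_iff_dvd)
  then obtain h where "g - [:poly g b:] = [:-b, 1:] * h" by (auto elim: dvdE)
  then have "poly (g - [:poly g b:]) a = poly ([:-b, 1:] * h) a" by simp
  then have "poly g a - poly g b = (a - b) * poly h a" by (simp add: algebra_simps)
  then show ?thesis by simp
qed

definition is_ideal :: "int poly set \<Rightarrow> bool" where
  "is_ideal J \<longleftrightarrow> (\<forall>a\<in>J. \<forall>b\<in>J. a + b \<in> J) \<and> (\<forall>a\<in>J. \<forall>c. c * a \<in> J)"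

lemma is_ideal_add: "is_ideal J \<Longrightarrow> a \<in> J \<Longrightarrow> b \<in> J \<Longrightarrow> a + b \<in> J"
  by (simp add: is_ideal_def)
lemma is_ideal_mult: "is_ideal J \<Longrightarrow> a \<in> J \<Longrightarrow> c * a \<in> J"
  by (simp add: is_ideal_def)
lemma is_ideal_mult2: "is_ideal J \<Longrightarrow> a \<in> J \<Longrightarrow> a * c \<in> J"
  by (metis is_ideal_def mult.commute)
lemma is_ideal_uminus: "is_ideal J \<Longrightarrow> a \<in> J \<Longrightarrow> - a \<in> J"
  using is_ideal_mult[of J a "-1"] by simp
lemma is_ideal_diff: "is_ideal J \<Longrightarrow> a \<in> J \<Longrightarrow> b \<in> J \<Longrightarrow> a - b \<in> J"
  using is_ideal_add[of J a "-b"] is_ideal_uminus by simp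
lemma is_ideal_dvd: "is_ideal J \<Longrightarrow> a \<in> J \<Longrightarrow> a dvd b \<Longrightarrow> b \<in> J"
  by (metis dvdE is_ideal_mult2)
lemma is_ideal_Int: "is_ideal I \<Longrightarrow> is_ideal J \<Longrightarrow> is_ideal (I \<inter> J)"
  by (simp add: is_ideal_def)

section \<open>Coefficient boxes and indices of ideals in a quotient of the polynomial ring\<close>

text \<open>The object of interest is the domain \<open>A = \<int>[X]/(f)\<close>. No type is made for it: its elements are
represented by polynomials of degree below \<open>degree f\<close>, or by arbitrary polynomials together with
the reduction \<open>red\<close>, and its ideals by ideals of \<open>\<int>[X]\<close> that contain \<open>f\<close>.\<close>

locale monic_prime_poly =
  fixes f :: "int poly"
  assumes monic: "lead_coeff f = 1" and deg_pos: "degree f > 0" and prime_f: "prime_elem f"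
begin

definition red :: "int poly \<Rightarrow> int poly" where
  "red y = snd (pseudo_divmod y f)"

lemma f_nz: "f \<noteq> 0" using deg_pos by auto

lemma red_eq: "f dvd y - red y" and degree_red: "degree (red y) < degree f"
proof -
  obtain q r where qr: "pseudo_divmod y f = (q, r)" by force
  have "y = f * q + r" using pseudo_divmod(1)[OF f_nz qr] monic by simp
  then have "y - red y = f * q" unfolding red_def qr by simp
  then show "f dvd y - red y" by simp
  show "degree (red y) < degree f" using pseudo_divmod(2)[OF f_nz qr] deg_pos
    by (auto simp add: red_def qr)
qed

lemma small_dvd: "f dvd y \<Longrightarrow> degree y < degree f \<Longrightarrow> y = 0"
  using dvd_imp_degree_le[of f y] by (cases "y = 0") auto

lemma red_unique: "f dvd y - s \<Longrightarrow> degree s < degree f \<Longrightarrow> red y = s"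
proof -
  assume a: "f dvd y - s" "degree s < degree f"
  have "f dvd (y - s) - (y - red y)" using a(1) red_eq by (rule dvd_diff)
  then have "f dvd red y - s" by simp
  then have "red y - s = 0" using a(2) degree_red by (intro small_dvd degree_diff_less)
  then show ?thesis by simp
qed

lemma red_id: "degree y < degree f \<Longrightarrow> red y = y"
  by (rule red_unique) auto

lemma red_cong: assumes "f dvd x - y" shows "red x = red y"
proof (rule red_unique)
  have "f dvd (x - y) + (y - red y)" using assms red_eq by (rule dvd_add)
  then show "f dvd x - red y" by simp
qed (rule degree_red)

lemma red_add: "red (x + y) = red x + red y"
proof (rule red_unique)
  have "f dvd (x - red x) + (y - red y)" using red_eq red_eq by (rule dvd_add)
  then show "f dvd x + y - (red x + red y)" by (simp only: add_diff_add)
qed (intro degree_add_less degree_red)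

lemma red_smult: "red (smult c x) = smult c (red x)"
proof (rule red_unique)
  show "f dvd smult c x - smult c (red x)"
    using dvd_smult[OF red_eq[of x], of c] by (simp add: smult_diff_right)
  show "degree (smult c (red x)) < degree f"
    by (rule le_less_trans[OF degree_smult_le degree_red])
qed

lemma red_diff: "red (x - y) = red x - red y"
  using red_add[of x "smult (-1) y"] red_smult[of "-1" y] by simp

lemma red_0: "red 0 = 0" using red_id deg_pos by simp

lemma red_sum: "red (\<Sum>i\<in>I. x i) = (\<Sum>i\<in>I. red (x i))"
  by (induction I rule: infinite_finite_induct) (simp_all add: red_0 red_add)

lemma red_mem_iff: "is_ideal J \<Longrightarrow> f \<in> J \<Longrightarrow> red x \<in> J \<longleftrightarrow> x \<in> J"
proof -
  assume J: "is_ideal J" "f \<in> J"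
  have *: "x - red x \<in> J" using red_eq is_ideal_dvd[OF J] by blast
  show ?thesis
    using is_ideal_add[OF J(1) *, of "red x"] is_ideal_diff[OF J(1) _ *, of x] by auto
qed

text \<open>The coefficients of \<open>u * w\<close> are bounded by a multiple of \<open>U * W\<close>, and reduction acts on them by a
fixed matrix, which reduces the finitely many powers of \<open>X\<close> that occur.\<close>

lemma mult_bound_ex:
  "\<exists>K\<ge>1. \<forall>u w U W. degree u < degree f \<longrightarrow> degree w < degree f \<longrightarrow> coeffs_le U u \<longrightarrow> coeffs_le W w
     \<longrightarrow> coeffs_le (K * U * W) (red (u * w))"
proof -
  define d where "d = degree f"
  have "\<forall>i. \<exists>M. coeffs_le M (red (monom 1 i))" using coeffs_le_ex by blast
  then obtain M where M: "\<And>i. coeffs_le (M i) (red (monom 1 i))" by metis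
  have M0: "M i \<ge> 0" for i using M coeffs_le_nonneg by blast
  define K where "K = 1 + (\<Sum>i<2*d. int d * M i)"
  have K: "K \<ge> 1" by (simp add: K_def sum_nonneg M0)
  have "coeffs_le (K * U * W) (red (u * w))"
    if u: "degree u < d" "coeffs_le U u" and w: "degree w < d" "coeffs_le W w" for u w U W
  proof -
    have UW: "0 \<le> U" "0 \<le> W" using u w coeffs_le_nonneg by auto
    have c: "\<bar>coeff (u * w) i\<bar> \<le> int d * (U * W)" for i
    proof -
      have u0: "coeff u j = 0" if "j \<ge> d" for j using u(1) that by (simp add: coeff_eq_0)
      have "coeff (u * w) i = (\<Sum>j\<le>i. coeff u j * coeff w (i - j))" by (simp add: coeff_mult)
      also have "\<dots> = (\<Sum>j\<in>{..i} \<inter> {..<d}. coeff u j * coeff w (i - j))"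
        using u0 by (intro sum.mono_neutral_right) (auto simp: not_less)
      finally have "\<bar>coeff (u * w) i\<bar> \<le> (\<Sum>j\<in>{..i} \<inter> {..<d}. \<bar>coeff u j * coeff w (i - j)\<bar>)"
        by simp
      also have "\<dots> \<le> (\<Sum>j\<in>{..i} \<inter> {..<d}. U * W)"
        unfolding abs_mult
        by (intro sum_mono mult_mono coeffs_leD u w UW) auto
      also have "\<dots> \<le> int d * (U * W)"
      proof -
        have "card ({..i} \<inter> {..<d}) \<le> d"
          by (metis card_lessThan card_mono finite_lessThan inf_le2)
        then show ?thesis using UW by (simp add: mult_right_mono)
      qed
      finally show ?thesis .
    qed
    have dg: "degree (u * w) < 2 * d"
      using degree_mult_le[of u w] u(1) w(1) by linarith
    have uw: "u * w = (\<Sum>i<2*d. smult (coeff (u * w) i) (monom 1 i))"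
    proof (rule poly_eqI)
      fix n
      show "coeff (u * w) n = coeff (\<Sum>i<2*d. smult (coeff (u * w) i) (monom 1 i)) n"
        using dg by (cases "n < 2 * d") (auto simp: coeff_sum smult_monom coeff_eq_0)
    qed
    have "red (u * w) = (\<Sum>i<2*d. smult (coeff (u * w) i) (red (monom 1 i)))"
      by (subst uw) (simp only: red_sum red_smult)
    moreover have "coeffs_le (\<Sum>i<2*d. (int d * (U * W)) * M i)
        (\<Sum>i<2*d. smult (coeff (u * w) i) (red (monom 1 i)))"
    proof (intro coeffs_le_sum)
      fix i
      show "coeffs_le (int d * (U * W) * M i) (smult (coeff (u * w) i) (red (monom 1 i)))"
        using coeffs_le_smult[OF M] mult_right_mono[OF c M0] coeffs_le_mono by blast
    qed simp
    moreover have "(\<Sum>i<2*d. (int d * (U * W)) * M i) \<le> K * U * W"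
    proof -
      have "(\<Sum>i<2*d. (int d * (U * W)) * M i) = (\<Sum>i<2*d. int d * M i) * (U * W)"
        unfolding sum_distrib_right by (intro sum.cong) auto
      also have "\<dots> \<le> K * (U * W)" using UW by (intro mult_right_mono) (auto simp: K_def)
      finally show ?thesis by (simp add: mult.assoc)
    qed
    ultimately show ?thesis using coeffs_le_mono by metis
  qed
  then show ?thesis using K unfolding d_def by blast
qed

text \<open>A factor by which multiplication in \<open>A\<close> enlarges coefficients at most, fixed once and for all because the bounds below are stated in terms of it.\<close>

definition K :: int where
  "K = (SOME K. K \<ge> 1 \<and> (\<forall>u w U W. degree u < degree f \<longrightarrow> degree w < degree f \<longrightarrow> coeffs_le U u \<longrightarrow> coeffs_le W w
     \<longrightarrow> coeffs_le (K * U * W) (red (u * w))))"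

lemma K_ge_1: "K \<ge> 1"
  and coeffs_le_red_mult: "degree u < degree f \<Longrightarrow> degree w < degree f \<Longrightarrow> coeffs_le U u \<Longrightarrow> coeffs_le W w
     \<Longrightarrow> coeffs_le (K * U * W) (red (u * w))"
  using someI_ex[OF mult_bound_ex] unfolding K_def[symmetric] by blast+

lemma red_mult_eq_0: "red (w * y) = 0 \<Longrightarrow> degree w < degree f \<Longrightarrow> w \<noteq> 0 \<Longrightarrow> degree y < degree f \<Longrightarrow> y = 0"
proof -
  assume a: "red (w * y) = 0" "degree w < degree f" "w \<noteq> 0" "degree y < degree f"
  have "f dvd w * y" using red_eq[of "w * y"] a(1) by simp
  then have "f dvd w \<or> f dvd y" using prime_f by (simp add: prime_elem_dvd_mult_iff)
  then show "y = 0" using small_dvd a by blast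
qed

definition coeff_box :: "nat \<Rightarrow> int poly set" where
  "coeff_box X = polys_over {0..<int X} (degree f)"

lemma card_coeff_box: "card (coeff_box X) = X ^ degree f"
  by (simp add: coeff_box_def card_polys_over)
lemma finite_coeff_box: "finite (coeff_box X)"
  by (simp add: coeff_box_def finite_polys_over)

lemma coeff_box_degree: "y \<in> coeff_box X \<Longrightarrow> degree y < degree f"
  using deg_pos by (auto simp: coeff_box_def polys_over_def intro: degree_lessI)

lemma coeff_box_coeff: "y \<in> coeff_box X \<Longrightarrow> X > 0 \<Longrightarrow> 0 \<le> coeff y i \<and> coeff y i < int X"
  by (cases "i < degree f") (auto simp: coeff_box_def polys_over_def)

lemma coeff_box_coeffs_le: "y \<in> coeff_box X \<Longrightarrow> coeffs_le (int X) y"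
  unfolding coeffs_le_def
  by (rule allI) (case_tac "i < degree f", auto simp: coeff_box_def polys_over_def)

lemma coeff_box_diff: "y \<in> coeff_box X \<Longrightarrow> y' \<in> coeff_box X \<Longrightarrow> X > 0 \<Longrightarrow> coeffs_le (int X) (y - y')"
  unfolding coeffs_le_def coeff_diff using coeff_box_coeff[of y X] coeff_box_coeff[of y' X]
  by (smt (verit))

lemma mem_polys_over_symmetric: "degree y < degree f \<Longrightarrow> coeffs_le M y \<Longrightarrow> y \<in> polys_over {-M..M} (degree f)"
  unfolding polys_over_def coeffs_le_def by (auto simp: coeff_eq_0 abs_le_iff) (smt (verit))

text \<open>This replaces the fact that a nonzero element of an ideal has norm at least the index of the ideal. The
hypothesis on the \<open>e i\<close> produces \<open>\<Prod>i\<in>I. m i\<close> elements of \<open>A\<close> that are pairwise incongruent modulo \<open>J\<close>.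
Adding to them the multiples \<open>w * y\<close>, with \<open>y\<close> in a box of side \<open>Q\<close>, gives distinct elements
whose coefficients are at most \<open>K * W * Q\<close> up to a constant, since \<open>A\<close> has no zero divisors. Comparing
the number of these elements with the size of that box as \<open>Q\<close> grows yields the bound.\<close>

lemma index_bound:
  assumes J: "is_ideal J" "f \<in> J"
    and w: "w \<in> J" "w \<noteq> 0" "degree w < degree f" "coeffs_le W w"
    and fin: "finite I"
    and ind: "\<And>c. (\<forall>i\<in>I. \<bar>c i\<bar> < int (m i)) \<Longrightarrow> (\<Sum>i\<in>I. smult (c i) (e i)) \<in> J \<Longrightarrow> \<forall>i\<in>I. c i = 0"
  shows "int (\<Prod>i\<in>I. m i) \<le> (2 * K * W) ^ degree f"
proof -
  define C where "C = (\<Pi>\<^sub>E i\<in>I. {0..<int (m i)})"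
  define g where "g c = red (\<Sum>i\<in>I. smult (c i) (e i))" for c
  have finC: "finite C" unfolding C_def by (intro finite_PiE fin) auto
  have cardC: "card C = (\<Prod>i\<in>I. m i)" unfolding C_def by (simp add: card_PiE fin)
  have "\<exists>A\<ge>0. \<forall>c\<in>C. coeffs_le A (g c)"
  proof -
    have "\<forall>c. \<exists>A. coeffs_le A (g c)" using coeffs_le_ex by blast
    then obtain A where A: "\<And>c. coeffs_le (A c) (g c)" by metis
    have "coeffs_le (\<Sum>c\<in>C. A c) (g c)" if "c \<in> C" for c
      using that finC A coeffs_le_nonneg by (intro coeffs_le_mono[OF A]) (auto intro: member_le_sum)
    moreover have "(\<Sum>c\<in>C. A c) \<ge> 0" using A coeffs_le_nonneg by (auto intro: sum_nonneg)
    ultimately show ?thesis by blast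
  qed
  then obtain A where A: "A \<ge> 0" "\<And>c. c \<in> C \<Longrightarrow> coeffs_le A (g c)" by blast
  have W0: "W \<ge> 0" using w(4) coeffs_le_nonneg by blast
  have K0: "K \<ge> 0" using K_ge_1 by simp
  have sep: "c = c'" if "c \<in> C" "c' \<in> C" "g c - g c' \<in> J" for c c'
  proof -
    have "g c - g c' = red (\<Sum>i\<in>I. smult (c i - c' i) (e i))"
      unfolding g_def red_diff[symmetric] by (simp add: sum_subtractf smult_diff_left)
    with that(3) J have mem: "(\<Sum>i\<in>I. smult (c i - c' i) (e i)) \<in> J" by (simp add: red_mem_iff)
    have lt: "\<forall>i\<in>I. \<bar>c i - c' i\<bar> < int (m i)"
    proof
      fix i assume i: "i \<in> I"
      have "c i \<in> {0..<int (m i)}" "c' i \<in> {0..<int (m i)}"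
        using that i by (auto simp: C_def PiE_iff)
      then show "\<bar>c i - c' i\<bar> < int (m i)" by auto
    qed
    have "\<forall>i\<in>I. c i - c' i = 0" using ind[OF lt mem] .
    then have eq: "c i = c' i" if "i \<in> I" for i using that by simp
    show ?thesis using that(1,2) unfolding C_def by (rule PiE_ext) (rule eq)
  qed
  have key: "int (card C) * int Q ^ degree f \<le> (2 * K * W * int Q + (2 * A + 1)) ^ degree f" if Q: "Q > 0" for Q
  proof -
    \<comment> \<open>The first summand is recovered from its class modulo \<open>J\<close>, and then \<open>y\<close> by cancelling \<open>w\<close>.\<close>
    define h where "h = (\<lambda>(c, y). g c + red (w * y))"
    have inj: "inj_on h (C \<times> coeff_box Q)"
    proof (rule inj_onI, clarify)
      fix c y c' y' assume cy: "c \<in> C" "y \<in> coeff_box Q" "c' \<in> C" "y' \<in> coeff_box Q" and eq: "h (c, y) = h (c', y')"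
      have e: "g c - g c' = red (w * (y' - y))"
        using eq by (simp add: h_def red_diff right_diff_distrib algebra_simps)
      have "red (w * (y' - y)) \<in> J"
        using is_ideal_mult2[OF J(1) w(1)] J by (simp add: red_mem_iff)
      then have "c = c'" using sep cy e by simp
      with e have "red (w * (y' - y)) = 0" by simp
      then have "y' - y = 0"
        by (rule red_mult_eq_0[OF _ w(3,2) degree_diff_less[OF coeff_box_degree[OF cy(4)] coeff_box_degree[OF cy(2)]]])
      with \<open>c = c'\<close> show "c = c' \<and> y = y'" by simp
    qed
    let ?R = "A + K * W * int Q"
    have sub: "h ` (C \<times> coeff_box Q) \<subseteq> polys_over {-?R..?R} (degree f)"
    proof (rule image_subsetI, clarify)
      fix c y assume "c \<in> C" "y \<in> coeff_box Q"
      then have "coeffs_le ?R (h (c, y))" unfolding h_def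
        using coeffs_le_add[OF A(2) coeffs_le_red_mult[OF w(3) coeff_box_degree w(4) coeff_box_coeffs_le]] by simp
      moreover have "degree (h (c, y)) < degree f"
        unfolding h_def g_def prod.case by (intro degree_add_less degree_red)
      ultimately show "h (c, y) \<in> polys_over {-?R..?R} (degree f)" by (rule mem_polys_over_symmetric[rotated])
    qed
    have R0: "?R \<ge> 0" using A W0 K0 by simp
    have "card (C \<times> coeff_box Q) \<le> card (polys_over {-?R..?R} (degree f))"
      using card_inj_on_le[OF inj sub] by (simp add: finite_polys_over)
    then have "card C * Q ^ degree f \<le> nat (2 * ?R + 1) ^ degree f"
      by (simp only: card_cartesian_product card_coeff_box card_polys_over_symmetric[OF R0])
    then have "int (card C * Q ^ degree f) \<le> int (nat (2 * ?R + 1) ^ degree f)" by linarith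
    then show ?thesis using R0 by (simp add: algebra_simps)
  qed
  show ?thesis using power_growth_bound[OF key] cardC by simp
qed

end

section \<open>The upper Mertens bound\<close>

text \<open>Cauchy-Schwarz, applied to the sizes of the fibres of \<open>\<phi>\<close>.\<close>

lemma card_collisions:
  fixes \<phi> :: "'a \<Rightarrow> 'b"
  assumes "finite U" "finite R" "\<phi> ` U \<subseteq> R" "R \<noteq> {}"
  shows "real (card U) ^ 2 / real (card R) \<le> real (card {(u, v) \<in> U \<times> U. \<phi> u = \<phi> v})"
proof -
  define n where "n c = real (card {u \<in> U. \<phi> u = c})" for c
  have "{(u, v) \<in> U \<times> U. \<phi> u = \<phi> v} = (\<Union>c\<in>R. {u \<in> U. \<phi> u = c} \<times> {u \<in> U. \<phi> u = c})"
    using assms(3) by auto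
  also have "card \<dots> = (\<Sum>c\<in>R. card ({u \<in> U. \<phi> u = c} \<times> {u \<in> U. \<phi> u = c}))"
    using assms by (intro card_UN_disjoint) auto
  finally have 1: "real (card {(u, v) \<in> U \<times> U. \<phi> u = \<phi> v}) = (\<Sum>c\<in>R. n c ^ 2)"
    by (simp add: n_def card_cartesian_product power2_eq_square)
  have "U = (\<Union>c\<in>R. {u \<in> U. \<phi> u = c})" using assms(3) by auto
  then have "card U = card (\<Union>c\<in>R. {u \<in> U. \<phi> u = c})" by simp
  also have "\<dots> = (\<Sum>c\<in>R. card {u \<in> U. \<phi> u = c})"
    using assms by (intro card_UN_disjoint) auto
  finally have 2: "real (card U) = (\<Sum>c\<in>R. n c)" by (simp add: n_def)
  have "(\<Sum>c\<in>R. n c) ^ 2 \<le> (\<Sum>c\<in>R. n c ^ 2) * real (card R)"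
    using sum_squared_le_sum_of_squares[of n R] assms by (simp add: mult.commute)
  moreover have "real (card R) > 0" using assms by (simp add: card_gt_0_iff)
  ultimately show ?thesis unfolding 1 2 by (simp add: divide_le_eq)
qed

context monic_prime_poly
begin

definition roots_mod :: "nat \<Rightarrow> int set" where
  "roots_mod p = {r \<in> {0..<int p}. int p dvd poly f r}"

lemma finite_roots_mod: "finite (roots_mod p)"
  by (rule finite_subset[of _ "{0..<int p}"]) (auto simp: roots_mod_def)

text \<open>By the Chinese remainder theorem, the ideal of all polynomials \<open>g\<close> with \<open>p dvd poly g r\<close> for \<open>(p, r) \<in> T\<close>
has index \<open>\<Prod>t\<in>T. fst t\<close>, and it contains \<open>w\<close>.\<close>

lemma prod_primes_bound:
  assumes fin: "finite T"
    and T: "\<And>p r. (p, r) \<in> T \<Longrightarrow> prime p \<and> r \<in> roots_mod p \<and> int p dvd poly w r"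
    and w: "w \<noteq> 0" "degree w < degree f" "coeffs_le W w"
  shows "int (\<Prod>t\<in>T. fst t) \<le> (2 * K * W) ^ degree f"
proof -
  define J where "J = {g. \<forall>(p, r)\<in>T. int p dvd poly g r}"
  have J: "is_ideal J" unfolding is_ideal_def J_def by (auto simp: split_beta)
  have fJ: "f \<in> J" unfolding J_def using T by (auto simp: roots_mod_def)
  have wJ: "w \<in> J" unfolding J_def using T by auto
  \<comment> \<open>Modulo \<open>p'\<close>, the polynomial \<open>e t\<close> vanishes at \<open>r'\<close> for all \<open>(p', r')\<close> in \<open>T\<close> except for \<open>t\<close> itself.\<close>
  define e where "e t = (\<Prod>t'\<in>T - {t}. if fst t' = fst t then [:- snd t', 1:] else [:int (fst t'):])"
    for t :: "nat \<times> int"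
  show ?thesis
  proof (rule index_bound[OF J fJ wJ w(1) w(2) w(3) fin, where e = e])
    fix c :: "nat \<times> int \<Rightarrow> int"
    assume c: "\<forall>i\<in>T. \<bar>c i\<bar> < int (fst i)" and S: "(\<Sum>i\<in>T. smult (c i) (e i)) \<in> J"
    show "\<forall>i\<in>T. c i = 0"
    proof
      fix t assume t: "t \<in> T"
      obtain p r where pr: "t = (p, r)" by force
      have p: "prime (int p)" "r \<in> {0..<int p}" using T t pr by (auto simp: roots_mod_def)
      have "int p dvd poly (\<Sum>i\<in>T. smult (c i) (e i)) r" using S t pr by (auto simp: J_def)
      then have "int p dvd (\<Sum>i\<in>T. c i * poly (e i) r)" by (simp add: poly_sum)
      also have "(\<Sum>i\<in>T. c i * poly (e i) r) = c t * poly (e t) r + (\<Sum>i\<in>T-{t}. c i * poly (e i) r)"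
        by (rule sum.remove[OF fin t])
      finally have d1: "int p dvd c t * poly (e t) r + (\<Sum>i\<in>T-{t}. c i * poly (e i) r)" .
      have "int p dvd (\<Sum>i\<in>T-{t}. c i * poly (e i) r)"
      proof (rule dvd_sum)
        fix i assume i: "i \<in> T - {t}"
        have "poly (e i) r = (\<Prod>t'\<in>T - {i}. poly (if fst t' = fst i then [:- snd t', 1:] else [:int (fst t'):]) r)"
          unfolding e_def by (simp add: poly_prod)
        moreover have "poly (if fst t = fst i then [:- snd t, 1:] else [:int (fst t):]) r dvd
            (\<Prod>t'\<in>T - {i}. poly (if fst t' = fst i then [:- snd t', 1:] else [:int (fst t'):]) r)"
          using i t fin by (intro dvd_prodI) auto
        moreover have "int p dvd poly (if fst t = fst i then [:- snd t, 1:] else [:int (fst t):]) r"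
          by (simp add: pr)
        ultimately have "int p dvd poly (e i) r" by (metis dvd_trans)
        then show "int p dvd c i * poly (e i) r" by simp
      qed
      with d1 have "int p dvd c t * poly (e t) r" by (simp add: dvd_add_left_iff)
      moreover have "\<not> int p dvd poly (e t) r"
      proof
        assume "int p dvd poly (e t) r"
        then have "int p dvd (\<Prod>t'\<in>T - {t}. poly (if fst t' = fst t then [:- snd t', 1:] else [:int (fst t'):]) r)"
          by (simp add: e_def poly_prod)
        then obtain t' where t': "t' \<in> T" "t' \<noteq> t"
          and dv: "int p dvd poly (if fst t' = fst t then [:- snd t', 1:] else [:int (fst t'):]) r"
          using prime_dvd_prod_iff[of "T - {t}" "int p"] p(1) fin by auto
        obtain p' r' where pr': "t' = (p', r')" by force
        have p': "prime p'" "r' \<in> {0..<int p'}" using T t' pr' by (auto simp: roots_mod_def)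
        show False
        proof (cases "p' = p")
          case True
          then have "int p dvd r - r'" using dv pr pr' by simp
          moreover have "\<bar>r - r'\<bar> < int p" using p p' True by auto
          ultimately have "r - r' = 0" by (rule small_int_dvd)
          then show False using True t'(2) pr pr' by simp
        next
          case False
          then have "int p dvd int p'" using dv pr pr' by simp
          then have "p dvd p'" by simp
          then show False using False p'(1) p(1) primes_dvd_imp_eq[of p p'] by simp
        qed
      qed
      ultimately have "int p dvd c t" using p(1) prime_dvd_mult_iff by blast
      moreover have "\<bar>c t\<bar> < int p" using c t pr by auto
      ultimately show "c t = 0" by (rule small_int_dvd)
    qed
  qed
qed

lemma power_root_bound:
  assumes "int p > (2 * K) ^ degree f" "p > 1" "int p ^ n \<le> (2 * K * int p) ^ degree f"
  shows "n \<le> degree f"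
proof (rule ccontr)
  assume n: "\<not> n \<le> degree f"
  have "int p ^ n \<le> (2 * K) ^ degree f * int p ^ degree f" using assms(3) by (simp add: power_mult_distrib)
  also have "\<dots> < int p * int p ^ degree f" using assms by (intro mult_strict_right_mono) auto
  also have "\<dots> \<le> int p ^ n"
    using n assms(2) by (subst power_Suc[symmetric], intro power_increasing) auto
  finally show False by simp
qed

text \<open>Apply \<open>prod_primes_bound\<close> to the constant polynomial \<open>w = p\<close>, which vanishes modulo \<open>p\<close> at every root.\<close>

lemma card_roots_mod_small:
  assumes p: "int p > (2 * K) ^ degree f" "prime p"
  shows "card (roots_mod p) \<le> degree f"
proof -
  have p1: "p > 1" by (rule prime_gt_1_nat[OF p(2)])
  have "int (\<Prod>t\<in>{p} \<times> roots_mod p. fst t) \<le> (2 * K * int p) ^ degree f"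
  proof (rule prod_primes_bound[where w = "[:int p:]"])
    show "coeffs_le (int p) [:int p:]"
      unfolding coeffs_le_def by (auto simp: coeff_pCons split: nat.split)
  qed (use p p1 deg_pos finite_roots_mod in auto)
  also have "(\<Prod>t\<in>{p} \<times> roots_mod p. fst t) = p ^ card (roots_mod p)"
    by (subst prod.cong[of _ _ fst "\<lambda>_. p"]) (auto simp: card_cartesian_product)
  finally have "int p ^ card (roots_mod p) \<le> (2 * K * int p) ^ degree f" by simp
  then show ?thesis by (rule power_root_bound[OF p(1) p1])
qed

text \<open>The first summand takes care of the small primes, which have at most \<open>p\<close> roots.\<close>

definition root_bound :: nat where "root_bound = nat ((2 * K) ^ degree f) + degree f"

lemma card_roots_mod_le: "prime p \<Longrightarrow> card (roots_mod p) \<le> root_bound"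
proof (cases "int p > (2 * K) ^ degree f")
  case True
  then show "prime p \<Longrightarrow> ?thesis" using card_roots_mod_small[of p] by (simp add: root_bound_def)
next
  case False
  have "card (roots_mod p) \<le> card {0..<int p}"
    by (intro card_mono) (auto simp: roots_mod_def)
  then show "prime p \<Longrightarrow> ?thesis" using False by (simp add: root_bound_def)
qed

text \<open>Count, with weights \<open>ln p\<close>, the pairs of elements of a coefficient box that agree at a root \<open>r\<close> modulo \<open>p\<close>.
For fixed \<open>(p, r)\<close> the values lie in \<open>p\<close> classes, so at least the proportion \<open>1/p\<close> of all pairs agree, and
the subtracted term accounts for the pairs with equal entries. For a fixed pair with distinct
entries, \<open>prod_primes_bound\<close> limits the total weight of all the points at which it agrees.\<close>

lemma larger_sieve:
  assumes X: "X > 0"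
  shows "(\<Sum>p | prime p \<and> p \<le> Z. real (card (roots_mod p)) * (ln p * (real X ^ (2 * degree f) / p - real X ^ degree f)))
    \<le> real X ^ (2 * degree f) * (degree f * ln (2 * real_of_int K * X))"
proof -
  define d where "d = degree f"
  define U where "U = coeff_box X"
  have finU: "finite U" and cU: "card U = X ^ d" by (simp_all add: U_def d_def finite_coeff_box card_coeff_box)
  define P where "P = {(u, v) \<in> U \<times> U. u \<noteq> v}"
  define Q where "Q = (SIGMA p:{p. prime p \<and> p \<le> Z}. roots_mod p)"
  have finQ: "finite Q" unfolding Q_def by (intro finite_SigmaI finite_roots_mod) (auto intro: finite_subset[of _ "{..Z}"])
  have finP: "finite P" unfolding P_def by (rule finite_subset[of _ "U \<times> U"]) (auto simp: finU)
  have lnK: "ln (2 * real_of_int K * X) \<ge> 0" using K_ge_1 X by (simp add: mult_ge1_I)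
  have "(\<Sum>p | prime p \<and> p \<le> Z. real (card (roots_mod p)) * (ln p * (real X ^ (2 * d) / p - real X ^ d)))
    = (\<Sum>(p, r)\<in>Q. ln p * (real X ^ (2 * d) / p - real X ^ d))"
    unfolding Q_def by (subst sum.Sigma[symmetric]) (auto simp: finite_roots_mod)
  also have "\<dots> \<le> (\<Sum>(p, r)\<in>Q. ln p * (\<Sum>(u, v)\<in>P. if int p dvd poly (u - v) r then 1 else 0))"
  proof (rule sum_mono, clarify)
    fix p r assume pr: "(p, r) \<in> Q"
    then have p: "prime p" by (simp add: Q_def)
    then have p0: "p > 1" by (rule prime_gt_1_nat)
    let ?A = "{(u, v) \<in> U \<times> U. poly u r mod int p = poly v r mod int p}"
    have "real (card U) ^ 2 / real (card {0..<int p}) \<le> real (card ?A)"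
      using p0 by (intro card_collisions finU) auto
    then have 1: "real X ^ (2 * d) / p \<le> real (card ?A)"
      by (simp add: cU power_mult[symmetric] mult.commute)
    have "?A \<subseteq> {(u, v) \<in> P. int p dvd poly (u - v) r} \<union> (\<lambda>u. (u, u)) ` U"
      by (auto simp: P_def mod_eq_dvd_iff)
    then have "card ?A \<le> card ({(u, v) \<in> P. int p dvd poly (u - v) r} \<union> (\<lambda>u. (u, u)) ` U)"
      by (intro card_mono finite_UnI finite_imageI finU finite_subset[OF _ finP]) auto
    also have "\<dots> \<le> card {(u, v) \<in> P. int p dvd poly (u - v) r} + X ^ d"
      by (rule order_trans[OF card_Un_le]) (simp add: cU[symmetric] card_image_le finU)
    finally have "real (card ?A) \<le> real (card {(u, v) \<in> P. int p dvd poly (u - v) r} + X ^ d)"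
      by (simp only: of_nat_le_iff)
    then have 2: "real (card ?A) \<le> real (card {(u, v) \<in> P. int p dvd poly (u - v) r}) + real X ^ d"
      by simp
    have 3: "(\<Sum>(u, v)\<in>P. if int p dvd poly (u - v) r then 1 else (0::real)) = real (card {(u, v) \<in> P. int p dvd poly (u - v) r})"
    proof -
      have "(\<Sum>(u, v)\<in>P. if int p dvd poly (u - v) r then 1 else (0::real))
          = (\<Sum>x\<in>P. if int p dvd poly (fst x - snd x) r then 1 else 0)"
        by (intro sum.cong) auto
      also have "\<dots> = (\<Sum>x\<in>{x \<in> P. int p dvd poly (fst x - snd x) r}. 1)"
        by (rule sum.inter_filter[symmetric, OF finP])
      also have "{x \<in> P. int p dvd poly (fst x - snd x) r} = {(u, v) \<in> P. int p dvd poly (u - v) r}"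
        by auto
      finally show ?thesis by simp
    qed
    show "ln p * (real X ^ (2 * d) / p - real X ^ d) \<le> ln p * (\<Sum>(u, v)\<in>P. if int p dvd poly (u - v) r then 1 else 0)"
      unfolding 3 using 1 2 p0 by (intro mult_left_mono) auto
  qed
  also have "\<dots> = (\<Sum>q\<in>Q. \<Sum>x\<in>P. ln (fst q) * (if int (fst q) dvd poly (fst x - snd x) (snd q) then 1 else 0))"
    by (simp add: split_beta sum_distrib_left)
  also have "\<dots> = (\<Sum>x\<in>P. \<Sum>q\<in>Q. ln (fst q) * (if int (fst q) dvd poly (fst x - snd x) (snd q) then 1 else 0))"
    by (rule sum.swap)
  also have "\<dots> \<le> (\<Sum>x\<in>P. d * ln (2 * real_of_int K * X))"
  proof (rule sum_mono)
    fix x assume "x \<in> P"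
    then obtain u v where x: "x = (u, v)" "u \<in> U" "v \<in> U" "u \<noteq> v" by (auto simp: P_def)
    define T where "T = {q \<in> Q. int (fst q) dvd poly (u - v) (snd q)}"
    have finT: "finite T" using finQ by (simp add: T_def)
    have pos: "fst q > 0" if "q \<in> T" for q using that by (auto simp: T_def Q_def intro: prime_gt_0_nat)
    have "(\<Sum>q\<in>Q. ln (fst q) * (if int (fst q) dvd poly (fst x - snd x) (snd q) then 1 else (0::real)))
       = (\<Sum>q\<in>Q. if int (fst q) dvd poly (u - v) (snd q) then ln (fst q) else 0)"
      by (intro sum.cong) (auto simp: x)
    also have "\<dots> = (\<Sum>q\<in>T. ln (fst q))"
      unfolding T_def by (rule sum.inter_filter[symmetric, OF finQ])
    also have "\<dots> = ln (\<Prod>q\<in>T. real (fst q))"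
      using pos finT by (subst ln_prod) auto
    also have "(\<Prod>q\<in>T. real (fst q)) = real_of_int (int (\<Prod>q\<in>T. fst q))" by simp
    also have "ln \<dots> \<le> ln ((2 * real_of_int K * X) ^ d)"
    proof -
      have "int (\<Prod>q\<in>T. fst q) \<le> (2 * K * int X) ^ degree f"
        using x X by (intro prod_primes_bound[where w = "u - v"] finT degree_diff_less)
          (auto simp: T_def Q_def U_def coeff_box_degree coeff_box_diff)
      then have "real_of_int (int (\<Prod>q\<in>T. fst q)) \<le> real_of_int ((2 * K * int X) ^ degree f)"
        using of_int_le_iff by blast
      moreover have "real_of_int (int (\<Prod>q\<in>T. fst q)) > 0"
        using pos by (simp add: prod_pos del: of_nat_prod)
      ultimately show ?thesis by (simp add: d_def)
    qed
    also have "\<dots> = d * ln (2 * real_of_int K * X)" using K_ge_1 X by (simp add: ln_realpow)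
    finally show "(\<Sum>q\<in>Q. ln (fst q) * (if int (fst q) dvd poly (fst x - snd x) (snd q) then 1 else (0::real)))
       \<le> d * ln (2 * real_of_int K * X)" .
  qed
  also have "\<dots> = real (card P) * (d * ln (2 * real_of_int K * X))" by simp
  also have "\<dots> \<le> real X ^ (2 * d) * (d * ln (2 * real_of_int K * X))"
  proof (intro mult_right_mono)
    have "card P \<le> card (U \<times> U)" unfolding P_def by (intro card_mono) (auto simp: finU)
    also have "\<dots> = X ^ (2 * d)" by (simp add: card_cartesian_product cU mult_2 power_add)
    finally have "real (card P) \<le> real (X ^ (2 * d))" by (simp only: of_nat_le_iff)
    then show "real (card P) \<le> real X ^ (2 * d)" by simp
  qed (use lnK in auto)
  finally show ?thesis by (simp add: d_def)
qed

end

lemma harm_le_ln: "n \<ge> 1 \<Longrightarrow> (harm n :: real) \<le> ln n + 1"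
proof (induction n rule: dec_induct)
  case base
  then show ?case by (simp add: harm_def)
next
  case (step n)
  have n: "real n > 0" using step by simp
  have "1 / real (Suc n) \<le> ln (real (Suc n)) - ln (real n)"
  proof -
    have "ln (real n / real (Suc n)) \<le> real n / real (Suc n) - 1"
      using n by (intro ln_le_minus_one) simp
    also have "\<dots> = - 1 / real (Suc n)" by (simp add: field_simps)
    finally show ?thesis using n by (simp add: ln_div)
  qed
  then show ?case using step.IH by (simp add: harm_Suc inverse_eq_divide)
qed

lemma summable_log_tail: "summable (\<lambda>m. (ln (1 + real (m + 1) * ln 2) + C) / (real m * real (m + 1)))"
proof -
  have 1: "summable (\<lambda>m. ln (1 + real (m + 1) * ln 2) / (real m * real (m + 1)))"
  proof (rule summable_comparison_test_bigo)
    show "summable (\<lambda>m. norm (real m powr (-3/2)))"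
      by (simp add: summable_real_powr_iff)
    show "(\<lambda>m. ln (1 + real (m + 1) * ln 2) / (real m * real (m + 1))) \<in> O(\<lambda>m. real m powr (-3/2))"
      by real_asymp
  qed
  have 2: "summable (\<lambda>m. 1 / (real m * real (m + 1)))"
  proof (rule summable_comparison_test_bigo)
    show "summable (\<lambda>m. norm (real m powr (-3/2)))"
      by (simp add: summable_real_powr_iff)
    show "(\<lambda>m. 1 / (real m * real (m + 1))) \<in> O(\<lambda>m. real m powr (-3/2))"
      by real_asymp
  qed
  have "summable (\<lambda>m. ln (1 + real (m + 1) * ln 2) / (real m * real (m + 1)) + C * (1 / (real m * real (m + 1))))"
    by (intro summable_add summable_mult 1 2)
  then show ?thesis by (simp add: add_divide_distrib)
qed

text \<open>Partial summation over dyadic blocks. On the block between \<open>2 ^ m\<close> and \<open>2 ^ (m + 1)\<close> the weight \<open>ln p\<close> may be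
replaced by \<open>m * ln 2\<close>, so the main term adds up to a harmonic sum and the error terms to a
convergent series, even with the additional \<open>ln (1 + ln Z)\<close>.\<close>

lemma log_to_loglog:
  fixes a :: "nat \<Rightarrow> real" and C :: real
  assumes a: "\<And>p. a p \<ge> 0"
    and S: "\<And>Z. Z \<ge> 2 \<Longrightarrow> (\<Sum>p | prime p \<and> p \<le> (Z::nat). a p * ln p) \<le> ln Z + ln (1 + ln Z) + C"
  shows "\<exists>C. \<forall>Z\<ge>3. (\<Sum>p | prime p \<and> p \<le> (Z::nat). a p) \<le> ln (ln Z) + C"
proof -
  define S where "S m = (\<Sum>p | prime p \<and> p \<le> (2::nat) ^ m. a p * ln p)" for m
  define A where "A m = (\<Sum>p | prime p \<and> p \<le> (2::nat) ^ m. a p)" for m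
  define E where "E m = ln (1 + real m * ln 2) + \<bar>C\<bar>" for m
  have fin: "finite {p. prime p \<and> p \<le> (Z::nat)}" for Z
    by (rule finite_subset[of _ "{..Z}"]) auto
  have Sb: "S m \<le> real m * ln 2 + E m" if "m \<ge> 1" for m
  proof -
    have "(2::nat) ^ m \<ge> 2 ^ 1" using that by (intro power_increasing) auto
    then have "S m \<le> ln (real (2 ^ m)) + ln (1 + ln (real (2 ^ m))) + C"
      unfolding S_def by (intro S) simp
    then show ?thesis by (simp add: E_def ln_realpow)
  qed
  have step: "A (Suc m) \<le> A m + (S (Suc m) - S m) / (real m * ln 2)" if m: "m \<ge> 1" for m
  proof -
    define R where "R = {p. prime p \<and> p \<le> (2::nat) ^ Suc m} - {p. prime p \<and> p \<le> 2 ^ m}"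
    have sub: "{p. prime p \<and> p \<le> 2 ^ m} \<subseteq> {p. prime p \<and> p \<le> (2::nat) ^ Suc m}" by auto
    have d: "S (Suc m) - S m = (\<Sum>p\<in>R. a p * ln p)" "A (Suc m) - A m = (\<Sum>p\<in>R. a p)"
      unfolding S_def A_def R_def
      using sum_diff[OF fin sub, of "\<lambda>p. a p * ln p"] sum_diff[OF fin sub, of a] by simp_all
    have "(\<Sum>p\<in>R. a p) \<le> (\<Sum>p\<in>R. a p * ln p / (real m * ln 2))"
    proof (rule sum_mono)
      fix p assume "p \<in> R"
      then have "real (2 ^ m) \<le> real p" unfolding R_def by (subst of_nat_le_iff) auto
      then have "ln (real (2 ^ m)) \<le> ln (real p)" by (subst ln_le_cancel_iff) (auto intro: less_le_trans[of 0 "2 ^ m"])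
      then have "real m * ln 2 \<le> ln (real p)" by (simp add: ln_realpow)
      then have "a p * (real m * ln 2) \<le> a p * ln p" by (intro mult_left_mono a)
      then show "a p \<le> a p * ln p / (real m * ln 2)" using m by (simp add: le_divide_eq)
    qed
    then show ?thesis using d by (simp add: sum_divide_distrib)
  qed
  \<comment> \<open>Abel summation of the preceding inequality.\<close>
  have ind: "A (Suc n) \<le> A 1 + (S (Suc n) / real (Suc n) + (\<Sum>m=1..n. S (Suc m) / (real m * real (m + 1)))) / ln 2" for n
  proof (induction n)
    case 0
    have "S 1 \<ge> 0" unfolding S_def by (intro sum_nonneg mult_nonneg_nonneg a) (auto dest: prime_gt_0_nat)
    then show ?case by simp
  next
    case (Suc n)
    let ?s = "\<Sum>m=1..n. S (Suc m) / (real m * real (m + 1))"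
    have "A (Suc (Suc n)) \<le> A (Suc n) + (S (Suc (Suc n)) - S (Suc n)) / (real (Suc n) * ln 2)"
      by (rule step) simp
    also have "\<dots> \<le> A 1 + (S (Suc n) / real (Suc n) + ?s) / ln 2 + (S (Suc (Suc n)) - S (Suc n)) / (real (Suc n) * ln 2)"
      using Suc.IH by simp
    also have "\<dots> = A 1 + (S (Suc n) / real (Suc n) + ?s + (S (Suc (Suc n)) - S (Suc n)) / real (Suc n)) / ln 2"
      by (simp add: add_divide_distrib)
    also have "S (Suc n) / real (Suc n) + ?s + (S (Suc (Suc n)) - S (Suc n)) / real (Suc n)
       = ?s + S (Suc (Suc n)) / real (Suc n)" by (simp add: diff_divide_distrib)
    also have "S (Suc (Suc n)) / real (Suc n)
       = S (Suc (Suc n)) / real (Suc (Suc n)) + S (Suc (Suc n)) / (real (Suc n) * real (Suc n + 1))"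
      by (simp add: divide_simps) (simp add: algebra_simps)
    finally show ?case by (simp add: add_ac)
  qed
  define g where "g m = (ln (1 + real (m + 1) * ln 2) + \<bar>C\<bar>) / (real m * real (m + 1))" for m
  have g: "summable g" unfolding g_def by (rule summable_log_tail)
  have g0: "g m \<ge> 0" for m by (simp add: g_def)
  define D where "D = A 1 + (2 * ln 2 + \<bar>C\<bar> + suminf g) / ln 2 + 1"
  have main: "A (Suc n) \<le> ln n + D" if n: "n \<ge> 1" for n
  proof -
    have "(\<Sum>m=1..n. S (Suc m) / (real m * real (m + 1))) \<le> (\<Sum>m=1..n. ln 2 * inverse (real m) + g m)"
    proof (rule sum_mono)
      fix m assume m: "m \<in> {1..n}"
      have "S (Suc m) / (real m * real (m + 1)) \<le> (real (m + 1) * ln 2 + E (m + 1)) / (real m * real (m + 1))"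
        using Sb[of "Suc m"] m by (intro divide_right_mono) auto
      also have "\<dots> = ln 2 * inverse (real m) + g m"
        using m by (simp add: g_def E_def add_divide_distrib inverse_eq_divide)
      finally show "S (Suc m) / (real m * real (m + 1)) \<le> ln 2 * inverse (real m) + g m" .
    qed
    also have "\<dots> = ln 2 * harm n + sum g {1..n}"
      by (simp add: sum.distrib sum_distrib_left harm_def)
    also have "\<dots> \<le> ln 2 * (ln n + 1) + suminf g"
      using harm_le_ln[OF n] sum_le_suminf[OF g, of "{1..n}"] g0 by (intro add_mono mult_left_mono) auto
    finally have 1: "(\<Sum>m=1..n. S (Suc m) / (real m * real (m + 1))) \<le> ln 2 * (ln n + 1) + suminf g" .
    have "E (Suc n) \<le> real (Suc n) * ln 2 + \<bar>C\<bar>" unfolding E_def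
      using ln_add_one_self_le_self[of "real (Suc n) * ln 2"] by simp
    also have "\<dots> \<le> real (Suc n) * (ln 2 + \<bar>C\<bar>)" by (simp add: distrib_left mult_left_le_one_le algebra_simps)
    finally have "S (Suc n) \<le> real (Suc n) * (2 * ln 2 + \<bar>C\<bar>)" using Sb[of "Suc n"] by (simp add: algebra_simps)
    then have 2: "S (Suc n) / real (Suc n) \<le> 2 * ln 2 + \<bar>C\<bar>" by (simp add: divide_le_eq mult.commute)
    have "A (Suc n) \<le> A 1 + (2 * ln 2 + \<bar>C\<bar> + (ln 2 * (ln n + 1) + suminf g)) / ln 2"
      by (rule order_trans[OF ind]) (use 1 2 in \<open>intro add_mono divide_right_mono; simp\<close>)
    also have "\<dots> = ln n + D" by (simp add: D_def add_divide_distrib)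
    finally show ?thesis .
  qed
  have "(\<Sum>p | prime p \<and> p \<le> Z. a p) \<le> ln (ln Z) + (D - ln (ln 2))" if Z: "Z \<ge> 3" for Z :: nat
  proof -
    define n where "n = nat \<lfloor>log 2 Z\<rfloor>"
    have l1: "log 2 Z \<ge> 1" using Z by (simp add: le_log_iff)
    then have n: "n \<ge> 1" "real n \<le> log 2 Z" "log 2 Z < real n + 1" unfolding n_def by linarith+
    have "real Z \<le> 2 powr (real n + 1)" using n(3) Z by (simp add: log_less_iff)
    also have "\<dots> = real (2 ^ Suc n)" by (simp add: powr_add powr_realpow)
    finally have "Z \<le> 2 ^ Suc n" by (simp only: of_nat_le_iff)
    then have "(\<Sum>p | prime p \<and> p \<le> Z. a p) \<le> A (Suc n)"
      unfolding A_def by (intro sum_mono2 fin a) auto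
    also have "\<dots> \<le> ln n + D" by (rule main[OF n(1)])
    also have "ln n \<le> ln (log 2 Z)" using n by (subst ln_le_cancel_iff) auto
    also have "ln (log 2 Z) = ln (ln Z) - ln (ln 2)" using Z by (simp add: log_def ln_div)
    finally show ?thesis by simp
  qed
  then show ?thesis by blast
qed

context monic_prime_poly
begin

text \<open>The larger sieve for a box with \<open>X ^ d\<close> of order \<open>Z * (1 + ln Z)\<close>. With this size
the subtracted term, at most of order \<open>Z * ln Z / X ^ d\<close>, stays bounded; the price is the summand \<open>ln (1 + ln Z)\<close>.\<close>

lemma mertens_upper_log:
  "\<exists>C. \<forall>Z\<ge>2. (\<Sum>p | prime p \<and> p \<le> (Z::nat). real (card (roots_mod p)) / p * ln p) \<le> ln Z + ln (1 + ln Z) + C"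
proof -
  define d where "d = degree f"
  have d: "d > 0" using deg_pos by (simp add: d_def)
  define k where "k = real_of_int K"
  have k: "k \<ge> 1" using K_ge_1 by (simp add: k_def)
  define C where "C = ln ((4 * k) ^ d) + real root_bound"
  have "(\<Sum>p | prime p \<and> p \<le> Z. real (card (roots_mod p)) / p * ln p) \<le> ln Z + ln (1 + ln Z) + C"
    if Z: "Z \<ge> 2" for Z :: nat
  proof -
    let ?P = "{p. prime p \<and> p \<le> Z}"
    define L where "L = 1 + ln Z"
    have L: "L \<ge> 1" using Z by (simp add: L_def)
    define y where "y = (real Z * L) powr (1 / d)"
    have ZL: "real Z * L \<ge> 1" using Z L by (intro mult_ge1_I) auto
    have y1: "y \<ge> 1" unfolding y_def using ZL by (intro ge_one_powr_ge_zero) auto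
    have yd: "y ^ d = real Z * L" using d ZL y1 Z unfolding y_def
      by (subst powr_realpow[symmetric]) (auto simp: powr_powr)
    define X where "X = nat \<lceil>y\<rceil>"
    have X: "y \<le> real X" "real X \<le> 2 * y" "X > 0" using y1 unfolding X_def by linarith+
    have Xd1: "real Z * L \<le> real X ^ d" unfolding yd[symmetric] using X y1 by (intro power_mono) auto
    have "(\<Sum>p\<in>?P. real (card (roots_mod p)) * (ln p * (real X ^ (2 * d) / p - real X ^ d)))
      \<le> real X ^ (2 * d) * (d * ln (2 * k * X))"
      using larger_sieve[OF X(3), of Z] by (simp add: d_def k_def)
    moreover have "(\<Sum>p\<in>?P. real (card (roots_mod p)) * (ln p * (real X ^ (2 * d) / p - real X ^ d)))
      = real X ^ (2 * d) * (\<Sum>p\<in>?P. real (card (roots_mod p)) / p * ln p)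
        - real X ^ d * (\<Sum>p\<in>?P. real (card (roots_mod p)) * ln p)"
      by (simp add: sum_distrib_left sum_subtractf[symmetric] algebra_simps)
    moreover have "(\<Sum>p\<in>?P. real (card (roots_mod p)) * ln p) \<le> real root_bound * real X ^ d"
    proof -
      have "(\<Sum>p\<in>?P. real (card (roots_mod p)) * ln p) \<le> (\<Sum>p\<in>?P. real root_bound * ln Z)"
      proof (rule sum_mono)
        fix p assume p: "p \<in> ?P"
        then have "p \<ge> 1" "p \<le> Z" using prime_ge_1_nat[of p] by auto
        then show "real (card (roots_mod p)) * ln p \<le> real root_bound * ln Z"
          using card_roots_mod_le[of p] p by (intro mult_mono) auto
      qed
      also have "\<dots> = real (card ?P) * (real root_bound * ln Z)" by simp
      also have "\<dots> \<le> real Z * (real root_bound * ln Z)"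
      proof (rule mult_right_mono)
        have "?P \<subseteq> {1..Z}" using prime_ge_1_nat by auto
        then have "card ?P \<le> card {1..Z}" by (intro card_mono) auto
        then show "real (card ?P) \<le> real Z" by simp
        show "0 \<le> real root_bound * ln Z" using Z by (intro mult_nonneg_nonneg) auto
      qed
      also have "\<dots> \<le> real root_bound * (real Z * L)" using Z by (simp add: L_def distrib_left)
      also have "\<dots> \<le> real root_bound * real X ^ d" using Xd1 by (intro mult_left_mono) auto
      finally show ?thesis .
    qed
    then have "real X ^ d * (\<Sum>p\<in>?P. real (card (roots_mod p)) * ln p) \<le> real X ^ d * (real root_bound * real X ^ d)"
      by (intro mult_left_mono) auto
    then have "real X ^ d * (\<Sum>p\<in>?P. real (card (roots_mod p)) * ln p) \<le> real X ^ (2 * d) * real root_bound"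
      unfolding mult_2 power_add by (simp only: mult.assoc mult.left_commute mult.commute)
    ultimately have "real X ^ (2 * d) * (\<Sum>p\<in>?P. real (card (roots_mod p)) / p * ln p)
       \<le> real X ^ (2 * d) * (d * ln (2 * k * X) + real root_bound)"
      unfolding distrib_left by linarith
    then have "(\<Sum>p\<in>?P. real (card (roots_mod p)) / p * ln p) \<le> d * ln (2 * k * X) + real root_bound"
      using X(3) by (subst (asm) mult_le_cancel_left_pos) simp_all
    also have "d * ln (2 * k * X) = ln ((2 * k * X) ^ d)" using k X by (simp add: ln_realpow)
    also have "\<dots> \<le> ln ((4 * k) ^ d * (real Z * L))"
    proof (subst ln_le_cancel_iff)
      have "(2 * k * X) ^ d \<le> (2 * k * (2 * y)) ^ d" using X k by (intro power_mono mult_left_mono) auto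
      also have "2 * k * (2 * y) = (4 * k) * y" by simp
      also have "((4 * k) * y) ^ d = (4 * k) ^ d * y ^ d" by (rule power_mult_distrib)
      finally show "(2 * k * X) ^ d \<le> (4 * k) ^ d * (real Z * L)" by (simp add: yd)
    qed (use k X Z L in auto)
    also have "\<dots> = ln ((4 * k) ^ d) + (ln Z + ln L)"
      using k Z L by (simp add: ln_mult)
    finally show ?thesis by (simp add: C_def L_def)
  qed
  then show ?thesis by blast
qed

theorem mertens_upper:
  "\<exists>C. \<forall>Z\<ge>3. (\<Sum>p | prime p \<and> p \<le> (Z::nat). real (card (roots_mod p)) / p) \<le> ln (ln Z) + C"
proof -
  obtain C where "\<And>Z. Z \<ge> 2 \<Longrightarrow> (\<Sum>p | prime p \<and> p \<le> (Z::nat). real (card (roots_mod p)) / p * ln p) \<le> ln Z + ln (1 + ln Z) + C"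
    using mertens_upper_log by blast
  then show ?thesis by (intro log_to_loglog[where C = C]) auto
qed

end

section \<open>Division by an element and the primes that obstruct it\<close>

lemma poly_taylor: "\<exists>g::int. poly f (a + h) = poly f a + h * poly (pderiv f) a + h^2 * g"
proof (induction f)
  case 0
  show ?case by (rule exI[of _ 0]) simp
next
  case (pCons c q)
  then obtain g where g: "poly q (a + h) = poly q a + h * poly (pderiv q) a + h^2 * g" by blast
  have "poly (pCons c q) (a + h) = c + (a + h) * (poly q a + h * poly (pderiv q) a + h^2 * g)"
    by (simp add: g)
  also have "\<dots> = poly (pCons c q) a + h * poly (pderiv (pCons c q)) a + h^2 * (poly (pderiv q) a + (a + h) * g)"
    by (simp add: pderiv_pCons algebra_simps power2_eq_square)
  finally show ?case by blast
qed

lemma prime_unit_mod: "prime p \<Longrightarrow> \<not> int p dvd b \<Longrightarrow> \<exists>u k. u * b = 1 + int p * k"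
proof -
  assume p: "prime p" "\<not> int p dvd b"
  then have "coprime (int p) b" by (simp add: prime_imp_coprime)
  then have "gcd b (int p) = 1" by (simp add: coprime_commute)
  then obtain u v where "u * b + v * int p = 1" using bezout_int[of b "int p"] by auto
  then have "u * b = 1 + int p * (- v)" by (simp add: algebra_simps)
  then show ?thesis by blast
qed

lemma lift_simple_root:
  assumes p: "prime p" "int p dvd poly f r" "\<not> int p dvd poly (pderiv f) r"
  shows "\<exists>s. int p dvd s - r \<and> (int p)^2 dvd poly f s"
proof -
  obtain m where m: "poly f r = int p * m" using p(2) by (auto elim: dvdE)
  obtain u k where u: "u * poly (pderiv f) r = 1 + int p * k" using prime_unit_mod[OF p(1,3)] by blast
  define h where "h = int p * (- u * m)"
  obtain g where g: "poly f (r + h) = poly f r + h * poly (pderiv f) r + h^2 * g" using poly_taylor by blast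
  have "h * poly (pderiv f) r = - int p * m * (u * poly (pderiv f) r)" by (simp add: h_def)
  also have "\<dots> = - int p * m - (int p)^2 * (m * k)" unfolding u by (simp add: algebra_simps power2_eq_square)
  finally have "poly f (r + h) = (int p)^2 * (- m * k + (u * m)^2 * g)"
    unfolding g m by (simp add: h_def algebra_simps power2_eq_square)
  then show ?thesis by (intro exI[of _ "r + h"]) (simp add: h_def)
qed

lemma synthetic_div: "\<exists>h. g = [:- (s::int), 1:] * h + [:poly g s:]"
proof -
  have "poly (g - [:poly g s:]) s = 0" by simp
  then have "[:-s, 1:] dvd g - [:poly g s:]" by (simp only: poly_eq_0_iff_dvd)
  then obtain h where "g - [:poly g s:] = [:-s, 1:] * h" by (auto elim: dvdE)
  then have "g = [:-s, 1:] * h + [:poly g s:]" by (simp add: algebra_simps)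
  then show ?thesis by blast
qed

lemma smult_in_ideal: "is_ideal J \<Longrightarrow> g \<in> J \<Longrightarrow> smult c g \<in> J"
  using is_ideal_mult[of J g "[:c:]"] by simp

lemma ideal_unit_cancel:
  assumes J: "is_ideal J" "[:int p:] \<in> J" and p: "prime p" "\<not> int p dvd b" and g: "smult b g \<in> J"
  shows "g \<in> J"
proof -
  obtain u k where u: "u * b = 1 + int p * k" using prime_unit_mod[OF p] by blast
  have "smult u (smult b g) - smult k ([:int p:] * g) \<in> J"
    by (intro is_ideal_diff[OF J(1)] smult_in_ideal[OF J(1)] g is_ideal_mult2[OF J(1)] J(2))
  also have "smult u (smult b g) - smult k ([:int p:] * g) = g"
    using u by (simp add: smult_diff_left[symmetric] mult.commute[of k])
  finally show ?thesis .
qed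

lemma ideal_const_dvd:
  assumes J: "is_ideal J" "[:int p:] \<in> J" "1 \<notin> J" and p: "prime p" and c: "[:c:] \<in> J"
  shows "int p dvd c"
proof (rule ccontr)
  assume "\<not> int p dvd c"
  moreover have "smult c 1 \<in> J" using c by (simp add: one_pCons)
  ultimately have "1 \<in> J" using ideal_unit_cancel[OF J(1,2) p] by blast
  then show False using J by simp
qed

lemma ideal_eval:
  assumes J: "is_ideal J" "[:- s, 1:] \<in> J" and g: "g \<in> J"
  shows "[:poly g s:] \<in> J"
proof -
  obtain h where h: "g = [:- s, 1:] * h + [:poly g s:]" using synthetic_div by blast
  have "g - [:- s, 1:] * h \<in> J" by (intro is_ideal_diff[OF J(1)] g is_ideal_mult2 J)
  also have "g - [:- s, 1:] * h = [:poly g s:]" using h by (metis add_diff_cancel_left')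
  finally show ?thesis .
qed

lemma poly_dvd_poly: "g dvd h \<Longrightarrow> poly g (s::int) dvd poly h s"
  by (metis dvd_def poly_mult)

text \<open>The ideal generated by \<open>v\<close>, \<open>v'\<close>, \<open>p\<close> and \<open>h\<close>. Besides \<open>h = f\<close> the case of interest is that \<open>h\<close> is
the cofactor of a linear factor of \<open>f\<close> modulo \<open>p\<close>.\<close>

definition ideal3 :: "int poly \<Rightarrow> int poly \<Rightarrow> int poly \<Rightarrow> nat \<Rightarrow> int poly set" where
  "ideal3 h v v' p = {g. \<exists>a b c e. g = v * a + v' * b + [:int p:] * c + h * e}"

lemma is_ideal_ideal3: "is_ideal (ideal3 h v v' p)"
  unfolding is_ideal_def
proof (intro conjI ballI allI)
  fix x y assume "x \<in> ideal3 h v v' p" "y \<in> ideal3 h v v' p"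
  then obtain a b c e a' b' c' e' where "x = v * a + v' * b + [:int p:] * c + h * e"
    "y = v * a' + v' * b' + [:int p:] * c' + h * e'" unfolding ideal3_def by blast
  then have "x + y = v * (a + a') + v' * (b + b') + [:int p:] * (c + c') + h * (e + e')"
    by (simp only: distrib_left distrib_right ac_simps)
  then show "x + y \<in> ideal3 h v v' p" unfolding ideal3_def by blast
next
  fix x k assume "x \<in> ideal3 h v v' p"
  then obtain a b c e where "x = v * a + v' * b + [:int p:] * c + h * e" unfolding ideal3_def by blast
  then have "k * x = v * (k * a) + v' * (k * b) + [:int p:] * (k * c) + h * (k * e)"
    by (simp only: distrib_left distrib_right ac_simps)
  then show "k * x \<in> ideal3 h v v' p" unfolding ideal3_def by blast
qed

lemma ideal3_mem: "v \<in> ideal3 h v v' p" "v' \<in> ideal3 h v v' p" "[:int p:] \<in> ideal3 h v v' p" "h \<in> ideal3 h v v' p"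
proof -
  have "v = v * 1 + v' * 0 + [:int p:] * 0 + h * 0" "v' = v * 0 + v' * 1 + [:int p:] * 0 + h * 0"
    "[:int p:] = v * 0 + v' * 0 + [:int p:] * 1 + h * 0" "h = v * 0 + v' * 0 + [:int p:] * 0 + h * 1" by simp_all
  then show "v \<in> ideal3 h v v' p" "v' \<in> ideal3 h v v' p" "[:int p:] \<in> ideal3 h v v' p" "h \<in> ideal3 h v v' p"
    unfolding ideal3_def by blast+
qed

context monic_prime_poly
begin

text \<open>The ideal generated by \<open>f\<close> and \<open>p\<close>: membership means being zero in \<open>A/pA\<close>.\<close>

definition mod_ideal :: "nat \<Rightarrow> int poly set" where
  "mod_ideal p = {y. \<exists>a b. y = f * a + [:int p:] * b}"

lemma is_ideal_mod: "is_ideal (mod_ideal p)"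
  unfolding is_ideal_def
proof (intro conjI ballI allI)
  fix x y assume "x \<in> mod_ideal p" "y \<in> mod_ideal p"
  then obtain a b a' b' where "x = f * a + [:int p:] * b" "y = f * a' + [:int p:] * b'" unfolding mod_ideal_def by blast
  then have "x + y = f * (a + a') + [:int p:] * (b + b')" by (simp only: distrib_left distrib_right ac_simps)
  then show "x + y \<in> mod_ideal p" unfolding mod_ideal_def by blast
next
  fix x k assume "x \<in> mod_ideal p"
  then obtain a b where "x = f * a + [:int p:] * b" unfolding mod_ideal_def by blast
  then have "k * x = f * (k * a) + [:int p:] * (k * b)" by (simp only: distrib_left distrib_right ac_simps)
  then show "k * x \<in> mod_ideal p" unfolding mod_ideal_def by blast
qed

lemma mod_ideal_mem: "f \<in> mod_ideal p" "[:int p:] \<in> mod_ideal p"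
proof -
  have "f = f * 1 + [:int p:] * 0" "[:int p:] = f * 0 + [:int p:] * 1" by simp_all
  then show "f \<in> mod_ideal p" "[:int p:] \<in> mod_ideal p" unfolding mod_ideal_def by blast+
qed

lemma f_dvd_smult: "f dvd smult c g \<Longrightarrow> c \<noteq> 0 \<Longrightarrow> f dvd g"
proof -
  assume a: "f dvd smult c g" "c \<noteq> 0"
  have "f dvd [:c:] * g" using a(1) by simp
  then have "f dvd [:c:] \<or> f dvd g" by (rule prime_elem_dvd_multD[OF prime_f])
  moreover have "\<not> f dvd [:c:]" using small_dvd[of "[:c:]"] deg_pos a(2) by auto
  ultimately show "f dvd g" by blast
qed

text \<open>Call \<open>p\<close> bad for \<open>v\<close> if the roots of \<open>f\<close> modulo \<open>p\<close> cannot detect divisibility by \<open>v\<close> at \<open>p\<close>: some \<open>y\<close>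
vanishes at all common roots of \<open>f\<close> and \<open>v\<close>, and yet the quotient \<open>y / v = z / p\<close> has a denominator
\<open>p\<close>. The typical reasons are that \<open>v\<close> lies in a prime ideal above \<open>p\<close> of higher residue degree,
or in the square of a prime ideal.\<close>

definition bad :: "nat \<Rightarrow> int poly \<Rightarrow> bool" where
  "bad p v \<longleftrightarrow> (\<exists>y z. f dvd smult (int p) y - v * z \<and> z \<notin> mod_ideal p \<and>
     (\<forall>r. int p dvd poly f r \<and> int p dvd poly v r \<longrightarrow> int p dvd poly y r))"

text \<open>The ideal \<open>v A\<close> has finite index, so some positive multiple \<open>c * y\<close> lies in it. If \<open>c\<close> is chosen
least, a prime factor \<open>p\<close> of \<open>c\<close> could be cancelled from \<open>c * y = v * z\<close> unless \<open>z\<close> is nonzero modulo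
\<open>p\<close>; but then \<open>p\<close> would be bad for \<open>v\<close>.\<close>

lemma divisible_if_not_bad:
  assumes v: "v \<noteq> 0" "degree v < degree f"
    and nb: "\<And>p. prime p \<Longrightarrow> \<not> bad p v"
    and y: "\<And>p r. prime p \<Longrightarrow> int p dvd poly f r \<Longrightarrow> int p dvd poly v r \<Longrightarrow> int p dvd poly y r"
  shows "\<exists>z. f dvd y - v * z"
proof -
  define J where "J = {g. \<exists>z. f dvd g - v * z}"
  have J: "is_ideal J" unfolding is_ideal_def
  proof (intro conjI ballI allI)
    fix a b assume "a \<in> J" "b \<in> J"
    then obtain z z' where "f dvd a - v * z" "f dvd b - v * z'" unfolding J_def by blast
    then have "f dvd (a - v * z) + (b - v * z')" by (rule dvd_add)
    also have "(a - v * z) + (b - v * z') = (a + b) - v * (z + z')" by (simp add: distrib_left)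
    finally show "a + b \<in> J" unfolding J_def by blast
  next
    fix a c assume "a \<in> J"
    then obtain z where "f dvd a - v * z" unfolding J_def by blast
    then have "f dvd c * (a - v * z)" by (rule dvd_mult)
    also have "c * (a - v * z) = c * a - v * (c * z)" by (simp add: right_diff_distrib)
    finally show "c * a \<in> J" unfolding J_def by blast
  qed
  have "f dvd f - v * 0" "f dvd v - v * 1" by simp_all
  then have fJ: "f \<in> J" and vJ: "v \<in> J" unfolding J_def by blast+
  obtain W where W: "coeffs_le W v" using coeffs_le_ex by blast
  have "\<exists>N>0. [:int N:] \<in> J"
  proof (rule ccontr)
    assume no: "\<not> (\<exists>N>0. [:int N:] \<in> J)"
    \<comment> \<open>If \<open>J\<close> contained no positive integer, all integers below \<open>M\<close> would be distinct modulo \<open>J\<close>.\<close>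
    define M where "M = nat ((2 * K * W) ^ degree f) + 1"
    have "int (\<Prod>i\<in>{()}. M) \<le> (2 * K * W) ^ degree f"
    proof (rule index_bound[OF J fJ vJ v W, where e = "\<lambda>_. 1"])
      fix c :: "unit \<Rightarrow> int" assume "(\<Sum>i\<in>{()}. smult (c i) 1) \<in> J"
      then have c: "[:c ():] \<in> J" by simp
      then have "[:- c ():] \<in> J" using is_ideal_uminus[OF J] by fastforce
      with c have cJ: "[:int (nat \<bar>c ()\<bar>):] \<in> J" by (cases "c () \<ge> 0") auto
      have "\<not> nat \<bar>c ()\<bar> > 0"
      proof
        assume "nat \<bar>c ()\<bar> > 0"
        with cJ have "\<exists>N>0. [:int N:] \<in> J" by (intro exI[of _ "nat \<bar>c ()\<bar>"] conjI)
        with no show False by (rule notE)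
      qed
      then have "c () = 0" by simp
      then show "\<forall>i\<in>{()}. c i = 0" by simp
    qed simp
    then show False by (simp add: M_def split: if_splits)
  qed
  then obtain N where N: "N > 0" "[:int N:] \<in> J" by blast
  have "smult (int N) y \<in> J" using is_ideal_mult2[OF J N(2), of y] by simp
  with N(1) have ex: "\<exists>c>0. smult (int c) y \<in> J" by blast
  define c where "c = (LEAST c. c > 0 \<and> smult (int c) y \<in> J)"
  have c: "c > 0" "smult (int c) y \<in> J" using LeastI_ex[OF ex] unfolding c_def by auto
  have least: "c \<le> c'" if "c' > 0" "smult (int c') y \<in> J" for c'
    unfolding c_def using that by (intro Least_le) simp
  have "c = 1"
  proof (rule ccontr)
    assume "c \<noteq> 1"
    then obtain p where p: "prime p" "p dvd c" using prime_factor_nat by blast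
    then obtain c' where c': "c = p * c'" by (auto elim: dvdE)
    obtain z where z: "f dvd smult (int c) y - v * z" using c(2) unfolding J_def by blast
    have z': "f dvd smult (int p) (smult (int c') y) - v * z" using z by (simp add: c')
    have "z \<in> mod_ideal p"
    proof (rule ccontr)
      assume "z \<notin> mod_ideal p"
      then have "bad p v" unfolding bad_def using z' y[OF p(1)]
        by (intro exI[of _ "smult (int c') y"] exI[of _ z]) auto
      then show False using nb p by blast
    qed
    then obtain a b where ab: "z = f * a + [:int p:] * b" unfolding mod_ideal_def by blast
    have "f dvd (smult (int p) (smult (int c') y) - v * z) + f * (v * a)"
      using z' by (intro dvd_add) auto
    also have "(smult (int p) (smult (int c') y) - v * z) + f * (v * a) = smult (int p) (smult (int c') y - v * b)"
      unfolding ab by (simp add: algebra_simps smult_diff_right)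
    finally have "f dvd smult (int c') y - v * b"
      by (rule f_dvd_smult) (use p prime_gt_0_nat[of p] in auto)
    then have "smult (int c') y \<in> J" unfolding J_def by blast
    moreover have "c' > 0" "c' < c" using c c' prime_gt_1_nat[OF p(1)] by auto
    ultimately show False using least[of c'] by simp
  qed
  then show ?thesis using c(2) unfolding J_def by simp
qed

text \<open>If \<open>J\<close> contains no \<open>X - s\<close>, then \<open>1\<close> and \<open>X\<close> are linearly independent over \<open>\<int>/p\<close> modulo \<open>J\<close>, so
the index of \<open>J\<close> is at least \<open>p\<^sup>2\<close>.\<close>

lemma index_two:
  assumes J: "is_ideal J" "f \<in> J" "[:int p:] \<in> J" "1 \<notin> J" and p: "prime p"
    and lin: "\<And>s. [:- s, 1:] \<notin> J"
    and w: "w \<in> J" "w \<noteq> 0" "degree w < degree f" "coeffs_le W w"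
  shows "(int p)\<^sup>2 \<le> (2 * K * W) ^ degree f"
proof -
  have "int (\<Prod>i\<in>{0, 1::nat}. p) \<le> (2 * K * W) ^ degree f"
  proof (rule index_bound[OF J(1,2) w, where e = "\<lambda>i. monom 1 i"])
    fix c :: "nat \<Rightarrow> int"
    assume c: "\<forall>i\<in>{0, 1}. \<bar>c i\<bar> < int p" and "(\<Sum>i\<in>{0, 1}. smult (c i) (monom 1 i)) \<in> J"
    then have cJ: "[:c 0, c 1:] \<in> J" by (simp add: smult_monom monom_0 monom_Suc)
    have "int p dvd c 1"
    proof (rule ccontr)
      assume "\<not> int p dvd c 1"
      then obtain u k where u: "u * c 1 = 1 + int p * k" using prime_unit_mod[OF p] by blast
      have "smult u [:c 0, c 1:] - [:0, k:] * [:int p:] \<in> J"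
        by (intro is_ideal_diff smult_in_ideal is_ideal_mult J cJ)
      also have "smult u [:c 0, c 1:] - [:0, k:] * [:int p:] = [:- (- u * c 0), 1:]" using u by (simp add: mult.commute del: One_nat_def)
      finally show False using lin by blast
    qed
    then have c1: "c 1 = 0" using c by (intro small_int_dvd[of "int p"]) auto
    then have "[:c 0:] \<in> J" using cJ by simp
    then have "int p dvd c 0" by (rule ideal_const_dvd[OF J(1,3,4) p])
    then have "c 0 = 0" using c by (intro small_int_dvd[of "int p"]) auto
    with c1 show "\<forall>i\<in>{0, 1}. c i = 0" by simp
  qed simp
  then show ?thesis by (simp add: power2_eq_square)
qed

text \<open>Multiply a representation of \<open>1\<close> by \<open>l * z\<close>: only the term with \<open>v'\<close> survives. So \<open>v'\<close> acts on
\<open>l * z\<close> as an invertible element, while \<open>v\<close> annihilates it.\<close>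

lemma comaximal_unit:
  assumes one: "1 \<in> ideal3 h v v' p" and vz: "v * z \<in> mod_ideal p" and lh: "l * h \<in> mod_ideal p"
  shows "\<exists>b. l * z - b * v' * (l * z) \<in> mod_ideal p"
proof -
  obtain a b c e where "1 = v * a + v' * b + [:int p:] * c + h * e" using one unfolding ideal3_def by blast
  then have "l * z * 1 = l * z * (v * a + v' * b + [:int p:] * c + h * e)" by (rule arg_cong)
  then have "l * z - b * v' * (l * z) = (l * a) * (v * z) + (l * z * c) * [:int p:] + (z * e) * (l * h)"
    by (simp add: algebra_simps)
  also have "\<dots> \<in> mod_ideal p"
    by (intro is_ideal_add[OF is_ideal_mod] is_ideal_mult[OF is_ideal_mod] vz lh mod_ideal_mem)
  finally show ?thesis by blast
qed

text \<open>The nonzero elements \<open>\<zeta> i\<close> of the vector space \<open>A/pA\<close> of dimension \<open>degree f\<close> are linearly independent: multiplying a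
relation by \<open>\<Prod>j\<in>G - {i}. v j\<close> annihilates every \<open>\<zeta> j\<close> with \<open>j \<noteq> i\<close>, and acts invertibly on \<open>\<zeta> i\<close>.\<close>

lemma card_comaximal:
  assumes p: "prime p" "int p > (2 * K) ^ degree f" and fin: "finite G"
    and \<zeta>: "\<And>i. i \<in> G \<Longrightarrow> \<zeta> i \<notin> mod_ideal p" "\<And>i. i \<in> G \<Longrightarrow> v i * \<zeta> i \<in> mod_ideal p"
    and co: "\<And>i j. i \<in> G \<Longrightarrow> j \<in> G \<Longrightarrow> i \<noteq> j \<Longrightarrow> \<exists>b. \<zeta> i - b * v j * \<zeta> i \<in> mod_ideal p"
  shows "card G \<le> degree f"
proof -
  have p1: "p > 1" by (rule prime_gt_1_nat[OF p(1)])
  note M = is_ideal_mod[of p]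
  have "int (\<Prod>i\<in>G. p) \<le> (2 * K * int p) ^ degree f"
  proof (rule index_bound[OF M mod_ideal_mem, where e = \<zeta>])
    show "coeffs_le (int p) [:int p:]"
      unfolding coeffs_le_def by (auto simp: coeff_pCons split: nat.split)
    fix c assume c: "\<forall>i\<in>G. \<bar>c i\<bar> < int p" and S: "(\<Sum>i\<in>G. smult (c i) (\<zeta> i)) \<in> mod_ideal p"
    show "\<forall>i\<in>G. c i = 0"
    proof
      fix i assume i: "i \<in> G"
      \<comment> \<open>The factors \<open>v j\<close> can be cancelled one by one in front of \<open>\<zeta> i\<close>.\<close>
      have del: "g * \<zeta> i \<in> mod_ideal p" if "finite H" "H \<subseteq> G - {i}" "(\<Prod>j\<in>H. v j) * (g * \<zeta> i) \<in> mod_ideal p" for g H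
        using that
      proof (induction H rule: finite_induct)
        case empty
        then show ?case by simp
      next
        case (insert j H)
        obtain b where b: "\<zeta> i - b * v j * \<zeta> i \<in> mod_ideal p" using co[OF i, of j] insert.prems by auto
        let ?P = "\<Prod>j\<in>H. v j"
        have "(?P * g) * (\<zeta> i - b * v j * \<zeta> i) + b * ((\<Prod>j\<in>insert j H. v j) * (g * \<zeta> i)) \<in> mod_ideal p"
          by (intro is_ideal_add[OF M] is_ideal_mult[OF M] b insert.prems)
        also have "(?P * g) * (\<zeta> i - b * v j * \<zeta> i) + b * ((\<Prod>j\<in>insert j H. v j) * (g * \<zeta> i)) = ?P * (g * \<zeta> i)"
          using insert.hyps by (simp add: algebra_simps)
        finally show ?case using insert.IH insert.prems by simp
      qed
      let ?P = "\<Prod>j\<in>G - {i}. v j"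
      have "?P * (\<Sum>j\<in>G. smult (c j) (\<zeta> j)) \<in> mod_ideal p" by (intro is_ideal_mult[OF M] S)
      also have "?P * (\<Sum>j\<in>G. smult (c j) (\<zeta> j)) = ?P * ([:c i:] * \<zeta> i) + (\<Sum>j\<in>G - {i}. smult (c j) (?P * \<zeta> j))"
        by (simp add: sum.remove[OF fin i] distrib_left sum_distrib_left)
      finally have 1: "?P * ([:c i:] * \<zeta> i) + (\<Sum>j\<in>G - {i}. smult (c j) (?P * \<zeta> j)) \<in> mod_ideal p" .
      have sumM: "(\<Sum>j\<in>H. smult (c j) (?P * \<zeta> j)) \<in> mod_ideal p" if "H \<subseteq> G - {i}" for H
        using finite_subset[OF that finite_Diff[OF fin]] that
      proof (induction H rule: finite_induct)
        case empty
        show ?case using is_ideal_mult[OF M mod_ideal_mem(1), of 0] by simp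
      next
        case (insert j H)
        have j: "j \<in> G - {i}" using insert.prems by simp
        have eq: "?P * \<zeta> j = (\<Prod>k\<in>G - {i} - {j}. v k) * (v j * \<zeta> j)"
          using prod.remove[of "G - {i}" j v] fin j by (simp add: mult_ac)
        have "?P * \<zeta> j \<in> mod_ideal p" unfolding eq by (intro is_ideal_mult[OF M] \<zeta>(2)) (use j in simp)
        then show ?case using insert by (simp add: is_ideal_add[OF M] smult_in_ideal[OF M])
      qed
      have "?P * ([:c i:] * \<zeta> i) \<in> mod_ideal p"
        using is_ideal_diff[OF M 1 sumM[OF order_refl]] by simp
      then have "[:c i:] * \<zeta> i \<in> mod_ideal p" by (rule del[rotated 2]) (use fin in auto)
      then have "smult (c i) (\<zeta> i) \<in> mod_ideal p" by simp
      then have "int p dvd c i"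
        using ideal_unit_cancel[OF M mod_ideal_mem(2) p(1)] \<zeta>(1)[OF i] by blast
      then show "c i = 0" using c i by (intro small_int_dvd[of "int p"]) auto
    qed
  qed (use p1 deg_pos fin in auto)
  then have "int p ^ card G \<le> (2 * K * int p) ^ degree f" by simp
  then show ?thesis by (rule power_root_bound[OF p(2) p1])
qed

end

section \<open>Counting the elements for which a prime is bad\<close>

context monic_prime_poly
begin

text \<open>If the ideal generated by \<open>v\<close>, \<open>v'\<close>, \<open>p\<close> and \<open>f\<close> were proper, it could not contain any \<open>X - s\<close>, since \<open>s\<close> would be
a common root of \<open>f\<close> and \<open>v\<close>. Then its index would be at least \<open>p\<^sup>2\<close>, which the small element \<open>w\<close> excludes.\<close>

lemma comaximal_no_root:
  assumes p: "prime p" and nr: "\<And>r. int p dvd poly f r \<Longrightarrow> int p dvd poly v r \<Longrightarrow> False"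
    and vz: "v * z \<in> mod_ideal p"
    and w: "w \<in> ideal3 f v v' p" "w \<noteq> 0" "degree w < degree f" "coeffs_le W w" "(2 * K * W) ^ degree f < (int p)\<^sup>2"
  shows "\<exists>b. z - b * v' * z \<in> mod_ideal p"
proof -
  note J = is_ideal_ideal3[of f v v' p]
  have "1 \<in> ideal3 f v v' p"
  proof (rule ccontr)
    assume no: "1 \<notin> ideal3 f v v' p"
    have "(int p)\<^sup>2 \<le> (2 * K * W) ^ degree f"
    proof (rule index_two[OF J ideal3_mem(4) ideal3_mem(3) no p _ w(1-4)])
      fix s show "[:- s, 1:] \<notin> ideal3 f v v' p"
      proof
        assume s: "[:- s, 1:] \<in> ideal3 f v v' p"
        have "int p dvd poly f s" "int p dvd poly v s"
          using ideal_const_dvd[OF J ideal3_mem(3) no p ideal_eval[OF J s]] ideal3_mem by blast+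
        then show False by (rule nr)
      qed
    qed
    then show False using w(5) by simp
  qed
  then have "\<exists>b. 1 * z - b * v' * (1 * z) \<in> mod_ideal p"
    by (rule comaximal_unit[OF _ vz]) (simp add: mod_ideal_mem)
  then show ?thesis by simp
qed

text \<open>At a common simple root \<open>s\<close>, everything is divided by \<open>X - s\<close>: the role of \<open>f\<close> is taken by the
cofactor \<open>h\<close>, which does not vanish at \<open>s\<close>. If the ideal generated by \<open>v\<close>, \<open>v'\<close>, \<open>p\<close> and \<open>h\<close> were proper,
its intersection with the polynomials vanishing at \<open>s\<close> modulo \<open>p\<close> would contain \<open>w\<close>
and have index at least \<open>p\<^sup>2\<close>.\<close>

lemma comaximal_simple_root:
  assumes p: "prime p" and h: "f = [:- s, 1:] * h + [:poly f s:]" "int p dvd poly f s" "\<not> int p dvd poly h s"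
    and r: "int p dvd poly v s" "int p dvd poly v' s" "int p dvd poly w s"
    and vz: "v * z \<in> mod_ideal p"
    and w: "w \<in> ideal3 h v v' p" "w \<noteq> 0" "degree w < degree f" "coeffs_le W w" "(2 * K * W) ^ degree f < (int p)\<^sup>2"
  shows "\<exists>b. [:- s, 1:] * z - b * v' * ([:- s, 1:] * z) \<in> mod_ideal p"
proof -
  define J0 where "J0 = ideal3 h v v' p"
  have J0: "is_ideal J0" unfolding J0_def by (rule is_ideal_ideal3)
  have pJ0: "[:int p:] \<in> J0" unfolding J0_def by (rule ideal3_mem)
  define E where "E = {g. int p dvd poly g s}"
  have E: "is_ideal E" unfolding E_def is_ideal_def by auto
  have J: "is_ideal (J0 \<inter> E)" by (rule is_ideal_Int[OF J0 E])
  obtain m where m: "poly f s = int p * m" using h(2) by (auto elim: dvdE)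
  have fs: "[:poly f s:] = [:int p:] * [:m:]" by (simp add: m)
  have fJ0: "f \<in> J0"
    by (subst h(1), subst fs) (intro is_ideal_add[OF J0] is_ideal_mult[OF J0] is_ideal_mult2[OF J0] pJ0, simp add: J0_def ideal3_mem)
  have fJ: "f \<in> J0 \<inter> E" using fJ0 h(2) by (simp add: E_def)
  have pJ: "[:int p:] \<in> J0 \<inter> E" using pJ0 by (simp add: E_def)
  have wJ: "w \<in> J0 \<inter> E" using w(1) r(3) by (simp add: E_def J0_def)
  have "1 \<in> J0"
  proof (rule ccontr)
    assume no: "1 \<notin> J0"
    then have no': "1 \<notin> J0 \<inter> E" by simp
    have "(int p)\<^sup>2 \<le> (2 * K * W) ^ degree f"
    proof (rule index_two[OF J fJ pJ no' p _ wJ w(2-4)])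
      fix u show "[:- u, 1:] \<notin> J0 \<inter> E"
      proof
        assume u: "[:- u, 1:] \<in> J0 \<inter> E"
        then have "int p dvd s - u" by (simp add: E_def)
        then obtain k where k: "s - u = int p * k" by (auto elim: dvdE)
        have "[:- u, 1:] - [:k:] * [:int p:] \<in> J0"
          using u by (intro is_ideal_diff[OF J0] is_ideal_mult[OF J0] pJ0) simp
        also have "[:- u, 1:] - [:k:] * [:int p:] = [:- s, 1:]" using k by (simp add: algebra_simps)
        finally have "[:- s, 1:] \<in> J0" .
        then have "[:poly h s:] \<in> J0" by (rule ideal_eval[OF J0]) (simp add: J0_def ideal3_mem)
        then have "int p dvd poly h s" by (rule ideal_const_dvd[OF J0 pJ0 no p])
        then show False using h(3) by simp
      qed
    qed
    then show False using w(5) by simp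
  qed
  then have one: "1 \<in> ideal3 h v v' p" by (simp add: J0_def)
  have "[:- s, 1:] * h = f - [:m:] * [:int p:]" using h(1) fs by (simp add: algebra_simps)
  also have "\<dots> \<in> mod_ideal p"
    by (intro is_ideal_diff[OF is_ideal_mod] is_ideal_mult[OF is_ideal_mod] mod_ideal_mem)
  finally show ?thesis by (rule comaximal_unit[OF one vz])
qed

lemma bad_witness_mem: "f dvd smult (int p) y - v * z \<Longrightarrow> v * z \<in> mod_ideal p"
proof -
  assume "f dvd smult (int p) y - v * z"
  then obtain k where k: "smult (int p) y - v * z = f * k" by (auto elim: dvdE)
  then have "v * z = f * (- k) + [:int p:] * y" by (simp add: algebra_simps)
  then show ?thesis unfolding mod_ideal_def by blast
qed

text \<open>Suppose \<open>(X - s) * z\<close> is zero modulo \<open>p\<close>. Then \<open>z\<close> is modulo \<open>p\<close> a multiple \<open>c * h\<close> of the cofactor,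
because \<open>h\<close> does not vanish at \<open>s\<close>. Inserting this into \<open>p * y = v * z\<close> and dividing by \<open>p\<close>, which
is possible because \<open>p\<^sup>2\<close> divides \<open>poly f s\<close>, gives \<open>y(s) \<equiv> c * (v(s)/p) * h(s)\<close> modulo \<open>p\<close>. The left
side vanishes and \<open>p\<^sup>2\<close> does not divide \<open>v(s)\<close>, so \<open>p\<close> divides \<open>c\<close> and \<open>z\<close> is zero modulo \<open>p\<close>.\<close>

lemma simple_root_witness:
  assumes p: "prime p" and h: "f = [:- s, 1:] * h + [:poly f s:]" "(int p)\<^sup>2 dvd poly f s" "\<not> int p dvd poly h s"
    and v: "int p dvd poly v s" "\<not> (int p)\<^sup>2 dvd poly v s"
    and yz: "f dvd smult (int p) y - v * z" "z \<notin> mod_ideal p" "int p dvd poly y s"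
  shows "[:- s, 1:] * z \<notin> mod_ideal p"
proof
  assume lz: "[:- s, 1:] * z \<in> mod_ideal p"
  note M = is_ideal_mod[of p]
  have p0: "int p \<noteq> 0" using prime_gt_0_nat[OF p] by simp
  obtain n where n: "poly f s = (int p)\<^sup>2 * n" using h(2) by (auto elim: dvdE)
  obtain m where m: "poly v s = int p * m" using v(1) by (auto elim: dvdE)
  have pm: "\<not> int p dvd m" using v(2) m by (auto simp: power2_eq_square)
  obtain g where g: "h = [:- s, 1:] * g + [:poly h s:]" using synthetic_div by blast
  obtain k where k: "z = [:- s, 1:] * k + [:poly z s:]" using synthetic_div by blast
  obtain v1 where v1: "v = [:- s, 1:] * v1 + [:poly v s:]" using synthetic_div by blast
  obtain u j where u: "u * poly h s = 1 + int p * j" using prime_unit_mod[OF p h(3)] by blast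
  define c where "c = u * poly z s"
  have lh: "[:- s, 1:] * h = f - [:(int p)\<^sup>2 * n:]" using h(1) n by (simp add: algebra_simps)
  have lhM: "[:- s, 1:] * h \<in> mod_ideal p"
  proof -
    have "[:- s, 1:] * h = f - [:int p * n:] * [:int p:]" unfolding lh by (simp add: power2_eq_square mult_ac)
    also have "\<dots> \<in> mod_ideal p" by (intro is_ideal_diff[OF M] is_ideal_mult[OF M] mod_ideal_mem)
    finally show ?thesis .
  qed
  have hz1: "h * z = g * ([:- s, 1:] * z) + smult (poly h s) z" by (subst g) (simp add: algebra_simps)
  have hz2: "h * z = k * ([:- s, 1:] * h) + smult (poly z s) h" by (subst k) (simp add: algebra_simps)
  have "smult (poly h s) z - smult (poly z s) h = k * ([:- s, 1:] * h) - g * ([:- s, 1:] * z)"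
    using hz1 hz2 by (simp add: algebra_simps)
  also have "\<dots> \<in> mod_ideal p" by (intro is_ideal_diff[OF M] is_ideal_mult[OF M] lhM lz)
  finally have d: "smult (poly h s) z - smult (poly z s) h \<in> mod_ideal p" .
  have "smult u (smult (poly h s) z - smult (poly z s) h) - [:j:] * z * [:int p:] \<in> mod_ideal p"
    by (rule is_ideal_diff[OF M smult_in_ideal[OF M d] is_ideal_mult[OF M mod_ideal_mem(2)]])
  also have "smult u (smult (poly h s) z - smult (poly z s) h) - [:j:] * z * [:int p:] = z - smult c h"
  proof -
    have "smult (u * poly h s) z = z + smult (int p * j) z" unfolding u by (simp add: smult_add_left)
    then show ?thesis by (simp add: smult_diff_right c_def mult.commute)
  qed
  finally have zc: "z - smult c h \<in> mod_ideal p" .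
  then obtain a b where ab: "z - smult c h = f * a + [:int p:] * b" unfolding mod_ideal_def by blast
  then have z: "z = smult c h + f * a + smult (int p) b" by (simp add: algebra_simps)
  have hv: "h * v = f * v1 + smult (int p) (smult m h - smult (int p * n) v1)"
  proof -
    have "h * v = ([:- s, 1:] * h) * v1 + smult (poly v s) h" by (subst v1) (simp add: algebra_simps)
    also have "\<dots> = f * v1 + smult (int p) (smult m h - smult (int p * n) v1)"
      unfolding lh m by (simp add: algebra_simps smult_diff_right power2_eq_square)
    finally show ?thesis .
  qed
  have "v * z = smult c (h * v) + f * (a * v) + smult (int p) (b * v)" unfolding z by (simp add: algebra_simps)
  also have "\<dots> = f * (smult c v1 + a * v) + smult (int p) (smult c (smult m h - smult (int p * n) v1) + b * v)"
    unfolding hv by (simp add: algebra_simps smult_add_right)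
  finally have "smult (int p) y - v * z + f * (smult c v1 + a * v)
     = smult (int p) (y - (smult c (smult m h - smult (int p * n) v1) + b * v))"
    by (simp add: smult_diff_right)
  moreover have "f dvd smult (int p) y - v * z + f * (smult c v1 + a * v)" using yz(1) by (intro dvd_add) auto
  ultimately have "f dvd smult (int p) (y - (smult c (smult m h - smult (int p * n) v1) + b * v))" by simp
  then have "f dvd y - (smult c (smult m h - smult (int p * n) v1) + b * v)" by (rule f_dvd_smult[OF _ p0])
  then have "poly f s dvd poly (y - (smult c (smult m h - smult (int p * n) v1) + b * v)) s"
    by (rule poly_dvd_poly)
  then have "int p dvd poly (y - (smult c (smult m h - smult (int p * n) v1) + b * v)) s"
    by (rule dvd_trans[rotated]) (simp add: n power2_eq_square)
  moreover have "poly (y - (smult c (smult m h - smult (int p * n) v1) + b * v)) s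
     = poly y s - c * m * poly h s + int p * (c * n * poly v1 s - m * poly b s)"
    by (simp add: m algebra_simps)
  ultimately have "int p dvd poly y s - c * m * poly h s" by (metis dvd_add_times_triv_right_iff mult.commute)
  then have "int p dvd c * m * poly h s" using yz(3) by (simp add: dvd_diff_right_iff)
  then have "int p dvd c" using pm h(3) p by (simp add: prime_dvd_mult_iff)
  then obtain e where e: "c = int p * e" by (auto elim: dvdE)
  have "z = (z - smult c h) + smult e h * [:int p:]" by (simp add: e mult.commute)
  also have "\<dots> \<in> mod_ideal p" by (intro is_ideal_add[OF M] zc is_ideal_mult[OF M] mod_ideal_mem)
  finally show False using yz(2) by simp
qed

text \<open>Roots modulo \<open>p\<^sup>2\<close>, one above each root of \<open>f\<close> modulo \<open>p\<close>. Only at such a root is it meaningful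
to ask whether \<open>p\<^sup>2\<close> divides the value of an element of \<open>A\<close>.\<close>

definition lifts :: "nat \<Rightarrow> int set" where
  "lifts p = (\<lambda>r. SOME s. int p dvd s - r \<and> (int p)\<^sup>2 dvd poly f s) ` roots_mod p"

definition regular_prime :: "nat \<Rightarrow> bool" where
  "regular_prime p \<longleftrightarrow> prime p \<and> int p > (2 * K) ^ degree f \<and>
     (\<forall>r. int p dvd poly f r \<longrightarrow> \<not> int p dvd poly (pderiv f) r)"

lemma card_lifts: "regular_prime p \<Longrightarrow> card (lifts p) \<le> degree f"
proof -
  assume p: "regular_prime p"
  have "card (lifts p) \<le> card (roots_mod p)" unfolding lifts_def by (intro card_image_le finite_roots_mod)
  also have "\<dots> \<le> degree f" using p by (intro card_roots_mod_small) (auto simp: regular_prime_def)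
  finally show ?thesis .
qed

lemma finite_lifts: "finite (lifts p)" unfolding lifts_def by (intro finite_imageI finite_roots_mod)

lemma dvd_poly_cong: "(int p) dvd s - r \<Longrightarrow> int p dvd poly g s \<longleftrightarrow> int p dvd poly g r"
proof -
  assume "int p dvd s - r"
  then have "int p dvd poly g s - poly g r" using dvd_poly_diff dvd_trans by blast
  then obtain k where "poly g s - poly g r = int p * k" by (auto elim: dvdE)
  then have "poly g s = poly g r + int p * k" by simp
  then show ?thesis by (simp add: dvd_add_left_iff)
qed

lemma lifts_ex:
  assumes p: "regular_prime p" and r: "int p dvd poly f r"
  shows "\<exists>s\<in>lifts p. int p dvd s - r"
proof -
  have p0: "p > 0" using p prime_gt_0_nat by (auto simp: regular_prime_def)
  define r' where "r' = r mod int p"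
  have rr: "int p dvd r' - r" unfolding r'_def by (simp add: mod_eq_dvd_iff[symmetric])
  have fr': "int p dvd poly f r'" using dvd_poly_cong[OF rr] r by simp
  have r': "r' \<in> roots_mod p" using fr' p0 unfolding roots_mod_def r'_def by simp
  have "\<exists>s. int p dvd s - r' \<and> (int p)\<^sup>2 dvd poly f s"
    using p fr' by (intro lift_simple_root) (auto simp: regular_prime_def)
  from someI_ex[OF this] have "int p dvd (SOME s. int p dvd s - r' \<and> (int p)\<^sup>2 dvd poly f s) - r'" by blast
  from dvd_add[OF this rr] show ?thesis using r' unfolding lifts_def by auto
qed

lemma lifts_root: assumes p: "regular_prime p" and s: "s \<in> lifts p" shows "(int p)\<^sup>2 dvd poly f s"
proof -
  obtain r where r: "r \<in> roots_mod p" "s = (SOME s. int p dvd s - r \<and> (int p)\<^sup>2 dvd poly f s)"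
    using s unfolding lifts_def by blast
  have "\<exists>s. int p dvd s - r \<and> (int p)\<^sup>2 dvd poly f s"
    using p r(1) by (intro lift_simple_root) (auto simp: regular_prime_def roots_mod_def)
  from someI_ex[OF this] show ?thesis using r(2) by blast
qed

lemma cofactor_root:
  assumes p: "regular_prime p" and s: "(int p)\<^sup>2 dvd poly f s" and h: "f = [:- s, 1:] * h + [:poly f s:]"
  shows "\<not> int p dvd poly h s"
proof -
  have "pderiv f = pderiv ([:- s, 1:] * h + [:poly f s:])" by (rule arg_cong[OF h])
  also have "\<dots> = [:- s, 1:] * pderiv h + h * [:1:]"
    by (simp only: pderiv_add pderiv_mult) (simp add: pderiv_pCons)
  finally have "poly (pderiv f) s = poly h s" by simp
  moreover have "int p dvd poly f s" using s by (rule dvd_trans[rotated]) (simp add: power2_eq_square)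
  ultimately show ?thesis using p unfolding regular_prime_def by metis
qed

text \<open>The polynomials \<open>g\<close> with \<open>p\<^sup>2 dvd poly g s\<close> form an ideal of index \<open>p\<^sup>2\<close>.\<close>

lemma index_square:
  assumes p: "prime p" and s: "(int p)\<^sup>2 dvd poly f s" "(int p)\<^sup>2 dvd poly w s"
    and w: "w \<noteq> 0" "degree w < degree f" "coeffs_le W w"
  shows "(int p)\<^sup>2 \<le> (2 * K * W) ^ degree f"
proof -
  define J where "J = {g. (int p)\<^sup>2 dvd poly g s}"
  have J: "is_ideal J" unfolding J_def is_ideal_def by auto
  have "int (\<Prod>i\<in>{()}. p\<^sup>2) \<le> (2 * K * W) ^ degree f"
  proof (rule index_bound[OF J _ _ w, where e = "\<lambda>_. 1"])
    fix c :: "unit \<Rightarrow> int" assume c: "\<forall>i\<in>{()}. \<bar>c i\<bar> < int (p\<^sup>2)" and "(\<Sum>i\<in>{()}. smult (c i) 1) \<in> J"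
    then have "(int p)\<^sup>2 dvd c ()" by (simp add: J_def)
    then have "c () = 0" using c by (intro small_int_dvd[of "(int p)\<^sup>2"]) auto
    then show "\<forall>i\<in>{()}. c i = 0" by simp
  qed (use s in \<open>auto simp: J_def\<close>)
  then show ?thesis by simp
qed

text \<open>Suppose that \<open>p\<^sup>2\<close> exceeds the bound on the index of \<open>v A\<close>. Then \<open>p\<^sup>2\<close> does not divide the value of \<open>v\<close> at a lifted
root, and the element \<open>v\<close> itself can serve as the small element \<open>w\<close> in the
comaximality lemmas, with \<open>v' = v\<close>. So \<open>v\<close> both annihilates and acts invertibly on a
nonzero witness of badness.\<close>

lemma bad_index:
  assumes p: "regular_prime p" and b: "bad p v" and v: "v \<noteq> 0" "degree v < degree f" "coeffs_le V v"
  shows "(int p)\<^sup>2 \<le> (2 * K * V) ^ degree f"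
proof (rule ccontr)
  assume "\<not> ?thesis"
  then have small: "(2 * K * V) ^ degree f < (int p)\<^sup>2" by simp
  have pr: "prime p" using p by (simp add: regular_prime_def)
  note M = is_ideal_mod[of p]
  obtain y z where yz: "f dvd smult (int p) y - v * z" "z \<notin> mod_ideal p"
    "\<And>r. int p dvd poly f r \<Longrightarrow> int p dvd poly v r \<Longrightarrow> int p dvd poly y r"
    using b unfolding bad_def by blast
  have vz: "v * z \<in> mod_ideal p" by (rule bad_witness_mem[OF yz(1)])
  have kill: "\<zeta> \<in> mod_ideal p" if "v * \<zeta> \<in> mod_ideal p" "\<zeta> - b * v * \<zeta> \<in> mod_ideal p" for \<zeta> b
  proof -
    have "(\<zeta> - b * v * \<zeta>) + b * (v * \<zeta>) \<in> mod_ideal p"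
      by (intro is_ideal_add[OF M] is_ideal_mult[OF M] that)
    then show ?thesis by (simp add: mult.assoc)
  qed
  show False
  proof (cases "\<exists>r. int p dvd poly f r \<and> int p dvd poly v r")
    case False
    then have "\<exists>b. z - b * v * z \<in> mod_ideal p"
      by (intro comaximal_no_root[OF pr _ vz ideal3_mem(1) v small]) auto
    then show False using kill[OF vz] yz(2) by blast
  next
    case True
    then obtain r where r: "int p dvd poly f r" "int p dvd poly v r" by blast
    obtain s where s: "s \<in> lifts p" "int p dvd s - r" using lifts_ex[OF p r(1)] by blast
    have fs: "(int p)\<^sup>2 dvd poly f s" by (rule lifts_root[OF p s(1)])
    have fs': "int p dvd poly f s" and vs: "int p dvd poly v s" using r dvd_poly_cong[OF s(2)] by auto
    obtain h where h: "f = [:- s, 1:] * h + [:poly f s:]" using synthetic_div by blast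
    have hs: "\<not> int p dvd poly h s" by (rule cofactor_root[OF p fs h])
    show False
    proof (cases "(int p)\<^sup>2 dvd poly v s")
      case True
      then show False using index_square[OF pr fs True v] small by simp
    next
      case False
      have 1: "[:- s, 1:] * z \<notin> mod_ideal p"
        by (rule simple_root_witness[OF pr h fs hs vs False yz(1,2) yz(3)[OF fs' vs]])
      have "\<exists>b. [:- s, 1:] * z - b * v * ([:- s, 1:] * z) \<in> mod_ideal p"
        by (rule comaximal_simple_root[OF pr h fs' hs vs vs vs vz ideal3_mem(1) v small])
      moreover have "v * ([:- s, 1:] * z) \<in> mod_ideal p"
        using is_ideal_mult[OF M vz, of "[:- s, 1:]"] by (simp add: mult.left_commute)
      ultimately show False using kill 1 by blast
    qed
  qed
qed

text \<open>Since \<open>p\<close> does not divide \<open>B\<close>, the small element \<open>w\<close> lies in every ideal containing \<open>p\<close>, \<open>v\<close> and \<open>v'\<close>. The set \<open>G\<close> is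
covered by three kinds of elements \<open>v\<close>: those without a common root with \<open>f\<close> modulo \<open>p\<close>; for each
lifted root \<open>s\<close>, those with \<open>p\<^sup>2\<close> dividing \<open>v(s)\<close>, of which there is at most one because the ideal
belonging to \<open>s\<close> has index \<open>p\<^sup>2\<close>; and those with \<open>p\<close> but not \<open>p\<^sup>2\<close> dividing \<open>v(s)\<close>. In the
first and third kind the witnesses of badness are linearly independent in \<open>A/pA\<close>.\<close>

lemma card_close_bad:
  assumes p: "regular_prime p" and B: "\<not> int p dvd B" and fin: "finite G"
    and bad: "\<And>v. v \<in> G \<Longrightarrow> bad p v"
    and close: "\<And>v v'. v \<in> G \<Longrightarrow> v' \<in> G \<Longrightarrow> v \<noteq> v' \<Longrightarrow>
      \<exists>w W. v - v' = smult B w \<and> w \<noteq> 0 \<and> degree w < degree f \<and> coeffs_le W w \<and> (2 * K * W) ^ degree f < (int p)\<^sup>2"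
  shows "card G \<le> degree f * (degree f + 2)"
proof -
  have pr: "prime p" and big: "int p > (2 * K) ^ degree f" using p by (auto simp: regular_prime_def)
  note M = is_ideal_mod[of p]
  define N where "N = {v \<in> G. \<not> (\<exists>r. int p dvd poly f r \<and> int p dvd poly v r)}"
  define A where "A s = {v \<in> G. (int p)\<^sup>2 dvd poly v s}" for s
  define C where "C s = {v \<in> G. int p dvd poly v s \<and> \<not> (int p)\<^sup>2 dvd poly v s}" for s
  have "\<forall>v\<in>G. \<exists>y z. f dvd smult (int p) y - v * z \<and> z \<notin> mod_ideal p \<and>
     (\<forall>r. int p dvd poly f r \<and> int p dvd poly v r \<longrightarrow> int p dvd poly y r)"
    using bad unfolding bad_def by blast
  then obtain y z where yz: "\<And>v. v \<in> G \<Longrightarrow> f dvd smult (int p) (y v) - v * z v" "\<And>v. v \<in> G \<Longrightarrow> z v \<notin> mod_ideal p"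
    "\<And>v r. v \<in> G \<Longrightarrow> int p dvd poly f r \<Longrightarrow> int p dvd poly v r \<Longrightarrow> int p dvd poly (y v) r"
    by metis
  have vz: "v * z v \<in> mod_ideal p" if "v \<in> G" for v by (rule bad_witness_mem[OF yz(1)[OF that]])
  have wmem: "w \<in> ideal3 h v v' p" if "v - v' = smult B w" for h v v' w
  proof (rule ideal_unit_cancel[OF is_ideal_ideal3 ideal3_mem(3) pr B])
    show "smult B w \<in> ideal3 h v v' p" unfolding that[symmetric]
      by (intro is_ideal_diff[OF is_ideal_ideal3] ideal3_mem)
  qed
  have cN: "card N \<le> degree f"
  proof (rule card_comaximal[OF pr big, where \<zeta> = z and v = "\<lambda>v. v"])
    fix i j assume ij: "i \<in> N" "j \<in> N" "i \<noteq> j"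
    then have ij': "i \<in> G" "j \<in> G" by (auto simp: N_def)
    from close[OF ij' ij(3)] obtain w W where w: "i - j = smult B w" "w \<noteq> 0" "degree w < degree f" "coeffs_le W w" "(2 * K * W) ^ degree f < (int p)\<^sup>2"
      by blast
    show "\<exists>b. z i - b * j * z i \<in> mod_ideal p"
      by (rule comaximal_no_root[OF pr _ vz wmem[OF w(1)] w(2-)]) (use ij ij' in \<open>auto simp: N_def\<close>)
  qed (use fin yz vz in \<open>auto simp: N_def\<close>)
  have cA: "card (A s) \<le> 1" if s: "s \<in> lifts p" for s
  proof -
    have "v = v'" if v: "v \<in> A s" "v' \<in> A s" for v v'
    proof (rule ccontr)
      assume "v \<noteq> v'"
      moreover have "v \<in> G" "v' \<in> G" using v by (auto simp: A_def)
      ultimately obtain w W where w: "v - v' = smult B w" "w \<noteq> 0" "degree w < degree f" "coeffs_le W w" "(2 * K * W) ^ degree f < (int p)\<^sup>2"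
        using close[of v v'] by blast
      have "(int p)\<^sup>2 dvd poly (v - v') s" using v by (simp add: A_def)
      then have "(int p)\<^sup>2 dvd B * poly w s" by (simp add: w(1))
      moreover have "coprime ((int p)\<^sup>2) B" using B pr by (simp add: prime_imp_coprime)
      ultimately have "(int p)\<^sup>2 dvd poly w s" by (simp add: coprime_dvd_mult_right_iff)
      then show False using index_square[OF pr lifts_root[OF p s] _ w(2-4)] w(5) by simp
    qed
    then have "\<forall>v\<in>A s. \<forall>v'\<in>A s. v = v'" by blast
    moreover have "finite (A s)" using fin by (simp add: A_def)
    ultimately show ?thesis by (simp add: card_le_Suc0_iff_eq)
  qed
  have cC: "card (C s) \<le> degree f" if s: "s \<in> lifts p" for s
  proof -
    have fs: "(int p)\<^sup>2 dvd poly f s" by (rule lifts_root[OF p s])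
    then have fs': "int p dvd poly f s" by (rule dvd_trans[rotated]) (simp add: power2_eq_square)
    obtain h where h: "f = [:- s, 1:] * h + [:poly f s:]" using synthetic_div by blast
    have hs: "\<not> int p dvd poly h s" by (rule cofactor_root[OF p fs h])
    show ?thesis
    proof (rule card_comaximal[OF pr big, where \<zeta> = "\<lambda>v. [:- s, 1:] * z v" and v = "\<lambda>v. v"])
      show "finite (C s)" using fin by (simp add: C_def)
      fix i assume i: "i \<in> C s"
      then have iG: "i \<in> G" "int p dvd poly i s" "\<not> (int p)\<^sup>2 dvd poly i s" by (auto simp: C_def)
      show "[:- s, 1:] * z i \<notin> mod_ideal p"
        by (rule simple_root_witness[OF pr h fs hs iG(2,3) yz(1,2)[OF iG(1)] yz(3)[OF iG(1) fs' iG(2)]])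
      show "i * ([:- s, 1:] * z i) \<in> mod_ideal p"
        using is_ideal_mult[OF M vz[OF iG(1)], of "[:- s, 1:]"] by (simp add: mult.left_commute)
      fix j assume j: "j \<in> C s" "i \<noteq> j"
      then have jG: "j \<in> G" "int p dvd poly j s" by (auto simp: C_def)
      obtain w W where w: "i - j = smult B w" "w \<noteq> 0" "degree w < degree f" "coeffs_le W w" "(2 * K * W) ^ degree f < (int p)\<^sup>2"
        using close[OF iG(1) jG(1) j(2)] by blast
      have "int p dvd poly (i - j) s" using iG jG by simp
      then have "int p dvd B * poly w s" by (simp add: w(1))
      then have ws: "int p dvd poly w s" using B pr by (simp add: prime_dvd_mult_iff)
      show "\<exists>b. [:- s, 1:] * z i - b * j * ([:- s, 1:] * z i) \<in> mod_ideal p"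
        by (rule comaximal_simple_root[OF pr h fs' hs iG(2) jG(2) ws vz[OF iG(1)] wmem[OF w(1)] w(2-)])
    qed
  qed
  have "G \<subseteq> N \<union> (\<Union>s\<in>lifts p. A s \<union> C s)"
  proof
    fix v assume v: "v \<in> G"
    show "v \<in> N \<union> (\<Union>s\<in>lifts p. A s \<union> C s)"
    proof (cases "\<exists>r. int p dvd poly f r \<and> int p dvd poly v r")
      case True
      then obtain r where r: "int p dvd poly f r" "int p dvd poly v r" by blast
      obtain s where s: "s \<in> lifts p" "int p dvd s - r" using lifts_ex[OF p r(1)] by blast
      have "int p dvd poly v s" using r dvd_poly_cong[OF s(2)] by auto
      then show ?thesis using v s(1) by (auto simp: A_def C_def)
    qed (use v in \<open>simp add: N_def\<close>)
  qed
  then have "card G \<le> card (N \<union> (\<Union>s\<in>lifts p. A s \<union> C s))"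
    using fin finite_lifts by (intro card_mono) (auto simp: N_def A_def C_def)
  also have "\<dots> \<le> card N + card (\<Union>s\<in>lifts p. A s \<union> C s)" by (rule card_Un_le)
  also have "card (\<Union>s\<in>lifts p. A s \<union> C s) \<le> (\<Sum>s\<in>lifts p. card (A s \<union> C s))"
    by (rule card_UN_le[OF finite_lifts])
  also have "\<dots> \<le> (\<Sum>s\<in>lifts p. 1 + degree f)"
    by (intro sum_mono order_trans[OF card_Un_le] add_mono cA cC)
  also have "\<dots> \<le> degree f * (1 + degree f)" using mult_le_mono1[OF card_lifts[OF p], of "1 + degree f"] by simp
  finally have "card G \<le> card N + degree f * (1 + degree f)" by simp
  also have "\<dots> \<le> degree f * (degree f + 2)" using cN by (simp add: algebra_simps)
  finally show ?thesis .
qed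

end

lemma sum_inverse_squares_tail:
  assumes "P > 0" "finite A" "\<And>n. n \<in> A \<Longrightarrow> n > P"
  shows "(\<Sum>n\<in>A. 1 / (real n)\<^sup>2) \<le> 1 / real P"
proof -
  have tele: "(\<Sum>n\<in>{P<..P + m}. 1 / (real n)\<^sup>2) \<le> 1 / real P - 1 / real (P + m)" for m
  proof (induction m)
    case (Suc m)
    have "{P<..P + Suc m} = insert (P + Suc m) {P<..P + m}" by auto
    then have "(\<Sum>n\<in>{P<..P + Suc m}. 1 / (real n)\<^sup>2) = 1 / (real (P + Suc m))\<^sup>2 + (\<Sum>n\<in>{P<..P + m}. 1 / (real n)\<^sup>2)"
      by simp
    also have "\<dots> \<le> 1 / (real (P + Suc m))\<^sup>2 + (1 / real P - 1 / real (P + m))" using Suc.IH by simp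
    also have "1 / (real (P + Suc m))\<^sup>2 \<le> 1 / real (P + m) - 1 / real (P + Suc m)"
    proof -
      have "1 / real (P + m) - 1 / real (P + Suc m) = 1 / (real (P + m) * real (P + Suc m))"
        using assms(1) by (simp add: field_simps)
      also have "\<dots> \<ge> 1 / (real (P + Suc m))\<^sup>2"
        unfolding power2_eq_square using assms(1) by (intro divide_left_mono mult_right_mono) auto
      finally show ?thesis .
    qed
    finally show ?case by simp
  qed simp
  obtain m where m: "\<And>n. n \<in> A \<Longrightarrow> n \<le> m" using assms(2) finite_nat_set_iff_bounded_le[of A] by auto
  have "(\<Sum>n\<in>A. 1 / (real n)\<^sup>2) \<le> (\<Sum>n\<in>{P<..P + m}. 1 / (real n)\<^sup>2)"
    using assms(3) m by (intro sum_mono2) (auto simp: trans_le_add2)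
  also have "\<dots> \<le> 1 / real P - 1 / real (P + m)" by (rule tele)
  also have "\<dots> \<le> 1 / real P" by simp
  finally show ?thesis .
qed

lemma add_power_le: "0 \<le> (a::real) \<Longrightarrow> (a + 1) ^ n \<le> 2 ^ n * (a ^ n + 1)"
proof -
  assume a: "0 \<le> a"
  have "(a + 1) ^ n \<le> (2 * max a 1) ^ n" using a by (intro power_mono) auto
  also have "\<dots> = 2 ^ n * (max a 1) ^ n" by (rule power_mult_distrib)
  also have "(max a 1) ^ n \<le> a ^ n + 1" using a by (cases "a \<le> 1") (auto simp: max_def)
  finally show ?thesis by simp
qed

context monic_prime_poly
begin

definition bad_const :: real where
  "bad_const = real (degree f * (degree f + 2)) * 2 ^ degree f"

text \<open>Cut the coefficient box into cells of side \<open>h\<close> with \<open>(2 * K * h) ^ degree f = p\<^sup>2\<close>. Elements of one cell are close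
in the sense of \<open>card_close_bad\<close>, so each cell contains boundedly many elements for which \<open>p\<close> is bad.\<close>

lemma bad_count:
  assumes p: "regular_prime p" and B: "\<not> int p dvd B" and X: "X > 0"
  shows "real (card {y \<in> coeff_box X. bad p ([:t:] + smult B y)})
    \<le> bad_const * (1 + (2 * real_of_int K) ^ degree f * real X ^ degree f / (real p)\<^sup>2)"
proof -
  define d where "d = degree f"
  have d: "d > 0" using deg_pos by (simp add: d_def)
  define k where "k = real_of_int K"
  have k: "k \<ge> 1" using K_ge_1 by (simp add: k_def)
  have p0: "p > 0" using p prime_gt_0_nat by (simp add: regular_prime_def)
  have B0: "B \<noteq> 0" using B by auto
  define h where "h = (real p)\<^sup>2 powr (1 / d) / (2 * k)"
  have h: "h > 0" using p0 k by (simp add: h_def)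
  have hd: "(2 * k * h) ^ d = (real p)\<^sup>2"
  proof -
    have q: "(real p)\<^sup>2 > 0" using p0 by simp
    have "2 * k * h = (real p)\<^sup>2 powr (1 / d)" using k by (simp add: h_def)
    then have "(2 * k * h) ^ d = ((real p)\<^sup>2 powr (1 / d)) ^ d" by simp
    also have "\<dots> = ((real p)\<^sup>2 powr (1 / d)) powr real d" using q by (intro powr_realpow[symmetric]) simp
    also have "\<dots> = (real p)\<^sup>2 powr (1 / d * real d)" by (rule powr_powr)
    also have "\<dots> = (real p)\<^sup>2" using d q by simp
    finally show ?thesis .
  qed
  define Y where "Y = {y \<in> coeff_box X. bad p ([:t:] + smult B y)}"
  have finY: "finite Y" by (simp add: Y_def finite_coeff_box)
  define \<kappa> where "\<kappa> y = (\<lambda>i\<in>{..<d}. nat \<lfloor>real_of_int (coeff y i) / h\<rfloor>)" for y :: "int poly"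
  define m where "m = nat \<lfloor>real X / h\<rfloor>"
  have img: "\<kappa> ` Y \<subseteq> {..<d} \<rightarrow>\<^sub>E {..m}"
  proof (rule image_subsetI)
    fix y assume "y \<in> Y"
    then have y: "0 \<le> coeff y i \<and> coeff y i < int X" for i using X coeff_box_coeff[of y X i] by (auto simp: Y_def)
    have "nat \<lfloor>real_of_int (coeff y i) / h\<rfloor> \<le> m" for i
    proof -
      have "real_of_int (coeff y i) \<le> real X" using y[of i] by linarith
      then show ?thesis unfolding m_def using h by (intro nat_mono floor_mono divide_right_mono) auto
    qed
    then show "\<kappa> y \<in> {..<d} \<rightarrow>\<^sub>E {..m}" unfolding \<kappa>_def by auto
  qed
  have fiber: "card {y \<in> Y. \<kappa> y = c} \<le> d * (d + 2)" for c
  proof -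
    let ?F = "{y \<in> Y. \<kappa> y = c}"
    let ?\<phi> = "\<lambda>y. [:t:] + smult B y"
    have inj: "inj_on ?\<phi> ?F"
    proof (rule inj_onI)
      fix x y assume "?\<phi> x = ?\<phi> y"
      then have "smult B (x - y) = 0" by (simp add: smult_diff_right)
      then show "x = y" using B0 by simp
    qed
    have "card ?F = card (?\<phi> ` ?F)" by (rule card_image[OF inj, symmetric])
    also have "\<dots> \<le> degree f * (degree f + 2)"
    proof (rule card_close_bad[OF p B])
      show "finite (?\<phi> ` ?F)" using finY by simp
      show "bad p v" if "v \<in> ?\<phi> ` ?F" for v using that by (auto simp: Y_def)
      fix v v' assume v: "v \<in> ?\<phi> ` ?F" "v' \<in> ?\<phi> ` ?F" "v \<noteq> v'"
      then obtain y y' where y: "y \<in> Y" "y' \<in> Y" "\<kappa> y = \<kappa> y'" "v = ?\<phi> y" "v' = ?\<phi> y'" by auto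
      have yb: "y \<in> coeff_box X" "y' \<in> coeff_box X" using y by (auto simp: Y_def)
      \<comment> \<open>The largest integer strictly below \<open>h\<close>.\<close>
      define W where "W = \<lceil>h\<rceil> - 1"
      have Wh: "real_of_int W < h" "W \<ge> 0" using h unfolding W_def by linarith+
      have "\<bar>coeff (y - y') i\<bar> \<le> W" for i
      proof (cases "i < d")
        case True
        have c: "coeff y i \<ge> 0" "coeff y' i \<ge> 0" using yb X coeff_box_coeff by blast+
        have "nat \<lfloor>real_of_int (coeff y i) / h\<rfloor> = nat \<lfloor>real_of_int (coeff y' i) / h\<rfloor>"
          using fun_cong[OF y(3), of i] True by (simp add: \<kappa>_def)
        moreover have "\<lfloor>real_of_int (coeff y i) / h\<rfloor> \<ge> 0" "\<lfloor>real_of_int (coeff y' i) / h\<rfloor> \<ge> 0"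
          using c h by simp_all
        ultimately have "\<lfloor>real_of_int (coeff y i) / h\<rfloor> = \<lfloor>real_of_int (coeff y' i) / h\<rfloor>" by (simp add: nat_eq_iff)
        then have "\<bar>real_of_int (coeff y i) / h - real_of_int (coeff y' i) / h\<bar> < 1" by linarith
        then have "\<bar>real_of_int (coeff y i) - real_of_int (coeff y' i)\<bar> / h < 1"
          using h by (simp add: diff_divide_distrib[symmetric] abs_divide)
        then have "\<bar>real_of_int (coeff y i) - real_of_int (coeff y' i)\<bar> < h" using h by simp
        then show ?thesis unfolding W_def by (simp add: coeff_diff) linarith
      next
        case False
        then have "coeff y i = 0" "coeff y' i = 0"
          using coeff_box_degree[OF yb(1)] coeff_box_degree[OF yb(2)] by (simp_all add: d_def coeff_eq_0)
        then show ?thesis using Wh(2) by simp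
      qed
      then have 1: "coeffs_le W (y - y')" by (simp add: coeffs_le_def)
      have 2: "(2 * K * W) ^ degree f < (int p)\<^sup>2"
      proof -
        have "(2 * k * real_of_int W) ^ d < (2 * k * h) ^ d"
          using Wh k d by (intro power_strict_mono) auto
        then have "real_of_int ((2 * K * W) ^ degree f) < real_of_int ((int p)\<^sup>2)"
          unfolding hd by (simp add: k_def d_def)
        then show ?thesis by (simp only: of_int_less_iff)
      qed
      have 3: "v - v' = smult B (y - y')" using y by (simp add: smult_diff_right)
      have 4: "y - y' \<noteq> 0" using y v(3) by auto
      have 5: "degree (y - y') < degree f" using yb by (intro degree_diff_less coeff_box_degree)
      show "\<exists>w W. v - v' = smult B w \<and> w \<noteq> 0 \<and> degree w < degree f \<and> coeffs_le W w \<and> (2 * K * W) ^ degree f < (int p)\<^sup>2"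
        using 1 2 3 4 5 by blast
    qed
    finally show ?thesis by (simp add: d_def)
  qed
  have "Y = (\<Union>c\<in>\<kappa> ` Y. {y \<in> Y. \<kappa> y = c})" by auto
  then have "card Y \<le> (\<Sum>c\<in>\<kappa> ` Y. card {y \<in> Y. \<kappa> y = c})"
    using card_UN_le[of "\<kappa> ` Y" "\<lambda>c. {y \<in> Y. \<kappa> y = c}"] finY by simp
  also have "\<dots> \<le> card (\<kappa> ` Y) * (d * (d + 2))" using sum_bounded_above[of "\<kappa> ` Y" _ "d * (d + 2)"] fiber by simp
  also have "card (\<kappa> ` Y) \<le> card ({..<d} \<rightarrow>\<^sub>E {..m})" using img by (intro card_mono finite_PiE) auto
  also have "\<dots> = (m + 1) ^ d" by (simp add: card_PiE)
  finally have "card Y \<le> (m + 1) ^ d * (d * (d + 2))" by simp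
  then have "real (card Y) \<le> real ((m + 1) ^ d * (d * (d + 2)))" by (simp only: of_nat_le_iff)
  also have "\<dots> = real (d * (d + 2)) * (real m + 1) ^ d" by (simp add: add.commute)
  also have "\<dots> \<le> real (d * (d + 2)) * (real X / h + 1) ^ d"
    using h by (intro mult_left_mono power_mono) (auto simp: m_def)
  also have "\<dots> \<le> real (d * (d + 2)) * (2 ^ d * ((real X / h) ^ d + 1))"
    using h by (intro mult_left_mono add_power_le) auto
  also have "(real X / h) ^ d = (2 * k) ^ d * real X ^ d / (real p)\<^sup>2"
    unfolding hd[symmetric] using h k by (simp add: power_divide power_mult_distrib)
  finally show ?thesis by (simp add: Y_def bad_const_def d_def k_def add.commute mult.assoc)
qed

lemma not_bad_unit: "\<not> bad p (1 + smult (int p) g)"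
proof
  assume "bad p (1 + smult (int p) g)"
  then obtain y z where yz: "f dvd smult (int p) y - (1 + smult (int p) g) * z" "z \<notin> mod_ideal p"
    unfolding bad_def by blast
  note M = is_ideal_mod[of p]
  have "(1 + smult (int p) g) * z - (g * z) * [:int p:] \<in> mod_ideal p"
    by (intro is_ideal_diff[OF M] bad_witness_mem[OF yz(1)] is_ideal_mult[OF M] mod_ideal_mem)
  also have "(1 + smult (int p) g) * z - (g * z) * [:int p:] = z" by (simp add: algebra_simps)
  finally show False using yz(2) by simp
qed

text \<open>The large constant term dominates all other coefficients. This keeps the quotient of two such
elements small (\<open>cone_quotient\<close>). All these elements are congruent to \<open>1\<close> modulo
\<open>B\<close>, so no prime dividing \<open>B\<close> is bad for them.\<close>

definition cone :: "int \<Rightarrow> nat \<Rightarrow> int poly \<Rightarrow> int poly" where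
  "cone B X y = [:1 + B * (2 * K * int X):] + smult B y"

lemma cone_coeffs:
  assumes y: "y \<in> coeff_box X" and X: "X > 0" and B: "B \<ge> 1"
  shows "degree (cone B X y) < degree f" "cone B X y \<noteq> 0" "coeffs_le (3 * K * B * int X) (cone B X y)"
    "degree (1 + smult B y) < degree f" "coeffs_le (B * int X) (1 + smult B y)"
proof -
  have c: "0 \<le> coeff y i" "coeff y i \<le> int X - 1" for i using coeff_box_coeff[OF y X, of i] by auto
  have bc: "0 \<le> B * coeff y i" "B * coeff y i \<le> B * int X - B" for i
    using c[of i] B mult_left_mono[OF c(2)[of i], of B] by (auto simp: right_diff_distrib)
  have dy: "degree (smult B y) < degree f" by (rule le_less_trans[OF degree_smult_le coeff_box_degree[OF y]])
  show "degree (cone B X y) < degree f" "degree (1 + smult B y) < degree f"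
    unfolding cone_def using dy deg_pos by (auto intro!: degree_add_less)
  show e: "coeffs_le (B * int X) (1 + smult B y)"
    unfolding coeffs_le_def
  proof
    fix i
    have "coeff (1 + smult B y) i = (if i = 0 then 1 else 0) + B * coeff y i"
      by (cases i) (simp_all add: one_pCons)
    then have "0 \<le> coeff (1 + smult B y) i \<and> coeff (1 + smult B y) i \<le> B * int X"
      using bc[of i] c[of i] B by (cases "i = 0") auto
    then show "\<bar>coeff (1 + smult B y) i\<bar> \<le> B * int X" by linarith
  qed
  have BX: "0 \<le> B * int X" using B by simp
  have KB2: "B * int X \<le> K * (B * int X)" using mult_right_mono[OF K_ge_1 BX] by simp
  have KB: "0 \<le> B * (2 * K * int X)" using B K_ge_1 by (intro mult_nonneg_nonneg) simp_all
  have "coeffs_le (B * (2 * K * int X) + B * int X) ([:B * (2 * K * int X):] + (1 + smult B y))"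
  proof (rule coeffs_le_add[OF _ e])
    show "coeffs_le (B * (2 * K * int X)) [:B * (2 * K * int X):]"
      unfolding coeffs_le_def using KB by (auto simp: coeff_pCons split: nat.split)
  qed
  also have "[:B * (2 * K * int X):] + (1 + smult B y) = cone B X y"
    by (simp add: cone_def one_pCons add.assoc[symmetric])
  finally show "coeffs_le (3 * K * B * int X) (cone B X y)"
    by (rule coeffs_le_mono) (use KB2 in \<open>simp add: mult_ac\<close>)
  have "coeff (cone B X y) 0 = 1 + B * (2 * K * int X) + B * coeff y 0" by (simp add: cone_def)
  then have "coeff (cone B X y) 0 > 0" using KB bc(1)[of 0] by linarith
  then show "cone B X y \<noteq> 0" by auto
qed

text \<open>Let \<open>U\<close> be the largest coefficient of the quotient \<open>u\<close>, at position \<open>j\<close>. In \<open>v' = cone B X y * u\<close> the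
summand \<open>2 * K * B * X\<close> of the constant term contributes \<open>2 * K * B * X * U\<close> at \<open>j\<close>, and the rest of \<open>cone B X y\<close> at most half of
that, so \<open>K * B * X * U\<close> is bounded by a coefficient of \<open>v'\<close>.\<close>

lemma cone_quotient:
  assumes y: "y \<in> coeff_box X" and X: "X > 0" and B: "B \<ge> 1"
    and v': "degree v' < degree f" "coeffs_le (3 * K * B * int X') v'"
    and u: "f dvd v' - cone B X y * u" "degree u < degree f"
  shows "\<bar>coeff u i\<bar> * int X \<le> 3 * int X'"
proof -
  define U where "U = Max ((\<lambda>i. \<bar>coeff u i\<bar>) ` {..degree u})"
  have U: "\<bar>coeff u i\<bar> \<le> U" for i
  proof (cases "i \<le> degree u")
    case True
    then show ?thesis unfolding U_def by (intro Max_ge) auto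
  next
    case False
    have "\<bar>coeff u 0\<bar> \<le> U" unfolding U_def by (intro Max_ge) auto
    then show ?thesis using False by (simp add: coeff_eq_0)
  qed
  have "U \<in> (\<lambda>i. \<bar>coeff u i\<bar>) ` {..degree u}" unfolding U_def by (intro Max_in) auto
  then obtain j where j: "U = \<bar>coeff u j\<bar>" by auto
  let ?e = "1 + smult B y"
  have "coeffs_le U u" using U by (simp add: coeffs_le_def)
  then have eu: "coeffs_le (K * (B * int X) * U) (red (?e * u))"
    using cone_coeffs[OF y X B] u by (intro coeffs_le_red_mult) auto
  have "red v' = red (cone B X y * u)" by (rule red_cong[OF u(1)])
  also have "cone B X y * u = smult (B * (2 * K * int X)) u + ?e * u"
    by (simp add: cone_def one_pCons algebra_simps smult_add_left)
  finally have "v' = smult (B * (2 * K * int X)) u + red (?e * u)"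
    using v'(1) u(2) by (simp add: red_id red_add red_smult)
  then have "coeff v' j = (B * (2 * K * int X)) * coeff u j + coeff (red (?e * u)) j" by simp
  then have "(B * (2 * K * int X)) * coeff u j = coeff v' j - coeff (red (?e * u)) j" by simp
  then have "\<bar>(B * (2 * K * int X)) * coeff u j\<bar> \<le> \<bar>coeff v' j\<bar> + \<bar>coeff (red (?e * u)) j\<bar>" by linarith
  also have "\<dots> \<le> 3 * K * B * int X' + K * (B * int X) * U"
    by (intro add_mono coeffs_leD v'(2) eu)
  also have "\<bar>(B * (2 * K * int X)) * coeff u j\<bar> = 2 * (K * (B * int X) * U)"
    using B K_ge_1 by (simp add: abs_mult j)
  finally have "(K * B) * (int X * U) \<le> (K * B) * (3 * int X')" by (simp add: algebra_simps)
  moreover have "K * B > 0" using B K_ge_1 by simp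
  ultimately have "int X * U \<le> 3 * int X'" by (simp only: mult_le_cancel_left_pos)
  moreover have "\<bar>coeff u i\<bar> * int X \<le> U * int X" by (intro mult_right_mono U) simp
  ultimately show ?thesis by (simp add: mult.commute)
qed

definition good_set :: "int \<Rightarrow> nat \<Rightarrow> int poly set" where
  "good_set B X = {y \<in> coeff_box X. \<forall>p. prime p \<longrightarrow> \<not> bad p (cone B X y)}"

text \<open>At most half of the box is lost. Only primes \<open>p > P\<close> can be bad, and by \<open>bad_index\<close> only
those with \<open>p\<^sup>2 \<le> Q\<close>, where \<open>Q\<close> is of order \<open>X ^ degree f\<close>. Summing \<open>bad_count\<close> over them, its constant term contributes
at most \<open>bad_const * sqrt Q\<close>, which is small for large \<open>X\<close>, and its other term a multiple of
\<open>X ^ degree f * (\<Sum>p>P. 1/p\<^sup>2)\<close>, which is small for large \<open>P\<close>.\<close>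

lemma card_good_set:
  assumes reg: "\<And>p. prime p \<Longrightarrow> p > P \<Longrightarrow> regular_prime p"
    and P: "real P \<ge> 4 * bad_const * (2 * real_of_int K) ^ degree f" "P > 0"
    and B: "B = int (\<Prod>p | prime p \<and> p \<le> P. p)"
    and X: "real X \<ge> (4 * bad_const)\<^sup>2 * (6 * (real_of_int K)\<^sup>2 * real_of_int B) ^ degree f" "X > 0"
  shows "real X ^ degree f / 2 \<le> real (card (good_set B X))"
proof -
  define d where "d = degree f"
  have d: "d > 0" using deg_pos by (simp add: d_def)
  define k where "k = real_of_int K"
  have k: "k \<ge> 1" using K_ge_1 by (simp add: k_def)
  have finP: "finite {p. prime p \<and> p \<le> P}" by (rule finite_subset[of _ "{..P}"]) auto
  have B1: "B \<ge> 1"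
  proof -
    have "(\<Prod>p | prime p \<and> p \<le> P. p) > 0" by (intro prod_pos) (auto intro: prime_gt_0_nat)
    then show ?thesis unfolding B by linarith
  qed
  have dvB: "int p dvd B" if "prime p" "p \<le> P" for p
    unfolding B int_dvd_int_iff using that finP by (intro dvd_prodI) auto
  have ndB: "p > P" if "prime p" "\<not> int p dvd B" for p using dvB that by (meson not_le)
  have ndB': "\<not> int p dvd B" if pp: "prime p" "p > P" for p
  proof
    assume "int p dvd B"
    then have "p dvd (\<Prod>p | prime p \<and> p \<le> P. p)" unfolding B int_dvd_int_iff .
    then obtain p' where "prime p'" "p' \<le> P" "p dvd p'"
      using prime_dvd_prod_iff[OF finP, of p "\<lambda>p. p"] pp(1) by auto
    then show False using pp primes_dvd_imp_eq[of p p'] by simp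
  qed
  define c where "c = bad_const"
  have "d * (d + 2) > 0" using d by simp
  then have "real (d * (d + 2)) > 0" by (simp only: of_nat_0_less_iff)
  then have c: "c > 0" unfolding c_def bad_const_def d_def[symmetric] by (rule mult_pos_pos) simp
  define Q where "Q = (6 * k\<^sup>2 * real_of_int B * real X) ^ d"
  have Q0: "Q \<ge> 0" using B1 by (simp add: Q_def)
  define A where "A = {p. prime p \<and> p > P \<and> (real p)\<^sup>2 \<le> Q}"
  have finA: "finite A" and cardA: "real (card A) \<le> sqrt Q"
  proof -
    have "A \<subseteq> {1..nat \<lfloor>sqrt Q\<rfloor>}"
    proof
      fix p assume p: "p \<in> A"
      then have "real p \<le> sqrt Q" unfolding A_def by (simp add: real_le_rsqrt)
      then show "p \<in> {1..nat \<lfloor>sqrt Q\<rfloor>}" using p prime_ge_1_nat by (auto simp: A_def le_nat_floor)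
    qed
    moreover from this show "finite A" by (rule finite_subset) simp
    ultimately have "card A \<le> card {1..nat \<lfloor>sqrt Q\<rfloor>}" by (intro card_mono) auto
    then have "real (card A) \<le> real (nat \<lfloor>sqrt Q\<rfloor>)" by simp
    also have "\<dots> \<le> sqrt Q" using Q0 by simp
    finally show "real (card A) \<le> sqrt Q" .
  qed
  have sub: "coeff_box X - good_set B X \<subseteq> (\<Union>p\<in>A. {y \<in> coeff_box X. bad p (cone B X y)})"
  proof
    fix y assume "y \<in> coeff_box X - good_set B X"
    then obtain p where y: "y \<in> coeff_box X" and p: "prime p" "bad p (cone B X y)" by (auto simp: good_set_def)
    have "\<not> int p dvd B"
    proof
      assume "int p dvd B"
      then obtain B' where "B = int p * B'" by (auto elim: dvdE)
      then have "cone B X y = 1 + smult (int p) ([:B' * (2 * K * int X):] + smult B' y)"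
        by (simp add: cone_def one_pCons smult_add_right algebra_simps)
      then show False using not_bad_unit p(2) by metis
    qed
    then have pP: "p > P" by (rule ndB[OF p(1)])
    have "(int p)\<^sup>2 \<le> (2 * K * (3 * K * B * int X)) ^ degree f"
      by (rule bad_index[OF reg[OF p(1) pP] p(2) cone_coeffs(2,1,3)[OF y X(2) B1]])
    then have "real_of_int ((int p)\<^sup>2) \<le> real_of_int ((2 * K * (3 * K * B * int X)) ^ degree f)"
      by (simp only: of_int_le_iff)
    also have "\<dots> = Q" by (simp add: Q_def k_def d_def power2_eq_square mult_ac)
    finally have "(real p)\<^sup>2 \<le> Q" by simp
    then show "y \<in> (\<Union>p\<in>A. {y \<in> coeff_box X. bad p (cone B X y)})" using y p pP by (auto simp: A_def)
  qed
  have "card (coeff_box X - good_set B X) \<le> card (\<Union>p\<in>A. {y \<in> coeff_box X. bad p (cone B X y)})"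
    using finA finite_coeff_box by (intro card_mono sub) auto
  also have "\<dots> \<le> (\<Sum>p\<in>A. card {y \<in> coeff_box X. bad p (cone B X y)})" by (rule card_UN_le[OF finA])
  finally have "real (card (coeff_box X - good_set B X)) \<le> real (\<Sum>p\<in>A. card {y \<in> coeff_box X. bad p (cone B X y)})"
    by (simp only: of_nat_le_iff)
  also have "\<dots> = (\<Sum>p\<in>A. real (card {y \<in> coeff_box X. bad p (cone B X y)}))" by simp
  also have "\<dots> \<le> (\<Sum>p\<in>A. c * (1 + (2 * k) ^ d * real X ^ d / (real p)\<^sup>2))"
  proof (rule sum_mono)
    fix p assume p: "p \<in> A"
    then show "real (card {y \<in> coeff_box X. bad p (cone B X y)}) \<le> c * (1 + (2 * k) ^ d * real X ^ d / (real p)\<^sup>2)"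
      unfolding cone_def c_def k_def d_def
      by (intro bad_count X(2)) (auto simp: A_def reg ndB')
  qed
  also have "\<dots> = c * real (card A) + c * (2 * k) ^ d * real X ^ d * (\<Sum>p\<in>A. 1 / (real p)\<^sup>2)"
    by (simp add: distrib_left sum.distrib sum_distrib_left mult.assoc)
  also have "\<dots> \<le> real X ^ d / 4 + real X ^ d / 4"
  proof (rule add_mono)
    have "Q = (6 * k\<^sup>2 * real_of_int B) ^ d * real X ^ d" by (simp add: Q_def power_mult_distrib)
    then have "(4 * c)\<^sup>2 * Q = ((4 * c)\<^sup>2 * (6 * k\<^sup>2 * real_of_int B) ^ d) * real X ^ d" by simp
    also have "\<dots> \<le> real X * real X ^ d"
      using X(1) by (intro mult_right_mono) (auto simp: c_def k_def d_def)
    also have "\<dots> \<le> real X ^ d * real X ^ d"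
      using X(2) d by (intro mult_right_mono self_le_power) auto
    finally have "(4 * c)\<^sup>2 * Q \<le> (real X ^ d)\<^sup>2" by (simp add: power2_eq_square)
    then have "sqrt ((4 * c)\<^sup>2 * Q) \<le> sqrt ((real X ^ d)\<^sup>2)" by (rule real_sqrt_le_mono)
    then have "4 * c * sqrt Q \<le> real X ^ d" using c by (simp add: real_sqrt_mult)
    moreover have "c * real (card A) \<le> c * sqrt Q" using c cardA by (intro mult_left_mono) auto
    ultimately show "c * real (card A) \<le> real X ^ d / 4" by simp
    have "(\<Sum>p\<in>A. 1 / (real p)\<^sup>2) \<le> 1 / real P"
      by (rule sum_inverse_squares_tail[OF P(2) finA]) (simp add: A_def)
    then have "c * (2 * k) ^ d * real X ^ d * (\<Sum>p\<in>A. 1 / (real p)\<^sup>2) \<le> c * (2 * k) ^ d * real X ^ d * (1 / real P)"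
      using c k by (intro mult_left_mono) auto
    also have "\<dots> = (c * (2 * k) ^ d / real P) * real X ^ d" by simp
    also have "\<dots> \<le> (1 / 4) * real X ^ d"
    proof (rule mult_right_mono)
      show "c * (2 * k) ^ d / real P \<le> 1 / 4"
        using P by (simp add: divide_le_eq c_def k_def d_def)
    qed simp
    finally show "c * (2 * k) ^ d * real X ^ d * (\<Sum>p\<in>A. 1 / (real p)\<^sup>2) \<le> real X ^ d / 4" by simp
  qed
  finally have 1: "real (card (coeff_box X - good_set B X)) \<le> real X ^ d / 2" by simp
  have "good_set B X \<subseteq> coeff_box X" by (auto simp: good_set_def)
  then have "card (coeff_box X) = card (good_set B X) + card (coeff_box X - good_set B X)"
    by (metis card_Diff_subset card_mono finite_coeff_box finite_subset le_add_diff_inverse)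
  then have "real X ^ d = real (card (good_set B X)) + real (card (coeff_box X - good_set B X))"
    by (metis card_coeff_box d_def of_nat_add of_nat_power)
  then show ?thesis using 1 by (simp add: d_def)
qed

end

section \<open>The lower Mertens bound\<close>

context monic_prime_poly
begin

definition incidences :: "int poly \<Rightarrow> (nat \<times> int) set" where
  "incidences v = {(p, r). prime p \<and> r \<in> roots_mod p \<and> int p dvd poly v r}"

lemma incidences_bound:
  assumes v: "v \<noteq> 0" "degree v < degree f" "coeffs_le V v" and Y: "real_of_int ((2 * K * V) ^ degree f) \<le> real Y"
  shows "incidences v \<subseteq> (SIGMA p:{p. prime p \<and> p \<le> Y}. roots_mod p)" "finite (incidences v)"
    "real (\<Prod>t\<in>incidences v. fst t) \<le> real_of_int ((2 * K * V) ^ degree f)"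
proof -
  show sub: "incidences v \<subseteq> (SIGMA p:{p. prime p \<and> p \<le> Y}. roots_mod p)"
  proof
    fix t assume "t \<in> incidences v"
    then obtain p r where t: "t = (p, r)" "prime p" "r \<in> roots_mod p" "int p dvd poly v r"
      by (auto simp: incidences_def)
    have "int (\<Prod>t\<in>{(p, r)}. fst t) \<le> (2 * K * V) ^ degree f"
      by (rule prod_primes_bound) (use t v in auto)
    then have "real_of_int (int p) \<le> real_of_int ((2 * K * V) ^ degree f)" by (simp only: of_int_le_iff) simp
    then have "real p \<le> real Y" using Y by simp
    then show "t \<in> (SIGMA p:{p. prime p \<and> p \<le> Y}. roots_mod p)" using t by simp
  qed
  have "finite (SIGMA p:{p. prime p \<and> p \<le> Y}. roots_mod p)"
    by (intro finite_SigmaI finite_roots_mod) (auto intro: finite_subset[of _ "{..Y}"])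
  with sub show fin: "finite (incidences v)" by (rule finite_subset)
  have "int (\<Prod>t\<in>incidences v. fst t) \<le> (2 * K * V) ^ degree f"
    by (rule prod_primes_bound[OF fin _ v]) (auto simp: incidences_def)
  then have "real_of_int (int (\<Prod>t\<in>incidences v. fst t)) \<le> real_of_int ((2 * K * V) ^ degree f)"
    by (simp only: of_int_le_iff)
  then show "real (\<Prod>t\<in>incidences v. fst t) \<le> real_of_int ((2 * K * V) ^ degree f)" by simp
qed

text \<open>A root \<open>r\<close> of \<open>f\<close> and \<open>v\<close> modulo \<open>p\<close> is one of \<open>v'\<close> too, so \<open>divisible_if_not_bad\<close> applies.\<close>

lemma same_incidences_dvd:
  assumes v: "v \<noteq> 0" "degree v < degree f" "\<And>p. prime p \<Longrightarrow> \<not> bad p v"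
    and eq: "incidences v = incidences v'"
  shows "\<exists>u. f dvd v' - v * u \<and> degree u < degree f"
proof -
  have "\<exists>z. f dvd v' - v * z"
  proof (rule divisible_if_not_bad[OF v])
    fix p r assume p: "prime p" "int p dvd poly f r" "int p dvd poly v r"
    define r' where "r' = r mod int p"
    have p0: "p > 0" by (rule prime_gt_0_nat[OF p(1)])
    have rr: "int p dvd r' - r" unfolding r'_def by (simp add: mod_eq_dvd_iff[symmetric])
    have "r' \<in> roots_mod p" using dvd_poly_cong[OF rr, of f] p p0 unfolding roots_mod_def r'_def by simp
    then have "(p, r') \<in> incidences v" using dvd_poly_cong[OF rr, of v] p by (simp add: incidences_def)
    then have "(p, r') \<in> incidences v'" using eq by simp
    then show "int p dvd poly v' r" using dvd_poly_cong[OF rr, of v'] by (simp add: incidences_def)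
  qed
  then obtain z where z: "f dvd v' - v * z" by blast
  have "f dvd (v' - v * z) + v * (z - red z)" using z red_eq by (intro dvd_add dvd_mult)
  also have "(v' - v * z) + v * (z - red z) = v' - v * red z" by (simp add: algebra_simps)
  finally show ?thesis using degree_red by blast
qed

text \<open>Elements of good sets with the same incidences divide each other. By \<open>cone_quotient\<close>, the quotient of an element at
scale \<open>j\<close> by one at scale \<open>j'\<close> has coefficients at most \<open>3 * 4 ^ j / 4 ^ j'\<close>, and it is nonzero. So the
scales coincide, which is what the ratio \<open>4 > 3\<close> is for, and then there are at
most \<open>7 ^ degree f\<close> quotients by a fixed element.\<close>

lemma multiplicity_bound:
  assumes B: "B \<ge> 1" and X0: "X0 > 0"
  shows "card {x \<in> (SIGMA j:{..<J}. good_set B (X0 * 4 ^ j)). incidences (cone B (X0 * 4 ^ fst x) (snd x)) = T} \<le> 7 ^ degree f"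
proof -
  let ?F = "{x \<in> (SIGMA j:{..<J}. good_set B (X0 * 4 ^ j)). incidences (cone B (X0 * 4 ^ fst x) (snd x)) = T}"
  let ?v = "\<lambda>x. cone B (X0 * 4 ^ fst x) (snd x)"
  have X: "X0 * 4 ^ j > 0" for j using X0 by simp
  have mem: "snd x \<in> coeff_box (X0 * 4 ^ fst x)" "\<And>p. prime p \<Longrightarrow> \<not> bad p (?v x)" "incidences (?v x) = T" if "x \<in> ?F" for x
    using that by (auto simp: good_set_def)
  have quot: "\<exists>u. f dvd ?v x - ?v x' * u \<and> degree u < degree f \<and>
      (\<forall>i. \<bar>coeff u i\<bar> * int (X0 * 4 ^ fst x') \<le> 3 * int (X0 * 4 ^ fst x))" if "x \<in> ?F" "x' \<in> ?F" for x x'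
  proof -
    note c = cone_coeffs[OF mem(1)[OF that(1)] X B] cone_coeffs[OF mem(1)[OF that(2)] X B]
    have "incidences (?v x') = incidences (?v x)" using mem(3) that by simp
    from same_incidences_dvd[OF c(7,6) mem(2)[OF that(2)] this]
    obtain u where u: "f dvd ?v x - ?v x' * u" "degree u < degree f" by blast
    have "\<bar>coeff u i\<bar> * int (X0 * 4 ^ fst x') \<le> 3 * int (X0 * 4 ^ fst x)" for i
      by (rule cone_quotient[OF mem(1)[OF that(2)] X B c(1,3) u])
    with u show ?thesis by blast
  qed
  have le: "fst x' \<le> fst x" if x: "x \<in> ?F" "x' \<in> ?F" for x x'
  proof (rule ccontr)
    assume "\<not> fst x' \<le> fst x"
    then have "Suc (fst x) \<le> fst x'" by simp
    then have "(4::nat) ^ Suc (fst x) \<le> 4 ^ fst x'" by (intro power_increasing) auto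
    then have "4 * (X0 * 4 ^ fst x) \<le> X0 * 4 ^ fst x'" by simp
    then have lt: "3 * int (X0 * 4 ^ fst x) < int (X0 * 4 ^ fst x')" using X[of "fst x"] by linarith
    obtain u where u: "f dvd ?v x - ?v x' * u" "\<And>i. \<bar>coeff u i\<bar> * int (X0 * 4 ^ fst x') \<le> 3 * int (X0 * 4 ^ fst x)"
      using quot[OF x] by blast
    have "coeff u i = 0" for i
    proof (rule ccontr)
      assume "coeff u i \<noteq> 0"
      then have "1 * int (X0 * 4 ^ fst x') \<le> \<bar>coeff u i\<bar> * int (X0 * 4 ^ fst x')" by (intro mult_right_mono) auto
      then show False using u(2)[of i] lt by linarith
    qed
    then have "u = 0" by (simp add: poly_eq_iff)
    then have "f dvd ?v x" using u(1) by simp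
    then show False using small_dvd cone_coeffs(1,2)[OF mem(1)[OF x(1)] X B] by blast
  qed
  show ?thesis
  proof (cases "?F = {}")
    case True
    then show ?thesis by (simp only: card.empty)
  next
    case False
    then obtain x0 where x0: "x0 \<in> ?F" by blast
    have scale: "fst x = fst x0" if "x \<in> ?F" for x using le[OF that x0] le[OF x0 that] by simp
    have "\<forall>x\<in>?F. \<exists>u. f dvd ?v x - ?v x0 * u \<and> degree u < degree f \<and>
      (\<forall>i. \<bar>coeff u i\<bar> * int (X0 * 4 ^ fst x0) \<le> 3 * int (X0 * 4 ^ fst x))" using quot x0 by blast
    from bchoice[OF this] obtain u where uu: "\<forall>x\<in>?F. f dvd ?v x - ?v x0 * u x \<and> degree (u x) < degree f \<and>
      (\<forall>i. \<bar>coeff (u x) i\<bar> * int (X0 * 4 ^ fst x0) \<le> 3 * int (X0 * 4 ^ fst x))" by (rule exE)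
    have u: "f dvd ?v x - ?v x0 * u x" "degree (u x) < degree f"
      "\<bar>coeff (u x) i\<bar> * int (X0 * 4 ^ fst x0) \<le> 3 * int (X0 * 4 ^ fst x)" if "x \<in> ?F" for x i
      using bspec[OF uu that] by auto
    have "inj_on u ?F"
    proof (rule inj_onI)
      fix x y assume x: "x \<in> ?F" and y: "y \<in> ?F" and e: "u x = u y"
      have "f dvd (?v x - ?v x0 * u x) - (?v y - ?v x0 * u y)" by (intro dvd_diff u x y)
      then have "f dvd ?v x - ?v y" using e by simp
      moreover have "?v x - ?v y = smult B (snd x - snd y)"
        using scale[OF x] scale[OF y] by (simp add: cone_def smult_diff_right)
      ultimately have "f dvd snd x - snd y" using f_dvd_smult B by simp
      moreover have "degree (snd x - snd y) < degree f"
        using mem(1)[OF x] mem(1)[OF y] by (intro degree_diff_less coeff_box_degree)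
      ultimately have "snd x - snd y = 0" by (rule small_dvd)
      then show "x = y" using scale[OF x] scale[OF y] by (simp add: prod_eq_iff)
    qed
    moreover have "u ` ?F \<subseteq> polys_over {-3..3} (degree f)"
    proof (rule image_subsetI, rule mem_polys_over_symmetric)
      fix x assume x: "x \<in> ?F"
      show "degree (u x) < degree f" by (rule u(2)[OF x])
      show "coeffs_le 3 (u x)" unfolding coeffs_le_def
      proof
        fix i
        have "\<bar>coeff (u x) i\<bar> * int (X0 * 4 ^ fst x0) \<le> 3 * int (X0 * 4 ^ fst x0)" using u(3)[OF x, of i] scale[OF x] by simp
        moreover have "int (X0 * 4 ^ fst x0) > 0" using X0 by simp
        ultimately show "\<bar>coeff (u x) i\<bar> \<le> 3" by (rule mult_right_le_imp_le)
      qed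
    qed
    ultimately have "card ?F \<le> card (polys_over {-3..3} (degree f))"
      by (rule card_inj_on_le) (simp add: finite_polys_over)
    also have "\<dots> = 7 ^ degree f" by (simp add: card_polys_over_symmetric)
    finally show ?thesis .
  qed
qed

text \<open>Attach to each \<open>(j, y)\<close>, with \<open>j < J\<close> and \<open>y\<close> in the good set of scale \<open>X j\<close>, the weight \<open>1 / X j ^ d\<close>. The total
weight is at least \<open>J / 2\<close>. By \<open>incidences_bound\<close>, each weight is, up to a constant, at most the product of \<open>1/p\<close> over the incidences \<open>(p, r)\<close>
of the element, and a set of incidences occurs at most \<open>7 ^ d\<close> times. Thus \<open>J\<close> is bounded by a
multiple of the sum of these products over all sets of pairs \<open>(p, r)\<close> with \<open>p \<le> Y\<close>,
that is, of \<open>\<Prod>p\<le>Y. (1 + 1/p) ^ card (roots_mod p)\<close>.\<close>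

lemma mertens_lower_scales:
  assumes reg: "\<And>p. prime p \<Longrightarrow> p > P \<Longrightarrow> regular_prime p"
  shows "\<exists>c>0. \<exists>C\<ge>1. \<forall>J Y. real Y \<ge> C * (4 ^ degree f) ^ J \<longrightarrow>
     c * real J \<le> exp (\<Sum>p | prime p \<and> p \<le> (Y::nat). real (card (roots_mod p)) / p)"
proof -
  define d where "d = degree f"
  define k where "k = real_of_int K"
  have k: "k \<ge> 1" using K_ge_1 by (simp add: k_def)
  define P' where "P' = max (max P 1) (nat \<lceil>4 * bad_const * (2 * k) ^ d\<rceil>)"
  have P'1: "real P' \<ge> 4 * bad_const * (2 * real_of_int K) ^ degree f"
    unfolding P'_def k_def d_def by linarith
  have P'2: "P' > 0" "P' \<ge> P" by (auto simp: P'_def)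
  have reg': "\<And>p. prime p \<Longrightarrow> p > P' \<Longrightarrow> regular_prime p" using reg P'2 by simp
  define B where "B = int (\<Prod>p | prime p \<and> p \<le> P'. p)"
  have B1: "B \<ge> 1"
  proof -
    have "(\<Prod>p | prime p \<and> p \<le> P'. p) > 0" by (intro prod_pos) (auto intro: prime_gt_0_nat)
    then show ?thesis unfolding B_def by linarith
  qed
  define X0 where "X0 = nat \<lceil>(4 * bad_const)\<^sup>2 * (6 * k\<^sup>2 * real_of_int B) ^ d\<rceil> + 1"
  have X0: "X0 > 0" "real X0 \<ge> (4 * bad_const)\<^sup>2 * (6 * k\<^sup>2 * real_of_int B) ^ d"
    unfolding X0_def by linarith+
  define X where "X j = X0 * 4 ^ j" for j :: nat
  have Xpos: "X j > 0" for j using X0 by (simp add: X_def)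
  have good: "real (X j) ^ d / 2 \<le> real (card (good_set B (X j)))" for j
    unfolding d_def
  proof (rule card_good_set[OF reg' P'1 P'2(1) B_def _ Xpos])
    have "real X0 * 1 \<le> real X0 * 4 ^ j" by (intro mult_left_mono) auto
    then show "real (X j) \<ge> (4 * bad_const)\<^sup>2 * (6 * (real_of_int K)\<^sup>2 * real_of_int B) ^ degree f"
      using X0(2) by (simp add: X_def k_def d_def)
  qed
  define R where "R = 6 * k\<^sup>2 * real_of_int B"
  have R: "R > 0" using k B1 by (simp add: R_def)
  define C where "C = max 1 ((R * real X0) ^ d)"
  define c where "c = 1 / (2 * R ^ d * 7 ^ d)"
  have c: "c > 0" using R by (simp add: c_def)
  have "c * real J \<le> exp (\<Sum>p | prime p \<and> p \<le> Y. real (card (roots_mod p)) / p)"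
    if Y: "real Y \<ge> C * (4 ^ degree f) ^ J" for J Y :: nat
  proof -
    let ?A = "SIGMA j:{..<J}. good_set B (X j)"
    let ?v = "\<lambda>x. cone B (X (fst x)) (snd x)"
    let ?T = "\<lambda>x. incidences (?v x)"
    let ?D = "\<lambda>t. \<Prod>q\<in>t. 1 / real (fst q)"
    have fing: "finite (good_set B (X j))" for j
      by (rule finite_subset[of _ "coeff_box (X j)"]) (auto simp: good_set_def finite_coeff_box)
    have finA: "finite ?A" using fing by (intro finite_SigmaI) auto
    define Q where "Q = (SIGMA p:{p. prime p \<and> p \<le> Y}. roots_mod p)"
    have finP: "finite {p. prime p \<and> p \<le> Y}" by (rule finite_subset[of _ "{..Y}"]) auto
    have finQ: "finite Q" unfolding Q_def by (intro finite_SigmaI finite_roots_mod finP)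
    have norm: "real_of_int ((2 * K * (3 * K * B * int (X j))) ^ degree f) = (R * real (X j)) ^ d" for j
      by (simp add: R_def k_def d_def power2_eq_square mult_ac)
    have XY: "(R * real (X j)) ^ d \<le> real Y" if "j < J" for j
    proof -
      have "(R * real (X j)) ^ d = (R * real X0) ^ d * (4 ^ d) ^ j"
        by (simp add: X_def power_mult_distrib mult_ac power_mult[symmetric])
      also have "\<dots> \<le> C * (4 ^ d) ^ J"
        using that R by (intro mult_mono power_increasing) (auto simp: C_def)
      finally show ?thesis using Y by (simp add: d_def)
    qed
    have inc: "?T x \<in> Pow Q" "1 / (R * real (X (fst x))) ^ d \<le> ?D (?T x)" if x: "x \<in> ?A" for x
    proof -
      have y: "snd x \<in> coeff_box (X (fst x))" and j: "fst x < J" using x by (auto simp: good_set_def)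
      note cc = cone_coeffs[OF y Xpos B1]
      note ib = incidences_bound[OF cc(2,1,3), unfolded norm, OF XY[OF j]]
      show "?T x \<in> Pow Q" using ib(1) by (simp add: Q_def)
      have pos: "real (\<Prod>t\<in>?T x. fst t) > 0"
      proof -
        have "(\<Prod>t\<in>?T x. fst t) > 0" by (rule prod_pos) (auto simp: incidences_def intro: prime_gt_0_nat)
        then show ?thesis by (simp only: of_nat_0_less_iff)
      qed
      have "1 / (R * real (X (fst x))) ^ d \<le> 1 / real (\<Prod>t\<in>?T x. fst t)"
        by (rule divide_left_mono[OF ib(3)]) (use pos R Xpos[of "fst x"] in \<open>auto intro!: mult_pos_pos\<close>)
      also have "\<dots> = ?D (?T x)" by (simp add: prod_dividef)
      finally show "1 / (R * real (X (fst x))) ^ d \<le> ?D (?T x)" .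
    qed
    have powsum: "(\<Sum>t\<in>Pow Q. ?D t) \<le> exp (\<Sum>p | prime p \<and> p \<le> Y. real (card (roots_mod p)) / p)"
    proof -
      have "(\<Sum>t\<in>Pow Q. ?D t) = (\<Prod>q\<in>Q. 1 / real (fst q) + 1)"
        by (simp add: prod_add[OF finQ])
      also have "\<dots> \<le> (\<Prod>q\<in>Q. exp (1 / real (fst q)))"
        by (intro prod_mono conjI) (auto simp: add.commute intro: exp_ge_add_one_self add_nonneg_nonneg)
      also have "\<dots> = exp (\<Sum>q\<in>Q. 1 / real (fst q))" by (rule exp_sum[OF finQ, symmetric])
      also have "(\<Sum>q\<in>Q. 1 / real (fst q)) = (\<Sum>p | prime p \<and> p \<le> Y. \<Sum>r\<in>roots_mod p. 1 / real p)"
        unfolding Q_def by (subst sum.Sigma) (auto simp: finP finite_roots_mod split_beta)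
      also have "\<dots> = (\<Sum>p | prime p \<and> p \<le> Y. real (card (roots_mod p)) / p)" by simp
      finally show ?thesis .
    qed
    have "real J / (2 * R ^ d) = (\<Sum>j<J. (real (X j) ^ d / 2) * (1 / (R * real (X j)) ^ d))"
    proof -
      have "(real (X j) ^ d / 2) * (1 / (R * real (X j)) ^ d) = 1 / (2 * R ^ d)" for j
        using R Xpos[of j] by (simp add: power_mult_distrib)
      then show ?thesis by simp
    qed
    also have "\<dots> \<le> (\<Sum>j<J. real (card (good_set B (X j))) * (1 / (R * real (X j)) ^ d))"
      using good R by (intro sum_mono mult_right_mono) auto
    also have "\<dots> = (\<Sum>j<J. \<Sum>y\<in>good_set B (X j). 1 / (R * real (X j)) ^ d)" by simp
    also have "\<dots> = (\<Sum>x\<in>?A. 1 / (R * real (X (fst x))) ^ d)"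
      using fing by (subst sum.Sigma) (auto simp: split_beta)
    also have "\<dots> \<le> (\<Sum>x\<in>?A. ?D (?T x))" by (intro sum_mono inc)
    also have "\<dots> = (\<Sum>t\<in>?T ` ?A. \<Sum>x\<in>{x \<in> ?A. ?T x = t}. ?D (?T x))" by (rule sum.image_gen[OF finA])
    also have "\<dots> \<le> (\<Sum>t\<in>?T ` ?A. 7 ^ d * ?D t)"
    proof (rule sum_mono)
      fix t assume "t \<in> ?T ` ?A"
      have "(\<Sum>x\<in>{x \<in> ?A. ?T x = t}. ?D (?T x)) = (\<Sum>x\<in>{x \<in> ?A. ?T x = t}. ?D t)" by (intro sum.cong) auto
      also have "\<dots> = real (card {x \<in> ?A. ?T x = t}) * ?D t" by simp
      also have "\<dots> \<le> 7 ^ d * ?D t"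
      proof (rule mult_right_mono)
        have "card {x \<in> ?A. ?T x = t} \<le> 7 ^ d"
          unfolding X_def d_def by (rule multiplicity_bound[OF B1 X0(1)])
        then have "real (card {x \<in> ?A. ?T x = t}) \<le> real (7 ^ d)" by (simp only: of_nat_le_iff)
        then show "real (card {x \<in> ?A. ?T x = t}) \<le> 7 ^ d" by simp
      qed (intro prod_nonneg, simp)
      finally show "(\<Sum>x\<in>{x \<in> ?A. ?T x = t}. ?D (?T x)) \<le> 7 ^ d * ?D t" .
    qed
    also have "\<dots> \<le> (\<Sum>t\<in>Pow Q. 7 ^ d * ?D t)"
      using inc(1) finQ by (intro sum_mono2) (auto intro!: mult_nonneg_nonneg prod_nonneg)
    also have "\<dots> = 7 ^ d * (\<Sum>t\<in>Pow Q. ?D t)" by (simp add: sum_distrib_left)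
    also have "\<dots> \<le> 7 ^ d * exp (\<Sum>p | prime p \<and> p \<le> Y. real (card (roots_mod p)) / p)"
      by (intro mult_left_mono powsum) simp
    finally have "real J / (2 * R ^ d) \<le> 7 ^ d * exp (\<Sum>p | prime p \<and> p \<le> Y. real (card (roots_mod p)) / p)" .
    then show ?thesis using R by (simp add: c_def field_simps)
  qed
  moreover have "C \<ge> 1" by (simp add: C_def)
  ultimately show ?thesis using c by blast
qed

text \<open>Take logarithms in \<open>mertens_lower_scales\<close>, for the largest \<open>J\<close> admissible for \<open>Y = Z\<close>, which is of order \<open>ln Z\<close>.\<close>

theorem mertens_lower:
  assumes reg: "\<And>p. prime p \<Longrightarrow> p > P \<Longrightarrow> regular_prime p"
  shows "\<exists>C. \<forall>Z\<ge>3. ln (ln Z) - C \<le> (\<Sum>p | prime p \<and> p \<le> (Z::nat). real (card (roots_mod p)) / p)"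
proof -
  obtain c C where c: "c > 0" and C: "C \<ge> 1" and main: "\<And>J Y. real Y \<ge> C * (4 ^ degree f) ^ J \<Longrightarrow>
     c * real J \<le> exp (\<Sum>p | prime p \<and> p \<le> (Y::nat). real (card (roots_mod p)) / p)"
    using mertens_lower_scales[OF reg] by blast
  let ?S = "\<lambda>Z. \<Sum>p | prime p \<and> p \<le> (Z::nat). real (card (roots_mod p)) / p"
  define b where "b = real (4 ^ degree f)"
  have b: "b \<ge> 4" unfolding b_def using deg_pos self_le_power[of 4 "degree f"] by simp
  \<comment> \<open>The first argument covers the small \<open>Z\<close>, for which no \<open>J \<ge> 1\<close> needs to be admissible.\<close>
  define C' where "C' = max (ln (ln (C\<^sup>2 * b\<^sup>2 + 3))) (- ln (c / (4 * ln b)))"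
  have "ln (ln Z) - C' \<le> ?S Z" if Z: "Z \<ge> 3" for Z :: nat
  proof (cases "real Z \<le> C\<^sup>2 * b\<^sup>2 + 3")
    case True
    have "ln (real Z) > 0" using Z by simp
    then have "ln (ln (real Z)) \<le> ln (ln (C\<^sup>2 * b\<^sup>2 + 3))" using True Z by (subst ln_le_cancel_iff) (auto simp: ln_gt_zero_iff intro!: ln_gt_zero add_nonneg_pos)
    moreover have "?S Z \<ge> 0" by (intro sum_nonneg) auto
    ultimately show ?thesis by (simp add: C'_def)
  next
    case False
    then have big: "real Z \<ge> (C * b)\<^sup>2" by (simp add: power_mult_distrib)
    have lnb: "ln b > 0" using b by simp
    have Cb: "C * b \<ge> 1" using C b by (intro mult_ge1_I) auto
    define J where "J = nat \<lfloor>ln (Z / C) / ln b\<rfloor>"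
    have "ln ((C * b)\<^sup>2) \<le> ln Z" using big Cb Z by (subst ln_le_cancel_iff) auto
    then have l2: "2 * ln (C * b) \<le> ln Z" using Cb by (simp add: ln_realpow)
    have lC: "ln (C * b) = ln C + ln b" using C b by (simp add: ln_mult)
    have lZC: "ln (Z / C) = ln Z - ln C" using C Z by (simp add: ln_div)
    have lnC: "ln C \<ge> 0" using C by simp
    have 1: "ln (Z / C) / ln b \<ge> 1" using l2 lC lZC lnb lnC by (simp add: le_divide_eq)
    have J1: "real J \<le> ln (Z / C) / ln b" and J2: "ln (Z / C) / ln b < real J + 1"
      using 1 unfolding J_def by linarith+
    have J3: "J \<ge> 1" using 1 unfolding J_def by linarith
    have "real J * ln b \<le> ln (Z / C)" using J1 lnb by (simp add: le_divide_eq)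
    then have "ln (b ^ J) \<le> ln (Z / C)" using b by (simp add: ln_realpow)
    then have "b ^ J \<le> Z / C" using b C Z by (subst (asm) ln_le_cancel_iff) auto
    then have "C * (4 ^ degree f) ^ J \<le> real Z" using C by (simp add: le_divide_eq b_def mult.commute)
    then have m: "c * real J \<le> exp (?S Z)" by (rule main)
    have "ln Z / (4 * ln b) \<le> real J"
    proof -
      have "ln Z \<le> 2 * ln (Z / C)" using l2 lC lZC lnb by simp
      also have "ln (Z / C) < (real J + 1) * ln b" using J2 lnb by (simp add: divide_less_eq)
      also have "(real J + 1) * ln b \<le> (2 * real J) * ln b" using J3 lnb by (intro mult_right_mono) auto
      finally have "ln Z \<le> real J * (4 * ln b)" by simp
      then show ?thesis using lnb by (simp add: divide_le_eq)
    qed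
    then have "c * (ln Z / (4 * ln b)) \<le> c * real J" using c by (intro mult_left_mono) auto
    then have "(c / (4 * ln b)) * ln Z \<le> exp (?S Z)" using m by simp
    moreover have lZ: "ln (real Z) > 0" using Z by simp
    ultimately have "ln ((c / (4 * ln b)) * ln Z) \<le> ?S Z"
      using c lnb by (metis exp_gt_zero ln_exp ln_le_cancel_iff mult_pos_pos zero_less_divide_iff zero_less_numeral)
    then have "ln (c / (4 * ln b)) + ln (ln Z) \<le> ?S Z" using c lnb lZ by (subst (asm) ln_mult) auto
    then show ?thesis unfolding C'_def by linarith
  qed
  then show ?thesis by blast
qed

end

section \<open>Power residues and roots of binomials modulo primes\<close>

text \<open>The element \<open>g\<close> is a primitive root.\<close>

lemma index_exists:
  assumes p: "prime (p::nat)"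
  shows "\<exists>g. (\<forall>a. \<not> p dvd a \<longrightarrow> (\<exists>e. [g ^ e = a] (mod p))) \<and> (\<forall>i j. [g ^ i = g ^ j] (mod p) \<longleftrightarrow> [i = j] (mod p - 1))"
proof -
  have p1: "p > 1" by (rule prime_gt_1_nat[OF p])
  obtain g where g: "residue_primroot p g" using prime_primitive_root_exists[of p] p p1 by auto
  then have cop: "coprime p g" and ord: "ord p g = p - 1"
    using p by (auto simp: residue_primroot_def totient_prime)
  have bij: "bij_betw (\<lambda>i. g ^ i mod p) {..<totient p} (totatives p)"
    by (rule residue_primroot_is_generator[OF p1 g])
  have gen: "\<exists>e. [g ^ e = a] (mod p)" if "\<not> p dvd a" for a
  proof -
    have "coprime a p" using prime_imp_coprime[OF p that] by (simp add: coprime_commute)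
    then have "a mod p \<in> totatives p" using p1 that
      by (auto simp: totatives_def mod_greater_zero_iff_not_dvd)
    then have "a mod p \<in> (\<lambda>i. g ^ i mod p) ` {..<totient p}" using bij by (simp add: bij_betw_def)
    then show ?thesis by (auto simp: Cong.cong_def)
  qed
  have "[g ^ i = g ^ j] (mod p) \<longleftrightarrow> [i = j] (mod p - 1)" for i j
    using order_divides_expdiff[OF cop, of i j] ord by simp
  then show ?thesis using gen by blast
qed

definition power_residue :: "nat \<Rightarrow> nat \<Rightarrow> int \<Rightarrow> bool" where
  "power_residue q p a \<longleftrightarrow> (\<exists>x. [x ^ q = a] (mod int p))"

lemma power_residue_nat:
  assumes "p > 0"
  shows "power_residue q p (int a) \<longleftrightarrow> (\<exists>n. [n ^ q = a] (mod p))"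
proof
  assume "power_residue q p (int a)"
  then obtain x where x: "[x ^ q = int a] (mod int p)" by (auto simp: power_residue_def)
  define n where "n = nat (x mod int p)"
  have "[int n = x] (mod int p)" using assms by (simp add: n_def)
  then have "[int n ^ q = x ^ q] (mod int p)" by (rule cong_pow)
  then have "[int (n ^ q) = int a] (mod int p)" using x by (auto intro: cong_trans)
  then have "[n ^ q = a] (mod p)" by (simp only: cong_int_iff)
  then show "\<exists>n. [n ^ q = a] (mod p)" by blast
next
  assume "\<exists>n. [n ^ q = a] (mod p)"
  then obtain n where "[n ^ q = a] (mod p)" by blast
  then have "[int (n ^ q) = int a] (mod int p)" by (simp only: cong_int_iff)
  then show "power_residue q p (int a)" unfolding power_residue_def by (intro exI[of _ "int n"]) simp
qed

lemma power_residue_index: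
  assumes p: "prime p" and q: "q > 0" "q dvd p - 1"
    and gen: "\<And>a. \<not> p dvd a \<Longrightarrow> \<exists>e. [g ^ e = a] (mod p)"
    and exp: "\<And>i j. [g ^ i = g ^ j] (mod p) \<longleftrightarrow> [i = j] (mod p - 1)"
    and a: "[g ^ e = a] (mod p)" "\<not> p dvd a"
  shows "power_residue q p (int a) \<longleftrightarrow> q dvd e"
proof
  assume "power_residue q p (int a)"
  then obtain n where n: "[n ^ q = a] (mod p)" using power_residue_nat[of p q a] prime_gt_0_nat[OF p] by blast
  have "\<not> p dvd n"
  proof
    assume "p dvd n"
    then have "p dvd n ^ q" using q by (simp add: dvd_power_iff prime_dvd_power_iff[OF p])
    then show False using n a(2) by (simp add: cong_dvd_iff)
  qed
  then obtain i where i: "[g ^ i = n] (mod p)" using gen by blast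
  have "[(g ^ i) ^ q = n ^ q] (mod p)" by (rule cong_pow[OF i])
  also note n
  also have "[a = g ^ e] (mod p)" by (rule cong_sym[OF a(1)])
  finally have "[g ^ (i * q) = g ^ e] (mod p)" by (simp add: power_mult)
  then have "[i * q = e] (mod p - 1)" by (simp add: exp)
  then have "[i * q = e] (mod q)" using q(2) cong_dvd_modulus_nat by blast
  then show "q dvd e" by (simp add: Cong.cong_def mod_eq_0_iff_dvd)
next
  assume "q dvd e"
  then obtain i where "e = q * i" by (auto elim: dvdE)
  then have "[(g ^ i) ^ q = a] (mod p)" using a(1) by (simp add: power_mult[symmetric] mult.commute)
  then show "power_residue q p (int a)" using power_residue_nat[of p q a] prime_gt_0_nat[OF p] by blast
qed

text \<open>Translates root sets of \<open>X\<^sup>q - a\<close> over the integers into congruences between natural numbers, where discrete logarithms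
are available.\<close>

lemma root_set_nat:
  "{r \<in> {0..<int p}. int p dvd r ^ q - int a} = int ` {n. n < p \<and> [n ^ q = a] (mod p)}"
proof (intro equalityI subsetI)
  fix r assume r: "r \<in> {r \<in> {0..<int p}. int p dvd r ^ q - int a}"
  then have "[int (nat r ^ q) = int a] (mod int p)" by (simp add: cong_iff_dvd_diff)
  then have "[nat r ^ q = a] (mod p)" by (simp only: cong_int_iff)
  then have "nat r \<in> {n. n < p \<and> [n ^ q = a] (mod p)}" "r = int (nat r)" using r by auto
  then show "r \<in> int ` {n. n < p \<and> [n ^ q = a] (mod p)}" by (metis imageI)
next
  fix r assume "r \<in> int ` {n. n < p \<and> [n ^ q = a] (mod p)}"
  then obtain n where n: "r = int n" "n < p" "[n ^ q = a] (mod p)" by auto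
  then have "[int (n ^ q) = int a] (mod int p)" by (simp only: cong_int_iff)
  then show "r \<in> {r \<in> {0..<int p}. int p dvd r ^ q - int a}" using n by (simp add: cong_iff_dvd_diff)
qed

lemma card_roots_nonresidue:
  assumes "p > 0" "\<not> power_residue q p (int a)"
  shows "{n. n < p \<and> [n ^ q = a] (mod p)} = {}"
  using assms power_residue_nat by auto

text \<open>One solution \<open>x\<close> yields the solutions \<open>x * g ^ (m * i)\<close>, where \<open>m = (p - 1) / q\<close>.\<close>

lemma card_roots_residue:
  assumes p: "prime p" and q: "q > 0" "q dvd p - 1" and a: "\<not> p dvd a" and res: "power_residue q p (int a)"
  shows "card {n. n < p \<and> [n ^ q = a] (mod p)} \<ge> q"
proof -
  have p0: "p > 0" by (rule prime_gt_0_nat[OF p])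
  have p1: "p - 1 > 0" using prime_gt_1_nat[OF p] by simp
  obtain g where g: "\<And>i j. [g ^ i = g ^ j] (mod p) \<longleftrightarrow> [i = j] (mod p - 1)"
    "\<And>a. \<not> p dvd a \<Longrightarrow> \<exists>e. [g ^ e = a] (mod p)"
    using index_exists[OF p] by blast
  obtain x where x: "[x ^ q = a] (mod p)" using res power_residue_nat[OF p0] by blast
  obtain m where m: "p - 1 = q * m" using q(2) by (auto elim: dvdE)
  have m0: "m > 0" using m p1 by (cases m) auto
  let ?r = "\<lambda>i. (x * g ^ (m * i)) mod p"
  have xp: "coprime x p"
  proof -
    have "\<not> p dvd x"
    proof
      assume "p dvd x"
      then have "p dvd x ^ q" using q by (simp add: prime_dvd_power_iff[OF p])
      then show False using x a by (simp add: cong_dvd_iff)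
    qed
    then show ?thesis using prime_imp_coprime[OF p, of x] by (simp add: coprime_commute)
  qed
  have "inj_on ?r {..<q}"
  proof (rule inj_onI)
    fix i j assume ij: "i \<in> {..<q}" "j \<in> {..<q}" "?r i = ?r j"
    then have "[x * g ^ (m * i) = x * g ^ (m * j)] (mod p)" by (simp add: Cong.cong_def)
    then have "[g ^ (m * i) = g ^ (m * j)] (mod p)" using xp by (simp add: cong_mult_lcancel_nat)
    then have "[m * i = m * j] (mod m * q)" using g m by (simp add: mult.commute)
    then have "(m * i) mod (m * q) = (m * j) mod (m * q)" by (simp add: Cong.cong_def)
    then have "m * (i mod q) = m * (j mod q)" by (simp only: mult_mod_right)
    then show "i = j" using ij m0 by simp
  qed
  moreover have "?r ` {..<q} \<subseteq> {n. n < p \<and> [n ^ q = a] (mod p)}"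
  proof (rule image_subsetI)
    fix i
    have "[g ^ (m * i * q) = g ^ 0] (mod p)" using m by (simp only: g) (simp add: Cong.cong_def mult.commute mult.left_commute)
    then have "[x ^ q * g ^ (m * i * q) = a * g ^ 0] (mod p)" by (intro cong_mult x)
    then have "[(x * g ^ (m * i)) ^ q = a] (mod p)" by (simp add: power_mult_distrib power_mult)
    moreover have "[(?r i) ^ q = (x * g ^ (m * i)) ^ q] (mod p)" by (intro cong_pow) (simp add: Cong.cong_def)
    ultimately have "[(?r i) ^ q = a] (mod p)" using cong_trans by blast
    then show "?r i \<in> {n. n < p \<and> [n ^ q = a] (mod p)}" using p0 by simp
  qed
  ultimately have "card {..<q} \<le> card {n. n < p \<and> [n ^ q = a] (mod p)}"
    by (intro card_inj_on_le[of ?r]) auto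
  then show ?thesis by simp
qed

text \<open>If \<open>q\<close> does not divide \<open>p - 1\<close>, it is invertible modulo \<open>p - 1\<close>, so taking \<open>q\<close>-th powers is a
bijection on exponents of the primitive root.\<close>

lemma card_roots_coprime:
  assumes p: "prime p" and q: "prime q" "\<not> q dvd p - 1" and a: "\<not> p dvd a"
  shows "card {n. n < p \<and> [n ^ q = a] (mod p)} = 1"
proof -
  have p0: "p > 0" by (rule prime_gt_0_nat[OF p])
  obtain g where g: "\<And>i j. [g ^ i = g ^ j] (mod p) \<longleftrightarrow> [i = j] (mod p - 1)"
    "\<And>a. \<not> p dvd a \<Longrightarrow> \<exists>e. [g ^ e = a] (mod p)"
    using index_exists[OF p] by blast
  obtain e where e: "[g ^ e = a] (mod p)" using g(2)[OF a] by blast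
  have cop: "coprime q (p - 1)" using q by (simp add: prime_imp_coprime)
  obtain u where u: "[q * u = 1] (mod p - 1)" using cong_solve_coprime_nat[OF cop] by auto
  let ?n = "g ^ (u * e) mod p"
  have "{n. n < p \<and> [n ^ q = a] (mod p)} = {?n}"
  proof (intro equalityI subsetI)
    fix n assume "n \<in> {n. n < p \<and> [n ^ q = a] (mod p)}"
    then have n: "n < p" "[n ^ q = a] (mod p)" by auto
    have "\<not> p dvd n"
    proof
      assume "p dvd n"
      then have "p dvd n ^ q" using q prime_gt_0_nat by (simp add: prime_dvd_power_iff[OF p])
      then show False using n a by (simp add: cong_dvd_iff)
    qed
    then obtain i where i: "[g ^ i = n] (mod p)" using g(2) by blast
    have "[(g ^ i) ^ q = n ^ q] (mod p)" by (rule cong_pow[OF i])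
    also note n(2)
    also have "[a = g ^ e] (mod p)" by (rule cong_sym[OF e])
    finally have "[g ^ (i * q) = g ^ e] (mod p)" by (simp add: power_mult)
    then have 1: "[i * q = e] (mod p - 1)" by (simp add: g)
    have "[i * 1 = i * (q * u)] (mod p - 1)" by (intro cong_mult cong_refl cong_sym[OF u])
    also have "i * (q * u) = u * (i * q)" by simp
    also have "[u * (i * q) = u * e] (mod p - 1)" by (intro cong_mult cong_refl 1)
    finally have "[g ^ i = g ^ (u * e)] (mod p)" by (simp add: g)
    then have "[n = g ^ (u * e)] (mod p)" using i cong_sym cong_trans by blast
    then show "n \<in> {?n}" using n(1) by (simp add: Cong.cong_def)
  next
    fix n assume "n \<in> {?n}"
    then have n: "n = ?n" by simp
    have "[n ^ q = (g ^ (u * e)) ^ q] (mod p)" unfolding n by (intro cong_pow) (simp add: Cong.cong_def)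
    also have "(g ^ (u * e)) ^ q = g ^ ((q * u) * e)" by (simp add: power_mult[symmetric] mult_ac)
    also have "[g ^ ((q * u) * e) = g ^ (1 * e)] (mod p)" unfolding g by (intro cong_mult cong_refl u)
    also have "[g ^ (1 * e) = a] (mod p)" using e by simp
    finally show "n \<in> {n. n < p \<and> [n ^ q = a] (mod p)}" using n p0 by simp
  qed
  then show ?thesis by simp
qed

lemma power_residue_all:
  assumes p: "prime p" and q: "prime q" "\<not> q dvd p - 1" and a: "\<not> p dvd a"
  shows "power_residue q p (int a)"
proof -
  have "{n. n < p \<and> [n ^ q = a] (mod p)} \<noteq> {}" using card_roots_coprime[OF assms] by (metis card.empty zero_neq_one)
  then show ?thesis using power_residue_nat[OF prime_gt_0_nat[OF p]] by blast
qed

section \<open>Two families of prime polynomials\<close>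

lemma int_poly_unit:
  assumes "degree (g::int poly) = 0" "\<bar>lead_coeff g\<bar> = 1"
  shows "is_unit g"
proof -
  obtain c where c: "g = [:c:]" using assms(1) by (rule degree_eq_zeroE)
  then have "\<bar>c\<bar> = 1" using assms(2) by simp
  then have "c dvd 1" by simp
  then show ?thesis unfolding c is_unit_const_poly_iff .
qed

text \<open>Integer polynomials form a factorial ring, so irreducible elements are prime.\<close>

lemma irreducible_monic_intI:
  assumes "lead_coeff (f::int poly) = 1" "degree f > 0"
    and "\<And>g h. f = g * h \<Longrightarrow> degree g > 0 \<Longrightarrow> degree h > 0 \<Longrightarrow> \<bar>lead_coeff g\<bar> = 1 \<Longrightarrow> \<bar>lead_coeff h\<bar> = 1 \<Longrightarrow> False"
  shows "prime_elem f"
proof -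
  have "irreducible f"
  proof (rule irreducibleI)
    show "f \<noteq> 0" using assms(2) by auto
    show "\<not> is_unit f" using assms(2) by (auto simp: is_unit_poly_iff)
    fix g h assume f: "f = g * h"
    have "lead_coeff g * lead_coeff h = 1" using assms(1) f by (simp add: lead_coeff_mult)
    then have l: "\<bar>lead_coeff g\<bar> = 1" "\<bar>lead_coeff h\<bar> = 1" by (auto simp: zmult_eq_1_iff)
    show "is_unit g \<or> is_unit h"
      using assms(3)[OF f] l int_poly_unit by (cases "degree g = 0"; cases "degree h = 0") auto
  qed
  then show ?thesis by (rule irreducible_imp_prime_elem)
qed

text \<open>With \<open>r * u = q * v + 1\<close> one gets \<open>a * (a ^ v) ^ q = (b ^ u) ^ q\<close>, so \<open>a\<close> is the \<open>q\<close>-th power of \<open>b ^ u / a ^ v\<close>.\<close>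

lemma nth_power_from_coprime:
  assumes "a > 0" "coprime r q" "q > 0" "(b::nat) ^ q = a ^ r" "r > 0"
  shows "\<exists>c. a = c ^ q"
proof -
  obtain u v where "r * u = q * v + gcd r q" using bezout_nat[of r q] assms(5) by blast
  then have uv: "r * u = v * q + 1" using assms(2) by (simp add: mult.commute)
  have "a * (a ^ v) ^ q = a ^ (r * u)" unfolding uv power_add power_mult by simp
  also have "\<dots> = (b ^ q) ^ u" unfolding power_mult assms(4) ..
  also have "\<dots> = (b ^ u) ^ q" unfolding power_mult[symmetric] by (simp only: mult.commute)
  finally have e: "a * (a ^ v) ^ q = (b ^ u) ^ q" .
  then have "(a ^ v) ^ q dvd (b ^ u) ^ q" unfolding e[symmetric] by simp
  then have "a ^ v dvd b ^ u" using assms(3) by (simp add: pow_divides_pow_iff)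
  then obtain c where c: "b ^ u = a ^ v * c" by (auto elim: dvdE)
  have "a * (a ^ v) ^ q = c ^ q * (a ^ v) ^ q" unfolding e c by (simp add: power_mult_distrib mult.commute)
  then have "a = c ^ q" using assms(1) by simp
  then show ?thesis by blast
qed

text \<open>All complex roots of \<open>X\<^sup>q - a\<close> have the same absolute value. Hence a factor \<open>g\<close> of degree \<open>r\<close> satisfies
\<open>\<bar>g(0)\<bar> ^ q = a ^ r\<close>; for \<open>0 < r < q\<close> the exponents are coprime and \<open>a\<close> is a \<open>q\<close>-th power.\<close>

lemma prime_elem_power_minus_const:
  assumes q: "prime q" and a: "a > 0" "\<nexists>c. a = c ^ q"
  shows "prime_elem (monom 1 q - [:int a:])" "degree (monom 1 q - [:int a:]) = q" "lead_coeff (monom 1 q - [:int a:]) = 1"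
proof -
  define f where "f = monom 1 q - [:int a:]"
  have q0: "q > 0" by (rule prime_gt_0_nat[OF q])
  have cf: "coeff f i = (if i = q then 1 else 0) - (if i = 0 then int a else 0)" for i
    by (cases i) (auto simp: f_def)
  have deg: "degree f = q"
  proof (rule antisym)
    show "degree f \<le> q" by (rule degree_le) (simp add: cf)
    show "q \<le> degree f" by (rule le_degree) (use q0 in \<open>simp add: cf\<close>)
  qed
  have lead: "lead_coeff f = 1" unfolding deg cf using q0 by simp
  show "degree (monom 1 q - [:int a:]) = q" "lead_coeff (monom 1 q - [:int a:]) = 1"
    using deg lead by (simp_all add: f_def)
  have "prime_elem f"
  proof (rule irreducible_monic_intI[OF lead])
    show "degree f > 0" using deg q0 by simp
    fix g h assume gh: "f = g * h" "degree g > 0" "degree h > 0" "\<bar>lead_coeff g\<bar> = 1" "\<bar>lead_coeff h\<bar> = 1"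
    have nz: "g \<noteq> 0" "h \<noteq> 0" using gh by auto
    have dd: "degree g + degree h = q" using gh(1) deg nz by (simp add: degree_mult_eq)
    define G :: "complex poly" where "G = map_poly of_int g"
    have pG: "poly G (of_int x) = of_int (poly g x)" for x
      unfolding G_def by (induction g) (simp_all add: map_poly_pCons)
    have hom: "poly (map_poly of_int (u * v)) z = poly (map_poly of_int u) z * (poly (map_poly of_int v) z :: complex)" for u v :: "int poly" and z
    proof (induction u)
      case (pCons c u)
      have "map_poly of_int (pCons c u * v) = (smult (of_int c) (map_poly of_int v) + pCons 0 (map_poly of_int (u * v)) :: complex poly)"
        by (rule poly_eqI) (simp add: coeff_map_poly coeff_pCons split: nat.split)
      then show ?case using pCons.IH by (simp add: map_poly_pCons algebra_simps)
    qed simp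
    have dG: "degree G = degree g" unfolding G_def by (rule degree_map_poly) auto
    have lG: "norm (lead_coeff G) = 1" unfolding dG unfolding G_def using gh(4)
      by (simp add: coeff_map_poly)
    have G0: "G \<noteq> 0" using dG gh(2) by auto
    obtain A where A: "size A = degree G" "G = smult (lead_coeff G) (\<Prod>x\<in>#A. [:-x, 1:])"
      using alg_closed_imp_factorization[OF G0] by blast
    have root: "norm x ^ q = real a" if "x \<in># A" for x
    proof -
      have "poly (\<Prod>x\<in>#A. [:-x, 1:]) x = 0" using that by (auto simp: poly_prod_mset prod_mset_zero_iff)
      then have "poly G x = 0" by (subst A(2)) simp
      then have "poly (map_poly of_int f) x = 0" unfolding gh(1) hom G_def[symmetric] by simp
      also have "map_poly of_int f = (monom 1 q - [:of_nat a:] :: complex poly)"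
        by (rule poly_eqI) (simp add: f_def coeff_map_poly coeff_pCons split: nat.split)
      finally have "x ^ q = of_nat a" by (simp add: poly_monom)
      then have "norm (x ^ q) = real a" by simp
      then show ?thesis by (simp add: norm_power)
    qed
    have "norm (poly (\<Prod>x\<in>#A. [:-x, 1:]) 0) ^ q = real a ^ size A"
      using root by (induction A) (simp_all add: norm_mult power_mult_distrib)
    then have "norm (poly G 0) ^ q = real a ^ degree g"
      using lG A(1) dG by (subst A(2)) (simp add: norm_mult)
    moreover have "norm (poly G 0) = real_of_int \<bar>poly g 0\<bar>" using pG[of 0] by simp
    ultimately have "real (nat \<bar>poly g 0\<bar> ^ q) = real (a ^ degree g)" by simp
    then have "nat \<bar>poly g 0\<bar> ^ q = a ^ degree g" by (simp only: of_nat_eq_iff)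
    moreover have "coprime (degree g) q"
    proof -
      have "\<not> q dvd degree g" using dd gh(2,3) by (auto dest: dvd_imp_le)
      then have "coprime q (degree g)" by (rule prime_imp_coprime[OF q])
      then show ?thesis by (rule coprime_commute[THEN iffD1])
    qed
    ultimately show False using nth_power_from_coprime[OF a(1) _ q0 _ gh(2)] a(2) by blast
  qed
  then show "prime_elem (monom 1 q - [:int a:])" by (simp add: f_def)
qed

text \<open>Consider the lowest coefficient of \<open>g\<close> not divisible by \<open>q\<close>: modulo \<open>q\<close>, the coefficient of \<open>g * h\<close> at the same
position is its product with \<open>coeff h 0\<close>.\<close>

lemma eisenstein_aux:
  assumes q: "prime q" and F: "\<And>i. i < degree F \<Longrightarrow> int q dvd coeff F i"
    and gh: "F = g * h" "degree g > 0" "degree h > 0" "\<bar>lead_coeff g\<bar> = 1" "\<not> int q dvd coeff h 0"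
  shows False
proof -
  have q1: "\<not> int q dvd 1" using prime_gt_1_nat[OF q] by simp
  have "\<not> int q dvd lead_coeff g" using q1 gh(4) by (metis abs_dvd_iff dvd_abs_iff)
  then have ex: "\<exists>i. \<not> int q dvd coeff g i" by blast
  define m where "m = (LEAST i. \<not> int q dvd coeff g i)"
  have m: "\<not> int q dvd coeff g m" using LeastI_ex[OF ex] by (simp add: m_def)
  have least: "int q dvd coeff g i" if "i < m" for i using not_less_Least[of i] that unfolding m_def by blast
  have "coeff g m \<noteq> 0" using m by (intro notI) simp
  then have "m \<le> degree g" by (rule le_degree)
  also have "\<dots> < degree F" using gh by (subst gh(1), subst degree_mult_eq) auto
  finally have "int q dvd coeff F m" by (rule F)
  also have "coeff F m = (\<Sum>i\<le>m. coeff g i * coeff h (m - i))" by (simp add: gh(1) coeff_mult)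
  also have "\<dots> = coeff g m * coeff h 0 + (\<Sum>i<m. coeff g i * coeff h (m - i))"
    by (simp add: lessThan_Suc_atMost[symmetric])
  finally have "int q dvd coeff g m * coeff h 0 + (\<Sum>i<m. coeff g i * coeff h (m - i))" .
  moreover have "int q dvd (\<Sum>i<m. coeff g i * coeff h (m - i))" by (intro dvd_sum dvd_mult2 least) simp
  ultimately have "int q dvd coeff g m * coeff h 0" by (simp add: dvd_add_left_iff)
  then show False using m gh(5) q by (simp add: prime_dvd_mult_iff)
qed

lemma eisenstein:
  assumes q: "prime q" and F: "lead_coeff F = 1" "degree F > 0" "\<And>i. i < degree F \<Longrightarrow> int q dvd coeff F i"
    "\<not> (int q)\<^sup>2 dvd coeff F 0"
  shows "prime_elem F"
proof (rule irreducible_monic_intI[OF F(1,2)])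
  fix g h assume gh: "F = g * h" "degree g > 0" "degree h > 0" "\<bar>lead_coeff g\<bar> = 1" "\<bar>lead_coeff h\<bar> = 1"
  have c: "coeff F 0 = coeff g 0 * coeff h 0" by (simp add: gh(1) coeff_mult)
  have "\<not> (int q dvd coeff g 0 \<and> int q dvd coeff h 0)"
    using F(4) unfolding c by (auto simp: power2_eq_square intro: mult_dvd_mono)
  then consider "\<not> int q dvd coeff h 0" | "\<not> int q dvd coeff g 0" by blast
  then show False
  proof cases
    case 1
    then show ?thesis using eisenstein_aux[OF q F(3) gh(1-4)] by blast
  next
    case 2
    have "F = h * g" using gh(1) by (simp add: mult.commute)
    then show ?thesis using eisenstein_aux[OF q F(3) _ gh(3,2,5) 2] by blast
  qed
qed

text \<open>The polynomial \<open>((X + 1)\<^sup>q - 1) / X\<close>, the \<open>q\<close>-th cyclotomic polynomial at \<open>X + 1\<close>, for which Eisenstein's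
criterion holds.\<close>

definition shifted_cyclotomic :: "nat \<Rightarrow> int poly" where
  "shifted_cyclotomic q = (\<Sum>i<q. monom (int (q choose Suc i)) i)"

lemma coeff_shifted_cyclotomic: "coeff (shifted_cyclotomic q) i = (if i < q then int (q choose Suc i) else 0)"
  by (simp add: shifted_cyclotomic_def coeff_sum)

lemma shifted_cyclotomic_eq: "[:0, 1:] * shifted_cyclotomic q + 1 = [:1, 1:] ^ q"
proof -
  have "poly ([:0, 1:] * shifted_cyclotomic q + 1) x = poly ([:1, 1:] ^ q) x" for x
  proof -
    have "poly ([:1, 1:] ^ q) x = (x + 1) ^ q" by (simp add: add.commute)
    also have "\<dots> = (\<Sum>k\<le>q. int (q choose k) * x ^ k)" by (simp add: binomial_ring)
    also have "\<dots> = 1 + (\<Sum>k<q. int (q choose Suc k) * x ^ Suc k)"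
      by (subst lessThan_Suc_atMost[symmetric], subst sum.lessThan_Suc_shift) simp
    also have "\<dots> = poly ([:0, 1:] * shifted_cyclotomic q + 1) x"
      by (simp add: shifted_cyclotomic_def poly_sum poly_monom sum_distrib_left mult_ac)
    finally show ?thesis by simp
  qed
  then have "poly ([:0, 1:] * shifted_cyclotomic q + 1) = poly ([:1, 1:] ^ q)" by (rule ext)
  then show ?thesis by (simp only: poly_eq_poly_eq_iff)
qed

lemma prime_elem_shifted_cyclotomic:
  assumes q: "prime q" "odd q"
  shows "prime_elem (shifted_cyclotomic q)" "degree (shifted_cyclotomic q) = q - 1" "lead_coeff (shifted_cyclotomic q) = 1" "q - 1 > 0"
proof -
  have q2: "q > 2" using q prime_ge_2_nat[of q] by (cases "q = 2") auto
  have d: "degree (shifted_cyclotomic q) = q - 1"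
  proof (rule antisym)
    show "degree (shifted_cyclotomic q) \<le> q - 1"
      by (rule degree_le) (use q2 in \<open>auto simp: coeff_shifted_cyclotomic\<close>)
    show "q - 1 \<le> degree (shifted_cyclotomic q)"
      by (rule le_degree) (use q2 in \<open>auto simp: coeff_shifted_cyclotomic\<close>)
  qed
  show "degree (shifted_cyclotomic q) = q - 1" by (rule d)
  show l: "lead_coeff (shifted_cyclotomic q) = 1" unfolding d coeff_shifted_cyclotomic using q2 by simp
  show "q - 1 > 0" using q2 by simp
  show "prime_elem (shifted_cyclotomic q)"
  proof (rule eisenstein[OF q(1) l])
    show "0 < degree (shifted_cyclotomic q)" using d q2 by simp
    show "int q dvd coeff (shifted_cyclotomic q) i" if "i < degree (shifted_cyclotomic q)" for i
    proof -
      have "q dvd (q choose Suc i)" using that d q2 q(1) by (intro dvd_choose_prime) auto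
      then show ?thesis by (simp add: coeff_shifted_cyclotomic)
    qed
    show "\<not> (int q)\<^sup>2 dvd coeff (shifted_cyclotomic q) 0"
    proof
      assume "(int q)\<^sup>2 dvd coeff (shifted_cyclotomic q) 0"
      then have "(int q)\<^sup>2 dvd int q" using q2 by (simp add: coeff_shifted_cyclotomic)
      then have "(int q)\<^sup>2 \<le> int q" using q2 by (intro zdvd_imp_le) auto
      then show False using q2 by (simp add: power2_eq_square)
    qed
  qed
qed

text \<open>If \<open>r\<close> is a root, then \<open>r + 1\<close> has order \<open>q\<close> modulo \<open>p\<close>. Simplicity comes from differentiating
\<open>X * F + 1 = (X + 1)\<^sup>q\<close>.\<close>

lemma shifted_cyclotomic_root:
  assumes q: "prime q" and p: "prime p" "p > q" and r: "int p dvd poly (shifted_cyclotomic q) r"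
  shows "q dvd p - 1" "\<not> int p dvd poly (pderiv (shifted_cyclotomic q)) r"
proof -
  let ?F = "shifted_cyclotomic q"
  have q0: "q > 0" by (rule prime_gt_0_nat[OF q])
  have pq: "\<not> int p dvd int q" using p q0 by (auto dest: dvd_imp_le)
  have pp: "prime (int p)" using p by simp
  have "poly ([:0, 1:] * ?F + 1) r = poly ([:1, 1:] ^ q) r" by (simp only: shifted_cyclotomic_eq)
  then have e: "(r + 1) ^ q = r * poly ?F r + 1" by (simp add: add.commute)
  have c: "[(r + 1) ^ q = 1] (mod int p)" using r by (simp add: e cong_iff_dvd_diff)
  have nd: "\<not> int p dvd r + 1"
  proof
    assume "int p dvd r + 1"
    then have "int p dvd (r + 1) ^ q" using q0 by (meson dvd_power dvd_trans)
    then have "int p dvd 1" using c by (simp add: cong_dvd_iff)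
    then show False using prime_gt_1_nat[OF p(1)] by simp
  qed
  have r0: "\<not> int p dvd r"
  proof
    assume "int p dvd r"
    obtain h where "?F = [:- 0, 1:] * h + [:poly ?F 0:]" using synthetic_div[of ?F 0] by blast
    then have "poly ?F r = poly ([:- 0, 1:] * h + [:poly ?F 0:]) r" by (rule arg_cong)
    then have "poly ?F 0 = poly ?F r - r * poly h r" by simp
    then have "int p dvd poly ?F 0" using r \<open>int p dvd r\<close> by simp
    moreover have "poly ?F 0 = int q" using q0 by (simp add: poly_0_coeff_0 coeff_shifted_cyclotomic)
    ultimately show False using pq by simp
  qed
  have p0: "p > 0" by (rule prime_gt_0_nat[OF p(1)])
  define n where "n = nat ((r + 1) mod int p)"
  have n: "[int n = r + 1] (mod int p)" using p0 by (simp add: n_def)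
  have "[int n ^ q = 1] (mod int p)" using cong_trans[OF cong_pow[OF n] c] .
  then have "[int (n ^ q) = int 1] (mod int p)" by simp
  then have nq: "[n ^ q = 1] (mod p)" by (simp only: cong_int_iff)
  then have "ord p n dvd q" by (rule ord_divides[THEN iffD1])
  moreover have "ord p n \<noteq> 1"
  proof
    assume "ord p n = 1"
    then have "[n ^ 1 = 1] (mod p)" using ord[of n p] by simp
    then have "[int n = int 1] (mod int p)" by (simp only: cong_int_iff power_one_right)
    then have "[r + 1 = 1] (mod int p)" using n cong_trans cong_sym by (metis of_nat_1)
    then show False using r0 by (simp add: cong_iff_dvd_diff)
  qed
  ultimately have "ord p n = q" using q by (auto simp: prime_nat_iff)
  moreover have "coprime p n"
  proof -
    have "\<not> p dvd n"
    proof
      assume "p dvd n"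
      then have "p dvd n ^ q" using q0 by (meson dvd_power dvd_trans)
      then have "p dvd 1" using nq by (simp add: cong_dvd_iff)
      then show False using prime_gt_1_nat[OF p(1)] by simp
    qed
    then show ?thesis by (rule prime_imp_coprime[OF p(1)])
  qed
  ultimately show "q dvd p - 1" using order_divides_totient[of p n] p(1) by (simp add: totient_prime)
  have "pderiv ([:0, 1:] * ?F + 1) = pderiv ([:1, 1:] ^ q)" by (simp only: shifted_cyclotomic_eq)
  then have "[:0, 1:] * pderiv ?F + ?F = smult (of_nat q) ([:1, 1:] ^ (q - 1))"
    by (simp only: pderiv_add pderiv_mult pderiv_power) (simp add: pderiv_pCons one_pCons)
  then have "poly ([:0, 1:] * pderiv ?F + ?F) r = poly (smult (of_nat q) ([:1, 1:] ^ (q - 1))) r" by simp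
  then have d: "r * poly (pderiv ?F) r + poly ?F r = int q * (r + 1) ^ (q - 1)" by (simp add: add.commute)
  show "\<not> int p dvd poly (pderiv ?F) r"
  proof
    assume "int p dvd poly (pderiv ?F) r"
    then have "int p dvd int q * (r + 1) ^ (q - 1)" unfolding d[symmetric] using r by simp
    then show False using pq nd pp prime_dvd_power[of "int p"] by (auto simp: prime_dvd_mult_iff)
  qed
qed

section \<open>Mean values of power residues\<close>

lemma prime_sum_compare:
  fixes a b :: "nat \<Rightarrow> real"
  assumes "\<And>p. prime p \<Longrightarrow> p > P \<Longrightarrow> a p \<le> b p"
  shows "\<exists>D. \<forall>Z. (\<Sum>p | prime p \<and> p \<le> (Z::nat). a p) \<le> (\<Sum>p | prime p \<and> p \<le> Z. b p) + D"
proof -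
  have fin: "finite {p. prime p \<and> p \<le> (Z::nat)}" for Z by (rule finite_subset[of _ "{..Z}"]) auto
  define e where "e p = (if p \<le> P then \<bar>a p - b p\<bar> else 0)" for p
  have "(\<Sum>p | prime p \<and> p \<le> (Z::nat). a p) \<le> (\<Sum>p | prime p \<and> p \<le> Z. b p) + (\<Sum>p\<le>P. e p)" for Z
  proof -
    have "(\<Sum>p | prime p \<and> p \<le> Z. a p) \<le> (\<Sum>p | prime p \<and> p \<le> Z. b p + e p)"
    proof (rule sum_mono)
      fix p assume "p \<in> {p. prime p \<and> p \<le> Z}"
      then show "a p \<le> b p + e p" using assms[of p] by (cases "p \<le> P") (auto simp: e_def)
    qed
    also have "\<dots> = (\<Sum>p | prime p \<and> p \<le> Z. b p) + (\<Sum>p | prime p \<and> p \<le> Z. e p)" by (rule sum.distrib)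
    also have "(\<Sum>p | prime p \<and> p \<le> Z. e p) = (\<Sum>p\<in>{p. prime p \<and> p \<le> Z} \<inter> {..P}. e p)"
      by (rule sum.mono_neutral_right) (auto simp: fin e_def)
    also have "\<dots> \<le> (\<Sum>p\<le>P. e p)" by (rule sum_mono2) (auto simp: e_def)
    finally show ?thesis by simp
  qed
  then show ?thesis by blast
qed

text \<open>The root counts are only ever compared with simpler weights \<open>M\<close>, for all but finitely many primes. The bound
\<open>degree f\<close> on the number of roots, valid for large primes, may be used in that comparison.\<close>

lemma mertens_lower_weights:
  assumes f: "monic_prime_poly f"
    and simple: "\<And>p r. prime p \<Longrightarrow> p > P \<Longrightarrow> int p dvd poly f r \<Longrightarrow> \<not> int p dvd poly (pderiv f) r"
    and M: "\<And>p. prime p \<Longrightarrow> p > P \<Longrightarrow> card {r \<in> {0..<int p}. int p dvd poly f r} \<le> degree f \<Longrightarrow>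
      real (card {r \<in> {0..<int p}. int p dvd poly f r}) \<le> M p"
  shows "\<exists>C. \<forall>Z\<ge>3. ln (ln Z) - C \<le> (\<Sum>p | prime p \<and> p \<le> (Z::nat). M p / p)"
proof -
  interpret monic_prime_poly f by (rule f)
  define P' where "P' = max P (nat ((2 * K) ^ degree f))"
  have big: "int p > (2 * K) ^ degree f" if "p > P'" for p using that unfolding P'_def by linarith
  have "regular_prime p" if "prime p" "p > P'" for p
    using simple[of p] big that unfolding regular_prime_def P'_def by auto
  from mertens_lower[OF this] obtain C where
    C: "\<And>Z. Z \<ge> 3 \<Longrightarrow> ln (ln Z) - C \<le> (\<Sum>p | prime p \<and> p \<le> (Z::nat). real (card (roots_mod p)) / p)" by blast
  have "real (card (roots_mod p)) / p \<le> M p / p" if "prime p" "p > P'" for p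
    using M[OF that(1)] card_roots_mod_small[OF big[OF that(2)] that(1)] that(2)
    unfolding roots_mod_def P'_def by (intro divide_right_mono) auto
  from prime_sum_compare[of P' "\<lambda>p. real (card (roots_mod p)) / p" "\<lambda>p. M p / p", OF this] obtain D where
    D: "\<And>Z. (\<Sum>p | prime p \<and> p \<le> (Z::nat). real (card (roots_mod p)) / p) \<le> (\<Sum>p | prime p \<and> p \<le> Z. M p / p) + D" by blast
  have "ln (ln Z) - (C + D) \<le> (\<Sum>p | prime p \<and> p \<le> (Z::nat). M p / p)" if "Z \<ge> 3" for Z
    using C[OF that] D[of Z] by linarith
  then show ?thesis by blast
qed

lemma mertens_upper_weights:
  assumes f: "monic_prime_poly f"
    and M: "\<And>p. prime p \<Longrightarrow> p > P \<Longrightarrow> M p \<le> real (card {r \<in> {0..<int p}. int p dvd poly f r})"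
  shows "\<exists>C. \<forall>Z\<ge>3. (\<Sum>p | prime p \<and> p \<le> (Z::nat). M p / p) \<le> ln (ln Z) + C"
proof -
  interpret monic_prime_poly f by (rule f)
  obtain C where C: "\<And>Z. Z \<ge> 3 \<Longrightarrow> (\<Sum>p | prime p \<and> p \<le> (Z::nat). real (card (roots_mod p)) / p) \<le> ln (ln Z) + C"
    using mertens_upper by blast
  have "M p / p \<le> real (card (roots_mod p)) / p" if "prime p" "p > P" for p
    using M[OF that] unfolding roots_mod_def by (intro divide_right_mono) auto
  from prime_sum_compare[of P "\<lambda>p. M p / p" "\<lambda>p. real (card (roots_mod p)) / p", OF this] obtain D where
    D: "\<And>Z. (\<Sum>p | prime p \<and> p \<le> (Z::nat). M p / p) \<le> (\<Sum>p | prime p \<and> p \<le> Z. real (card (roots_mod p)) / p) + D" by blast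
  have "(\<Sum>p | prime p \<and> p \<le> (Z::nat). M p / p) \<le> ln (ln Z) + (C + D)" if "Z \<ge> 3" for Z
    using C[OF that] D[of Z] by linarith
  then show ?thesis by blast
qed

lemma monic_prime_poly_X: "monic_prime_poly [:0, 1:]"
proof
  show "prime_elem ([:0, 1:] :: int poly)"
  proof (rule prime_elemI)
    show "\<not> is_unit ([:0, 1:] :: int poly)" by (auto simp: is_unit_poly_iff)
    fix a b :: "int poly" assume "[:0, 1:] dvd a * b"
    then have "poly (a * b) 0 = 0" using poly_eq_0_iff_dvd[of "a * b" 0] by simp
    then show "[:0, 1:] dvd a \<or> [:0, 1:] dvd b" using poly_eq_0_iff_dvd[of a 0] poly_eq_0_iff_dvd[of b 0] by auto
  qed simp
qed simp_all

text \<open>The polynomial \<open>X\<close> has exactly one root modulo every prime.\<close>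

theorem mertens: "\<exists>C. \<forall>Z\<ge>3. \<bar>(\<Sum>p | prime p \<and> p \<le> (Z::nat). 1 / real p) - ln (ln Z)\<bar> \<le> C"
proof -
  have c: "card {r \<in> {0..<int p}. int p dvd poly [:0, 1:] r} = 1" if "prime p" for p
  proof -
    have "{r \<in> {0..<int p}. int p dvd poly [:0, 1:] r} = {0}"
      using prime_gt_0_nat[OF that] by (auto dest: zdvd_imp_le)
    then show ?thesis by simp
  qed
  obtain C1 where C1: "\<And>Z. Z \<ge> 3 \<Longrightarrow> (\<Sum>p | prime p \<and> p \<le> (Z::nat). 1 / real p) \<le> ln (ln Z) + C1"
    using mertens_upper_weights[OF monic_prime_poly_X, of 0 "\<lambda>_. 1"] c by auto
  have "\<exists>C. \<forall>Z\<ge>3. ln (ln Z) - C \<le> (\<Sum>p | prime p \<and> p \<le> (Z::nat). 1 / real p)"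
  proof (rule mertens_lower_weights[OF monic_prime_poly_X, of 0])
    fix p :: nat and r assume "prime p"
    then show "\<not> int p dvd poly (pderiv [:0, 1:]) r" using prime_gt_1_nat[of p] by (simp add: pderiv_pCons)
  qed (use c in simp)
  then obtain C2 where C2: "\<And>Z. Z \<ge> 3 \<Longrightarrow> ln (ln Z) - C2 \<le> (\<Sum>p | prime p \<and> p \<le> (Z::nat). 1 / real p)" by blast
  have "\<bar>(\<Sum>p | prime p \<and> p \<le> (Z::nat). 1 / real p) - ln (ln Z)\<bar> \<le> \<bar>C1\<bar> + \<bar>C2\<bar>" if "Z \<ge> 3" for Z
    using C1[OF that] C2[OF that] by linarith
  then show ?thesis by blast
qed

text \<open>The primes that are \<open>1\<close> modulo \<open>q\<close> are those that split completely in the \<open>q\<close>-th cyclotomic field.\<close>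

definition split_sum :: "nat \<Rightarrow> nat \<Rightarrow> real" where
  "split_sum q Z = (\<Sum>p | prime (p::nat) \<and> p \<le> Z. if q dvd p - 1 then 1 / real p else 0)"

definition residue_sum :: "nat \<Rightarrow> nat \<Rightarrow> nat \<Rightarrow> real" where
  "residue_sum q a Z = (\<Sum>p | prime (p::nat) \<and> p \<le> Z. if q dvd p - 1 \<and> power_residue q p (int a) then 1 / real p else 0)"

text \<open>For large \<open>p\<close>, the polynomial \<open>X\<^sup>q - a\<close> has one root modulo \<open>p\<close> if \<open>q\<close> does not divide \<open>p - 1\<close>, and otherwise
\<open>q\<close> roots or none, according to whether \<open>a\<close> is a \<open>q\<close>-th power. Subtracting the sum of \<open>1/p\<close> over all primes, which has
the same asymptotics, leaves the difference in question.\<close>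

theorem residue_sum_asymp:
  assumes q: "prime q" and a: "a > 0" "\<nexists>c. a = c ^ q"
  shows "\<exists>C. \<forall>Z\<ge>3. \<bar>real q * residue_sum q a Z - split_sum q Z\<bar> \<le> C"
proof -
  define f where "f = monom 1 q - [:int a:]"
  note pe = prime_elem_power_minus_const[OF q a]
  have q0: "q > 0" by (rule prime_gt_0_nat[OF q])
  have deg: "degree f = q" using pe(2) by (simp add: f_def)
  have f: "monic_prime_poly f" by unfold_locales (use pe q0 in \<open>simp_all add: f_def\<close>)
  have pf: "poly f r = r ^ q - int a" for r by (simp add: f_def poly_monom)
  have dpf: "poly (pderiv f) r = int q * r ^ (q - 1)" for r
    by (simp add: f_def pderiv_diff pderiv_monom poly_monom pderiv_pCons)
  have nd: "\<not> p dvd a" "\<not> p dvd q" if "prime p" "p > q * a" for p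
  proof -
    have "q \<le> q * a" "a \<le> q * a" using q0 a(1) by simp_all
    then have "p > q" "p > a" using that(2) by linarith+
    then show "\<not> p dvd a" "\<not> p dvd q" using q0 a(1) by (auto dest: dvd_imp_le)
  qed
  define M where "M p = (if q dvd p - 1 then if power_residue q p (int a) then real q else 0 else 1)" for p
  have roots: "card {r \<in> {0..<int p}. int p dvd poly f r} = card {n. n < p \<and> [n ^ q = a] (mod p)}" for p
    unfolding pf root_set_nat by (rule card_image) simp
  have up: "M p \<le> real (card {r \<in> {0..<int p}. int p dvd poly f r})" if "prime p" "p > q * a" for p
    unfolding roots M_def
    using card_roots_residue[OF that(1) q0 _ nd(1)[OF that]] card_roots_coprime[OF that(1) q _ nd(1)[OF that]] by simp
  have low: "real (card {r \<in> {0..<int p}. int p dvd poly f r}) \<le> M p"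
    if "prime p" "p > q * a" "card {r \<in> {0..<int p}. int p dvd poly f r} \<le> degree f" for p
    using that(3) unfolding roots M_def deg
    using card_roots_nonresidue[of p q a] prime_gt_0_nat[OF that(1)] card_roots_coprime[OF that(1) q _ nd(1)[OF that(1,2)]] by simp
  have simple: "\<not> int p dvd poly (pderiv f) r" if p: "prime p" "p > q * a" and r: "int p dvd poly f r" for p r
  proof
    assume "int p dvd poly (pderiv f) r"
    then have "int p dvd int q \<or> int p dvd r ^ (q - 1)" unfolding dpf using p by (simp add: prime_dvd_mult_iff)
    then have "int p dvd r" using nd(2)[OF p] p prime_dvd_power[of "int p" r] by auto
    then have "int p dvd r ^ q" using q0 by (meson dvd_power dvd_trans)
    then have "int p dvd r ^ q - (r ^ q - int a)" using r unfolding pf by (rule dvd_diff)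
    then show False using nd(1)[OF p] by simp
  qed
  obtain C1 where C1: "\<And>Z. Z \<ge> 3 \<Longrightarrow> (\<Sum>p | prime p \<and> p \<le> (Z::nat). M p / p) \<le> ln (ln Z) + C1"
    using mertens_upper_weights[OF f up] by blast
  obtain C2 where C2: "\<And>Z. Z \<ge> 3 \<Longrightarrow> ln (ln Z) - C2 \<le> (\<Sum>p | prime p \<and> p \<le> (Z::nat). M p / p)"
    using mertens_lower_weights[OF f simple low] by blast
  obtain C3 where C3: "\<And>Z. Z \<ge> 3 \<Longrightarrow> \<bar>(\<Sum>p | prime p \<and> p \<le> (Z::nat). 1 / real p) - ln (ln Z)\<bar> \<le> C3"
    using mertens by blast
  have eq: "real q * residue_sum q a Z - split_sum q Z = (\<Sum>p | prime p \<and> p \<le> Z. M p / p) - (\<Sum>p | prime p \<and> p \<le> Z. 1 / real p)" for Z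
    unfolding residue_sum_def split_sum_def sum_distrib_left sum_subtractf[symmetric] M_def
    by (intro sum.cong) auto
  have "\<bar>real q * residue_sum q a Z - split_sum q Z\<bar> \<le> \<bar>C1\<bar> + \<bar>C2\<bar> + \<bar>C3\<bar>" if "Z \<ge> 3" for Z
    unfolding eq using C1[OF that] C2[OF that] C3[OF that] by linarith
  then show ?thesis by blast
qed

text \<open>The shifted cyclotomic polynomial has roots only modulo primes that are \<open>1\<close> modulo \<open>q\<close>, and at most \<open>q - 1\<close> of
them.\<close>

theorem split_sum_unbounded:
  assumes q: "prime q" "odd q"
  shows "\<exists>C. \<forall>Z\<ge>3. ln (ln Z) - C \<le> real (q - 1) * split_sum q Z"
proof -
  let ?F = "shifted_cyclotomic q"
  note pe = prime_elem_shifted_cyclotomic[OF q]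
  have f: "monic_prime_poly ?F" by unfold_locales (use pe in simp_all)
  have "\<exists>C. \<forall>Z\<ge>3. ln (ln Z) - C \<le> (\<Sum>p | prime p \<and> p \<le> (Z::nat). (if q dvd p - 1 then real (q - 1) else 0) / real p)"
  proof (rule mertens_lower_weights[OF f, of q])
    show "\<not> int p dvd poly (pderiv ?F) r" if "prime p" "q < p" "int p dvd poly ?F r" for p r
      by (rule shifted_cyclotomic_root(2)[OF q(1) that])
    fix p assume p: "prime p" "q < p" "card {r \<in> {0..<int p}. int p dvd poly ?F r} \<le> degree ?F"
    show "real (card {r \<in> {0..<int p}. int p dvd poly ?F r}) \<le> (if q dvd p - 1 then real (q - 1) else 0)"
    proof (cases "q dvd p - 1")
      case True
      then show ?thesis using p(3) pe(2) by simp
    next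
      case False
      then have "{r \<in> {0..<int p}. int p dvd poly ?F r} = {}"
        using shifted_cyclotomic_root(1)[OF q(1) p(1,2)] by blast
      then show ?thesis by (simp only: card.empty) simp
    qed
  qed
  moreover have "(\<Sum>p | prime p \<and> p \<le> (Z::nat). (if q dvd p - 1 then real (q - 1) else 0) / real p) = real (q - 1) * split_sum q Z" for Z
    unfolding split_sum_def sum_distrib_left by (intro sum.cong) auto
  ultimately show ?thesis by simp
qed

section \<open>Linear algebra over a prime field by counting\<close>

text \<open>Vectors are the extensional functions with values in \<open>{0..<int q}\<close> that make up the carrier of \<open>Fq_space q n\<close>; subspaces
are handled through their cardinality, the codimension \<open>k\<close> being expressed as size \<open>q ^ (n - k)\<close>. A linear functional is
\<open>dot m\<close> for an arbitrary integer vector \<open>m\<close>, read modulo \<open>q\<close>.\<close>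

locale prime_vectors =
  fixes q :: nat and n :: nat
  assumes q: "prime q"
begin

definition vecs :: "(nat \<Rightarrow> int) set" where "vecs = {..<n} \<rightarrow>\<^sub>E {0..<int q}"
definition dot :: "(nat \<Rightarrow> int) \<Rightarrow> (nat \<Rightarrow> int) \<Rightarrow> int" where "dot u v = (\<Sum>i<n. u i * v i)"
definition vadd :: "(nat \<Rightarrow> int) \<Rightarrow> (nat \<Rightarrow> int) \<Rightarrow> nat \<Rightarrow> int" where
  "vadd u v = (\<lambda>i\<in>{..<n}. (u i + v i) mod int q)"
definition vscale :: "int \<Rightarrow> (nat \<Rightarrow> int) \<Rightarrow> nat \<Rightarrow> int" where
  "vscale c v = (\<lambda>i\<in>{..<n}. (c * v i) mod int q)"
definition vzero :: "nat \<Rightarrow> int" where "vzero = (\<lambda>i\<in>{..<n}. 0)"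

definition subsp :: "(nat \<Rightarrow> int) set \<Rightarrow> bool" where
  "subsp W \<longleftrightarrow> W \<subseteq> vecs \<and> vzero \<in> W \<and> (\<forall>u\<in>W. \<forall>v\<in>W. vadd u v \<in> W) \<and> (\<forall>c. \<forall>v\<in>W. vscale c v \<in> W)"

lemma q0: "q > 0" using prime_gt_0_nat[OF q] .

lemma vecs_ext: "u \<in> vecs \<Longrightarrow> v \<in> vecs \<Longrightarrow> (\<And>i. i < n \<Longrightarrow> [u i = v i] (mod int q)) \<Longrightarrow> u = v"
proof -
  assume a: "u \<in> vecs" "v \<in> vecs" "\<And>i. i < n \<Longrightarrow> [u i = v i] (mod int q)"
  have "u i = v i" if "i \<in> {..<n}" for i
  proof -
    have "u i \<in> {0..<int q}" "v i \<in> {0..<int q}"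
      by (rule PiE_mem[OF a(1)[unfolded vecs_def] that], rule PiE_mem[OF a(2)[unfolded vecs_def] that])
    then show ?thesis using a(3)[of i] that by (simp add: Cong.cong_def)
  qed
  then show ?thesis by (rule PiE_ext[OF a(1)[unfolded vecs_def] a(2)[unfolded vecs_def]])
qed

lemma mod_vec: "(\<lambda>i\<in>{..<n}. g i mod int q) \<in> vecs"
  using q0 by (auto simp: vecs_def)
lemma vadd_vecs: "vadd u v \<in> vecs" unfolding vadd_def by (rule mod_vec)
lemma vscale_vecs: "vscale c v \<in> vecs" unfolding vscale_def by (rule mod_vec)
lemma vzero_vecs: "vzero \<in> vecs" using q0 by (auto simp: vzero_def vecs_def)

lemma vadd_cong: "i < n \<Longrightarrow> [vadd u v i = u i + v i] (mod int q)" by (simp add: vadd_def Cong.cong_def)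
lemma vscale_cong: "i < n \<Longrightarrow> [vscale c v i = c * v i] (mod int q)" by (simp add: vscale_def Cong.cong_def)

lemma dot_vadd: "[dot m (vadd u v) = dot m u + dot m v] (mod int q)"
proof -
  have "[dot m (vadd u v) = (\<Sum>i<n. m i * (u i + v i))] (mod int q)"
    unfolding dot_def by (intro cong_sum cong_mult cong_refl vadd_cong) simp
  then show ?thesis by (simp add: dot_def sum.distrib distrib_left)
qed

lemma dot_vscale: "[dot m (vscale c v) = c * dot m v] (mod int q)"
proof -
  have "[dot m (vscale c v) = (\<Sum>i<n. m i * (c * v i))] (mod int q)"
    unfolding dot_def by (intro cong_sum cong_mult cong_refl vscale_cong) simp
  then show ?thesis by (simp add: dot_def sum_distrib_left mult.left_commute)
qed

lemma dot_vzero: "dot m vzero = 0" by (simp add: dot_def vzero_def)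

lemma finite_vecs: "finite vecs" unfolding vecs_def by (intro finite_PiE) auto
lemma card_vecs: "card vecs = q ^ n" unfolding vecs_def by (simp add: card_PiE)

lemma subsp_vecs: "subsp vecs" by (simp add: subsp_def vzero_vecs vadd_vecs vscale_vecs)

lemma subsp_kernel:
  assumes U: "subsp U"
  shows "subsp {u \<in> U. int q dvd dot m u}"
proof -
  have "int q dvd dot m (vadd u v)" if "int q dvd dot m u" "int q dvd dot m v" for u v
    using cong_dvd_iff[OF dot_vadd[of m u v]] that by simp
  moreover have "int q dvd dot m (vscale c v)" if "int q dvd dot m v" for c v
    using cong_dvd_iff[OF dot_vscale[of m c v]] that by simp
  ultimately show ?thesis using U unfolding subsp_def by (auto simp: dot_vzero)
qed

lemma subsp_finite: "subsp U \<Longrightarrow> finite U"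
  by (rule finite_subset[OF _ finite_vecs]) (simp add: subsp_def)

lemma vadd_cancel: "w \<in> vecs \<Longrightarrow> w' \<in> vecs \<Longrightarrow> vadd w x = vadd w' x \<Longrightarrow> w = w'"
proof (rule vecs_ext)
  fix i assume a: "w \<in> vecs" "w' \<in> vecs" "vadd w x = vadd w' x" and i: "i < n"
  have "[w i + x i = vadd w x i] (mod int q)" by (rule cong_sym[OF vadd_cong[OF i]])
  also have "vadd w x i = vadd w' x i" using a by simp
  also have "[\<dots> = w' i + x i] (mod int q)" by (rule vadd_cong[OF i])
  finally show "[w i = w' i] (mod int q)" by (simp add: cong_add_rcancel)
qed

text \<open>The \<open>q\<close> fibres of the functional are translates of each other.\<close>

lemma card_kernel:
  assumes U: "subsp U" and u: "u \<in> U" "\<not> int q dvd dot m u"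
  shows "card U = q * card {w \<in> U. int q dvd dot m w}"
proof -
  define N where "N = {w \<in> U. int q dvd dot m w}"
  have finU: "finite U" by (rule subsp_finite[OF U])
  have UV: "U \<subseteq> vecs" using U by (simp add: subsp_def)
  obtain a where a: "\<exists>k. a * dot m u = 1 + int q * k" using prime_unit_mod[OF q u(2)] by blast
  define x where "x = vscale a u"
  have xU: "x \<in> U" using U u by (auto simp: subsp_def x_def)
  have dx: "[dot m x = 1] (mod int q)"
  proof -
    have "[dot m x = a * dot m u] (mod int q)" unfolding x_def by (rule dot_vscale)
    moreover have "[a * dot m u = 1] (mod int q)" using a by (auto simp: cong_iff_dvd_diff)
    ultimately show ?thesis by (rule cong_trans)
  qed
  define F where "F c = {w \<in> U. [dot m w = c] (mod int q)}" for c
  have le: "card (F c) \<le> card (F (c + e))" for c e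
  proof (rule card_inj_on_le[of "\<lambda>w. vadd w (vscale e x)"])
    show "inj_on (\<lambda>w. vadd w (vscale e x)) (F c)"
    proof (rule inj_onI)
      fix a b assume ab: "a \<in> F c" "b \<in> F c" "vadd a (vscale e x) = vadd b (vscale e x)"
      then have "a \<in> vecs" "b \<in> vecs" using UV by (auto simp: F_def)
      then show "a = b" using ab(3) by (rule vadd_cancel)
    qed
    show "finite (F (c + e))" using finU by (simp add: F_def)
    show "(\<lambda>w. vadd w (vscale e x)) ` F c \<subseteq> F (c + e)"
    proof (rule image_subsetI)
      fix w assume w: "w \<in> F c"
      have "[dot m (vadd w (vscale e x)) = dot m w + dot m (vscale e x)] (mod int q)" by (rule dot_vadd)
      also have "[dot m w + dot m (vscale e x) = c + e * 1] (mod int q)"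
      proof (rule cong_add)
        show "[dot m w = c] (mod int q)" using w by (simp add: F_def)
        show "[dot m (vscale e x) = e * 1] (mod int q)"
          by (rule cong_trans[OF dot_vscale]) (rule cong_mult[OF cong_refl dx])
      qed
      finally have "[dot m (vadd w (vscale e x)) = c + e] (mod int q)" by simp
      then show "vadd w (vscale e x) \<in> F (c + e)" using w xU U by (auto simp: F_def subsp_def)
    qed
  qed
  have eq: "card (F c) = card N" for c
  proof -
    have "F 0 = N" by (simp add: F_def N_def cong_0_iff)
    then show ?thesis using le[of 0 c] le[of c "-c"] by simp
  qed
  have "U = (\<Union>c\<in>{0..<int q}. F c)"
  proof
    show "U \<subseteq> (\<Union>c\<in>{0..<int q}. F c)"
    proof
      fix w assume w: "w \<in> U"
      then have "w \<in> F (dot m w mod int q)" by (simp add: F_def Cong.cong_def)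
      then show "w \<in> (\<Union>c\<in>{0..<int q}. F c)" using q0 by (intro UN_I[of "dot m w mod int q"]) auto
    qed
  qed (auto simp: F_def)
  then have "card U = card (\<Union>c\<in>{0..<int q}. F c)" by simp
  also have "\<dots> = (\<Sum>c\<in>{0..<int q}. card (F c))"
  proof (rule card_UN_disjoint)
    show "\<forall>c\<in>{0..<int q}. \<forall>d\<in>{0..<int q}. c \<noteq> d \<longrightarrow> F c \<inter> F d = {}"
    proof (intro ballI impI)
      fix c d assume cd: "c \<in> {0..<int q}" "d \<in> {0..<int q}" "c \<noteq> d"
      show "F c \<inter> F d = {}"
      proof (rule ccontr)
        assume "F c \<inter> F d \<noteq> {}"
        then obtain w where "[dot m w = c] (mod int q)" "[dot m w = d] (mod int q)" by (auto simp: F_def)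
        then have "[c = d] (mod int q)" using cong_trans cong_sym by blast
        then show False using cd by (simp add: Cong.cong_def)
      qed
    qed
  qed (use finU in \<open>auto simp: F_def\<close>)
  also have "\<dots> = q * card N" by (simp add: eq)
  finally show ?thesis by (simp add: N_def)
qed

text \<open>A subspace \<open>M\<close> that is maximal among those containing \<open>W\<close> but not \<open>v\<close> is a complement of the line through \<open>v\<close>. So for every
\<open>x\<close> there is a coordinate \<open>c x\<close>, unique modulo \<open>q\<close>, with \<open>x - c x * v\<close> in \<open>M\<close>. This coordinate is linear in \<open>x\<close> and thus
given by the vector of its values at the unit vectors.\<close>

lemma separating_functional:
  assumes W: "subsp W" and v: "v \<in> vecs" "v \<notin> W"
  shows "\<exists>m. (\<forall>w\<in>W. int q dvd dot m w) \<and> \<not> int q dvd dot m v"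
proof -
  define \<C> where "\<C> = {M. subsp M \<and> W \<subseteq> M \<and> v \<notin> M}"
  have "finite \<C>" by (rule finite_subset[of _ "Pow vecs"]) (auto simp: \<C>_def subsp_def finite_vecs)
  moreover have "W \<in> \<C>" using W v by (simp add: \<C>_def)
  ultimately obtain M where M: "M \<in> \<C>" "\<And>M'. M' \<in> \<C> \<Longrightarrow> M \<subseteq> M' \<Longrightarrow> M' = M"
    using finite_has_maximal2[of \<C> W] by metis
  have sM: "subsp M" "W \<subseteq> M" "v \<notin> M" using M(1) by (auto simp: \<C>_def)
  have MV: "M \<subseteq> vecs" using sM(1) by (simp add: subsp_def)
  have add: "vadd a b \<in> M" if "a \<in> M" "b \<in> M" for a b using that sM(1) by (simp add: subsp_def)
  have sc: "vscale c a \<in> M" if "a \<in> M" for a c using that sM(1) by (simp add: subsp_def)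
  have ex: "\<exists>c. vadd x (vscale (- c) v) \<in> M" if x: "x \<in> vecs" for x
  proof (cases "x \<in> M")
    case True
    have "vadd x (vscale (- 0) v) = x" using x
      by (intro vecs_ext vadd_vecs) (auto intro!: cong_trans[OF vadd_cong] simp: vscale_def)
    then show ?thesis using True by metis
  next
    case False
    \<comment> \<open>The span of \<open>M\<close> and \<open>x\<close>, which contains \<open>v\<close> by maximality of \<open>M\<close>.\<close>
    define M' where "M' = {u \<in> vecs. \<exists>a\<in>M. \<exists>c. u = vadd a (vscale c x)}"
    have "subsp M'" unfolding subsp_def
    proof (intro conjI ballI allI)
      show "M' \<subseteq> vecs" by (auto simp: M'_def)
      have "vzero = vadd vzero (vscale 0 x)"
        by (intro vecs_ext vzero_vecs vadd_vecs) (auto intro!: cong_sym[OF cong_trans[OF vadd_cong]] simp: vscale_def vzero_def)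
      then show "vzero \<in> M'" unfolding M'_def using sM(1) vzero_vecs by (auto simp: subsp_def)
      fix u w assume "u \<in> M'" "w \<in> M'"
      then obtain a b c e where u: "u = vadd a (vscale c x)" "a \<in> M" and w: "w = vadd b (vscale e x)" "b \<in> M"
        by (auto simp: M'_def)
      have "vadd u w = vadd (vadd a b) (vscale (c + e) x)"
      proof (intro vecs_ext vadd_vecs)
        fix i assume i: "i < n"
        have "[vadd u w i = (a i + c * x i) + (b i + e * x i)] (mod int q)"
          unfolding u w by (intro cong_trans[OF vadd_cong[OF i]] cong_add cong_refl vscale_cong i)
        also have "(a i + c * x i) + (b i + e * x i) = (a i + b i) + (c + e) * x i" by (simp add: algebra_simps)
        also have "[\<dots> = vadd (vadd a b) (vscale (c + e) x) i] (mod int q)"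
          by (rule cong_sym, intro cong_trans[OF vadd_cong[OF i]] cong_add vadd_cong vscale_cong i)
        finally show "[vadd u w i = vadd (vadd a b) (vscale (c + e) x) i] (mod int q)" .
      qed
      then show "vadd u w \<in> M'" unfolding M'_def using add[OF u(2) w(2)] vadd_vecs by blast
    next
      fix c u assume "u \<in> M'"
      then obtain a e where u: "u = vadd a (vscale e x)" "a \<in> M" by (auto simp: M'_def)
      have "vscale c u = vadd (vscale c a) (vscale (c * e) x)"
      proof (intro vecs_ext vadd_vecs vscale_vecs)
        fix i assume i: "i < n"
        have "[vscale c u i = c * (a i + e * x i)] (mod int q)"
          unfolding u by (intro cong_trans[OF vscale_cong[OF i]] cong_mult cong_refl cong_trans[OF vadd_cong[OF i]] cong_add vscale_cong i)
        also have "c * (a i + e * x i) = c * a i + (c * e) * x i" by (simp add: algebra_simps)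
        also have "[\<dots> = vadd (vscale c a) (vscale (c * e) x) i] (mod int q)"
          by (rule cong_sym, intro cong_trans[OF vadd_cong[OF i]] cong_add vscale_cong i)
        finally show "[vscale c u i = vadd (vscale c a) (vscale (c * e) x) i] (mod int q)" .
      qed
      then show "vscale c u \<in> M'" unfolding M'_def using sc[OF u(2)] vscale_vecs by blast
    qed
    moreover have "M \<subseteq> M'"
    proof
      fix a assume a: "a \<in> M"
      have "a = vadd a (vscale 0 x)" using a MV
        by (intro vecs_ext vadd_vecs) (auto intro!: cong_sym[OF cong_trans[OF vadd_cong]] simp: vscale_def)
      then show "a \<in> M'" using a MV unfolding M'_def by blast
    qed
    moreover have "x \<in> M'"
    proof -
      have "x = vadd vzero (vscale 1 x)"
      proof (intro vecs_ext vadd_vecs x)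
        fix i assume i: "i < n"
        have "[vadd vzero (vscale 1 x) i = vzero i + 1 * x i] (mod int q)"
          by (intro cong_trans[OF vadd_cong[OF i]] cong_add cong_refl vscale_cong i)
        then show "[x i = vadd vzero (vscale 1 x) i] (mod int q)" using i by (simp add: vzero_def cong_sym_eq)
      qed
      moreover have "vzero \<in> M" using sM(1) by (simp add: subsp_def)
      ultimately show ?thesis using x unfolding M'_def by blast
    qed
    ultimately have "v \<in> M'" using M(2)[of M'] False sM(2) by (auto simp: \<C>_def)
    then obtain a c where ac: "v = vadd a (vscale c x)" "a \<in> M" by (auto simp: M'_def)
    have "\<not> int q dvd c"
    proof
      assume qc: "int q dvd c"
      have "v = a"
      proof (rule vecs_ext[OF v(1)])
        show "a \<in> vecs" using ac MV by blast
        fix i assume i: "i < n"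
        have "[vadd a (vscale c x) i = a i + c * x i] (mod int q)"
          by (intro cong_trans[OF vadd_cong[OF i]] cong_add cong_refl vscale_cong i)
        moreover have "[a i + c * x i = a i] (mod int q)" using qc by (simp add: cong_iff_dvd_diff)
        ultimately show "[v i = a i] (mod int q)" unfolding ac(1) by (rule cong_trans)
      qed
      then show False using ac sM by simp
    qed
    then obtain b k where b: "b * c = 1 + int q * k" using prime_unit_mod[OF q] by blast
    have "vadd x (vscale (- b) v) = vscale (- b) a"
    proof (intro vecs_ext vadd_vecs vscale_vecs)
      fix i assume i: "i < n"
      have "[vadd x (vscale (- b) v) i = x i + (- b) * (a i + c * x i)] (mod int q)"
        unfolding ac(1) by (intro cong_trans[OF vadd_cong[OF i]] cong_add cong_refl cong_trans[OF vscale_cong[OF i]] cong_mult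
            cong_trans[OF vadd_cong[OF i]] vscale_cong i)
      also have "x i + (- b) * (a i + c * x i) = (- b) * a i - (b * c - 1) * x i" by (simp add: algebra_simps)
      also have "\<dots> = (- b) * a i + int q * (- k * x i)" by (simp add: b)
      also have "[\<dots> = (- b) * a i] (mod int q)" by (simp add: cong_iff_dvd_diff)
      also have "[(- b) * a i = vscale (- b) a i] (mod int q)" by (rule cong_sym[OF vscale_cong[OF i]])
      finally show "[vadd x (vscale (- b) v) i = vscale (- b) a i] (mod int q)" .
    qed
    then show ?thesis using sc[OF ac(2)] by metis
  qed
  then obtain c where c: "\<And>x. x \<in> vecs \<Longrightarrow> vadd x (vscale (- c x) v) \<in> M" by metis
  have uniq: "[e = e'] (mod int q)" if x: "vadd x (vscale (- e) v) \<in> M" "vadd x (vscale (- e') v) \<in> M" for x e e'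
  proof (rule ccontr)
    assume "\<not> [e = e'] (mod int q)"
    then have "\<not> int q dvd e' - e" by (simp add: cong_iff_dvd_diff dvd_diff_commute)
    then obtain b k where b: "b * (e' - e) = 1 + int q * k" using prime_unit_mod[OF q] by blast
    let ?m = "vscale b (vadd (vadd x (vscale (- e) v)) (vscale (- 1) (vadd x (vscale (- e') v))))"
    have "?m \<in> M" by (intro sc add x)
    moreover have "?m = v"
    proof (intro vecs_ext vscale_vecs v)
      fix i assume i: "i < n"
      have "[?m i = b * ((x i + (- e) * v i) + (- 1) * (x i + (- e') * v i))] (mod int q)"
        by (intro cong_trans[OF vscale_cong[OF i]] cong_mult cong_refl cong_trans[OF vadd_cong[OF i]] cong_add vscale_cong i)
      also have "b * ((x i + (- e) * v i) + (- 1) * (x i + (- e') * v i)) = (b * (e' - e)) * v i" by (simp add: algebra_simps)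
      also have "[\<dots> = v i] (mod int q)" unfolding b by (simp add: cong_iff_dvd_diff algebra_simps)
      finally show "[?m i = v i] (mod int q)" .
    qed
    ultimately show False using sM by simp
  qed
  define E where "E i = (\<lambda>j\<in>{..<n}. if j = i then 1 else 0 :: int)" for i
  have EV: "E i \<in> vecs" for i using prime_gt_1_nat[OF q] by (auto simp: E_def vecs_def)
  define m where "m i = c (E i)" for i
  \<comment> \<open>Linearity of the coordinate, by induction on the number of leading positions at which \<open>x\<close> may be nonzero.\<close>
  have lin: "\<forall>x. x \<in> vecs \<longrightarrow> (\<forall>i. i < n \<longrightarrow> i \<ge> k \<longrightarrow> x i = 0) \<longrightarrow>
      vadd x (vscale (- (\<Sum>i<k. m i * x i)) v) \<in> M" if "k \<le> n" for k
    using that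
  proof (induction k)
    case 0
    show ?case
    proof (intro allI impI)
      fix x assume x: "x \<in> vecs" "\<forall>i. i < n \<longrightarrow> i \<ge> 0 \<longrightarrow> x i = 0"
      have "vadd x (vscale (- (\<Sum>i<0. m i * x i)) v) = vzero"
        using x(2) by (intro vecs_ext vadd_vecs vzero_vecs) (auto intro!: cong_trans[OF vadd_cong] simp: vscale_def vzero_def)
      then show "vadd x (vscale (- (\<Sum>i<0. m i * x i)) v) \<in> M" using sM(1) by (simp add: subsp_def)
    qed
  next
    case (Suc k)
    show ?case
    proof (intro allI impI)
    fix x assume x: "x \<in> vecs" and x0: "\<forall>i. i < n \<longrightarrow> i \<ge> Suc k \<longrightarrow> x i = 0"
    have kn: "k < n" using Suc.prems by simp
    define y where "y = (\<lambda>i\<in>{..<n}. if i = k then 0 else x i)"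
    have xi: "x i \<in> {0..<int q}" if "i \<in> {..<n}" for i by (rule PiE_mem[OF x[unfolded vecs_def] that])
    have yi: "(if i = k then 0 else x i) \<in> {0..<int q}" if "i \<in> {..<n}" for i using xi[OF that] q0 by simp
    have yV: "y \<in> vecs" unfolding y_def vecs_def by (rule restrict_PiE_iff[THEN iffD2]) (use yi in blast)
    have y0: "\<forall>i. i < n \<longrightarrow> i \<ge> k \<longrightarrow> y i = 0" using x0 by (simp add: y_def)
    have 1: "vadd y (vscale (- (\<Sum>i<k. m i * y i)) v) \<in> M" using Suc.IH kn yV y0 by simp
    have s: "(\<Sum>i<k. m i * y i) = (\<Sum>i<k. m i * x i)" using kn by (intro sum.cong) (simp_all add: y_def)
    have 2: "vscale (x k) (vadd (E k) (vscale (- m k) v)) \<in> M" unfolding m_def by (intro sc c EV)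
    have "vadd x (vscale (- (\<Sum>i<Suc k. m i * x i)) v)
        = vadd (vadd y (vscale (- (\<Sum>i<k. m i * y i)) v)) (vscale (x k) (vadd (E k) (vscale (- m k) v)))"
    proof (intro vecs_ext vadd_vecs)
      fix i assume i: "i < n"
      let ?s = "\<Sum>i<k. m i * x i"
      have "[vadd x (vscale (- (\<Sum>i<Suc k. m i * x i)) v) i = x i + (- (\<Sum>i<Suc k. m i * x i)) * v i] (mod int q)"
        by (intro cong_trans[OF vadd_cong[OF i]] cong_add cong_refl vscale_cong i)
      also have "x i + (- (\<Sum>i<Suc k. m i * x i)) * v i = (y i + (- ?s) * v i) + x k * (E k i + (- m k) * v i)"
        using i by (cases "i = k") (simp_all add: y_def E_def algebra_simps)
      also have "[\<dots> = vadd (vadd y (vscale (- ?s) v)) (vscale (x k) (vadd (E k) (vscale (- m k) v))) i] (mod int q)"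
        by (rule cong_sym, intro cong_trans[OF vadd_cong[OF i]] cong_add cong_refl cong_trans[OF vscale_cong[OF i]] cong_mult vadd_cong vscale_cong i)
      finally show "[vadd x (vscale (- (\<Sum>i<Suc k. m i * x i)) v) i
        = vadd (vadd y (vscale (- (\<Sum>i<k. m i * y i)) v)) (vscale (x k) (vadd (E k) (vscale (- m k) v))) i] (mod int q)"
        unfolding s .
    qed
    then show "vadd x (vscale (- (\<Sum>i<Suc k. m i * x i)) v) \<in> M" using add[OF 1 2] by simp
    qed
  qed
  have dm: "vadd x (vscale (- dot m x) v) \<in> M" if "x \<in> vecs" for x
    using lin[OF order_refl] that by (simp add: dot_def)
  have "int q dvd dot m w" if w: "w \<in> W" for w
  proof -
    have wM: "w \<in> M" "w \<in> vecs" using w sM MV by auto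
    have "vadd w (vscale (- 0) v) = w" using wM
      by (intro vecs_ext vadd_vecs) (auto intro!: cong_trans[OF vadd_cong] simp: vscale_def)
    then have "[dot m w = 0] (mod int q)" using uniq[OF dm[OF wM(2)], of 0] wM(1) by simp
    then show ?thesis by (simp add: cong_0_iff)
  qed
  moreover have "\<not> int q dvd dot m v"
  proof
    assume "int q dvd dot m v"
    have "vadd v (vscale (- 1) v) = vzero"
    proof (intro vecs_ext vadd_vecs vzero_vecs)
      fix i assume i: "i < n"
      have "[vadd v (vscale (- 1) v) i = v i + (- 1) * v i] (mod int q)"
        by (intro cong_trans[OF vadd_cong[OF i]] cong_add cong_refl vscale_cong i)
      then show "[vadd v (vscale (- 1) v) i = vzero i] (mod int q)" using i by (simp add: vzero_def)
    qed
    then have "vadd v (vscale (- 1) v) \<in> M" using sM(1) by (simp add: subsp_def)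
    from uniq[OF dm[OF v(1)] this] have "int q dvd 1" using \<open>int q dvd dot m v\<close> by (simp add: cong_dvd_iff)
    then show False using prime_gt_1_nat[OF q] by simp
  qed
  ultimately show ?thesis by blast
qed

text \<open>Starting from all vectors, a functional that vanishes on \<open>W\<close> but not on the current intersection
lowers the dimension by one, until the size of \<open>W\<close> is reached.\<close>

lemma subspace_as_kernels:
  assumes W: "subsp W" "card W = q ^ (n - k)" and k: "k \<le> n"
  shows "\<exists>m. W = {v \<in> vecs. \<forall>j<k. int q dvd dot (m j) v} \<and> (\<forall>j<k. \<exists>v\<in>vecs. \<not> int q dvd dot (m j) v)"
proof -
  have "\<exists>m. W \<subseteq> {v \<in> vecs. \<forall>i<j. int q dvd dot (m i) v} \<and> card {v \<in> vecs. \<forall>i<j. int q dvd dot (m i) v} = q ^ (n - j)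
     \<and> subsp {v \<in> vecs. \<forall>i<j. int q dvd dot (m i) v} \<and> (\<forall>i<j. \<exists>v\<in>vecs. \<not> int q dvd dot (m i) v)" if "j \<le> k" for j
    using that
  proof (induction j)
    case 0
    have "W \<subseteq> vecs" using W by (simp add: subsp_def)
    then show ?case by (simp add: card_vecs subsp_vecs)
  next
    case (Suc j)
    then obtain m where m: "W \<subseteq> {v \<in> vecs. \<forall>i<j. int q dvd dot (m i) v}" "card {v \<in> vecs. \<forall>i<j. int q dvd dot (m i) v} = q ^ (n - j)"
     "subsp {v \<in> vecs. \<forall>i<j. int q dvd dot (m i) v}" "\<forall>i<j. \<exists>v\<in>vecs. \<not> int q dvd dot (m i) v" by auto
    let ?U = "{v \<in> vecs. \<forall>i<j. int q dvd dot (m i) v}"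
    have "q ^ (n - k) < q ^ (n - j)" using Suc.prems k prime_gt_1_nat[OF q] by (intro power_strict_increasing) auto
    then have "W \<noteq> ?U" using m(2) W(2) by auto
    then obtain v where v: "v \<in> ?U" "v \<notin> W" using m(1) by blast
    then have "v \<in> vecs" by simp
    from separating_functional[OF W(1) this v(2)] obtain l where
      l: "\<forall>w\<in>W. int q dvd dot l w" "\<not> int q dvd dot l v" by blast
    define m' where "m' = m(j := l)"
    have eq: "{v \<in> vecs. \<forall>i<Suc j. int q dvd dot (m' i) v} = {w \<in> ?U. int q dvd dot l w}"
      by (auto simp: m'_def less_Suc_eq)
    have "q * card {w \<in> ?U. int q dvd dot l w} = q ^ (n - j)" using card_kernel[OF m(3) v(1) l(2)] m(2) by simp
    also have "n - j = Suc (n - Suc j)" using Suc.prems k by simp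
    finally have "card {w \<in> ?U. int q dvd dot l w} = q ^ (n - Suc j)" using q0 by simp
    moreover have "subsp {w \<in> ?U. int q dvd dot l w}" by (rule subsp_kernel[OF m(3)])
    moreover have "W \<subseteq> {w \<in> ?U. int q dvd dot l w}" using m(1) l(1) by auto
    moreover have "\<forall>i<Suc j. \<exists>v\<in>vecs. \<not> int q dvd dot (m' i) v"
      using m(4) l(2) \<open>v \<in> vecs\<close> by (auto simp: m'_def less_Suc_eq)
    ultimately show ?case using eq by (intro exI[of _ m']) simp
  qed
  from this[OF order_refl] obtain m where m: "W \<subseteq> {v \<in> vecs. \<forall>i<k. int q dvd dot (m i) v}"
    "card {v \<in> vecs. \<forall>i<k. int q dvd dot (m i) v} = q ^ (n - k)" "\<forall>i<k. \<exists>v\<in>vecs. \<not> int q dvd dot (m i) v" by blast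
  have "finite {v \<in> vecs. \<forall>i<k. int q dvd dot (m i) v}" using finite_vecs by simp
  then have "W = {v \<in> vecs. \<forall>i<k. int q dvd dot (m i) v}" using m(1,2) W(2) by (intro card_subset_eq) auto
  then show ?thesis using m(3) by blast
qed

text \<open>Each further functional lowers the dimension by one or not at all. In the second case the subspace is cut down by
an arbitrary functional that does not vanish on it, so that the codimension is exactly \<open>k\<close>.\<close>

lemma kernels_contain_subspace:
  assumes k: "k \<le> n"
  shows "\<exists>W. subsp W \<and> card W = q ^ (n - k) \<and> (\<forall>j<k. \<forall>w\<in>W. int q dvd dot (m j) w)"
  using k
proof (induction k)
  case 0
  then show ?case using subsp_vecs card_vecs by auto
next
  case (Suc k)
  then obtain W where W: "subsp W" "card W = q ^ (n - k)" "\<forall>j<k. \<forall>w\<in>W. int q dvd dot (m j) w" by auto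
  have "\<exists>l. (\<exists>u\<in>W. \<not> int q dvd dot l u) \<and> (\<forall>w\<in>W. int q dvd dot l w \<longrightarrow> int q dvd dot (m k) w)"
  proof (cases "\<exists>u\<in>W. \<not> int q dvd dot (m k) u")
    case True
    then show ?thesis by blast
  next
    case False
    have "q ^ (n - k) > 1" using Suc.prems prime_gt_1_nat[OF q] by (intro one_less_power) auto
    then have "W \<noteq> {vzero}" using W(2) by auto
    then obtain w where w: "w \<in> W" "w \<noteq> vzero" using W(1) by (auto simp: subsp_def)
    have "subsp {vzero}"
    proof -
      have "vadd vzero vzero = vzero" "vscale c vzero = vzero" for c
        by (auto simp: vadd_def vscale_def vzero_def fun_eq_iff)
      then show ?thesis by (simp add: subsp_def vzero_vecs)
    qed
    moreover have "w \<in> vecs" using w W(1) by (auto simp: subsp_def)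
    ultimately obtain l where "\<not> int q dvd dot l w" using separating_functional[of "{vzero}" w] w by auto
    then show ?thesis using w False by blast
  qed
  then obtain l u where l: "u \<in> W" "\<not> int q dvd dot l u" "\<forall>w\<in>W. int q dvd dot l w \<longrightarrow> int q dvd dot (m k) w" by blast
  let ?W = "{w \<in> W. int q dvd dot l w}"
  have "q * card ?W = q ^ (n - k)" using card_kernel[OF W(1) l(1,2)] W(2) by simp
  also have "n - k = Suc (n - Suc k)" using Suc.prems by simp
  finally have "card ?W = q ^ (n - Suc k)" using q0 by simp
  moreover have "subsp ?W" by (rule subsp_kernel[OF W(1)])
  moreover have "\<forall>j<Suc k. \<forall>w\<in>?W. int q dvd dot (m j) w" using W(3) l(3) by (auto simp: less_Suc_eq)
  ultimately show ?case by blast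
qed

end

section \<open>Primes with a prescribed residue functional\<close>

locale prime_basis = prime_vectors +
  fixes ps :: "nat \<Rightarrow> nat"
  assumes ps: "\<And>i. i < n \<Longrightarrow> prime (ps i)" and inj: "inj_on ps {..<n}" and odd: "odd q"
begin

definition basis_prod :: "(nat \<Rightarrow> int) \<Rightarrow> nat" where
  "basis_prod v = (\<Prod>i<n. ps i ^ nat (v i))"

lemma basis_prod_pos: "basis_prod v > 0"
  unfolding basis_prod_def by (intro prod_pos) (auto intro: prime_gt_0_nat ps)

lemma basis_prod_multiplicity: "i < n \<Longrightarrow> multiplicity (ps i) (basis_prod v) = nat (v i)"
proof -
  assume i: "i < n"
  have "basis_prod v = (\<Prod>p\<in>ps ` {..<n}. p ^ nat (v (inv_into {..<n} ps p)))"
    unfolding basis_prod_def by (subst prod.reindex[OF inj]) (simp add: inv_into_f_f[OF inj])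
  also have "multiplicity (ps i) \<dots> = nat (v (inv_into {..<n} ps (ps i)))"
    by (subst multiplicity_prod_prime_powers) (use i ps in auto)
  finally show ?thesis using i by (simp add: inv_into_f_f[OF inj])
qed

lemma basis_prod_not_power: assumes v: "v \<in> vecs" "v \<noteq> vzero" shows "\<nexists>c. basis_prod v = c ^ q"
proof
  assume "\<exists>c. basis_prod v = c ^ q"
  then obtain c where c: "basis_prod v = c ^ q" by blast
  have c0: "c \<noteq> 0" using basis_prod_pos[of v] c q0 by (auto simp: power_0_left)
  have "v i = 0" if i: "i < n" for i
  proof -
    have e: "nat (v i) = q * multiplicity (ps i) c"
      using basis_prod_multiplicity[OF i, of v] c0 ps[OF i] by (simp add: c prime_elem_multiplicity_power_distrib)
    have vi: "0 \<le> v i" "v i < int q" using v(1) i by (auto simp: vecs_def PiE_iff)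
    then have "nat (v i) < q" by linarith
    then have "multiplicity (ps i) c = 0" unfolding e by (cases "multiplicity (ps i) c") simp_all
    then show ?thesis using e vi(1) by simp
  qed
  then have "v = vzero" using v(1) by (intro vecs_ext vzero_vecs) (auto simp: vzero_def)
  then show False using v(2) by simp
qed

text \<open>With respect to a primitive root modulo \<open>P\<close>, the exponent of \<open>basis_prod v\<close> is the scalar product of \<open>v\<close> with
the exponents of the \<open>ps i\<close>. If \<open>q\<close> does not divide \<open>P - 1\<close>, everything is a \<open>q\<close>-th power, and the zero functional serves.\<close>

lemma residue_functional:
  assumes P: "prime P" "\<And>i. i < n \<Longrightarrow> P \<noteq> ps i"
  shows "\<exists>l. \<forall>v. (\<forall>i<n. v i \<ge> 0) \<longrightarrow> (power_residue q P (int (basis_prod v)) \<longleftrightarrow> int q dvd dot l v)"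
proof -
  have nd: "\<not> P dvd ps i" if "i < n" for i using primes_dvd_imp_eq[OF P(1) ps[OF that]] P(2)[OF that] by blast
  have ndv: "\<not> P dvd basis_prod v" for v
  proof
    assume "P dvd basis_prod v"
    then obtain i where "i < n" "P dvd ps i ^ nat (v i)"
      unfolding basis_prod_def using prime_dvd_prod_iff[of "{..<n}" P] P(1) by auto
    then show False using nd[of i] P(1) prime_dvd_power by blast
  qed
  show ?thesis
  proof (cases "q dvd P - 1")
    case True
    obtain g where g: "\<And>i j. [g ^ i = g ^ j] (mod P) \<longleftrightarrow> [i = j] (mod P - 1)"
      "\<And>a. \<not> P dvd a \<Longrightarrow> \<exists>e. [g ^ e = a] (mod P)"
      using index_exists[OF P(1)] by blast
    have "\<forall>i\<in>{..<n}. \<exists>e. [g ^ e = ps i] (mod P)" using g(2) nd by blast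
    then obtain e where e: "\<forall>i\<in>{..<n}. [g ^ e i = ps i] (mod P)" using bchoice by metis
    have "power_residue q P (int (basis_prod v)) \<longleftrightarrow> int q dvd dot (\<lambda>i. int (e i)) v" if v: "\<forall>i<n. v i \<ge> 0" for v
    proof -
      have "[(\<Prod>i<n. (g ^ e i) ^ nat (v i)) = basis_prod v] (mod P)"
        unfolding basis_prod_def by (intro cong_prod cong_pow) (use e in auto)
      also have "(\<Prod>i<n. (g ^ e i) ^ nat (v i)) = g ^ (\<Sum>i<n. e i * nat (v i))"
        by (simp add: power_sum power_mult)
      finally have ge: "[g ^ (\<Sum>i<n. e i * nat (v i)) = basis_prod v] (mod P)" .
      have "power_residue q P (int (basis_prod v)) \<longleftrightarrow> q dvd (\<Sum>i<n. e i * nat (v i))"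
        by (rule power_residue_index[OF P(1) q0 True _ _ ge ndv]) (rule g(2), assumption, rule g(1))
      also have "\<dots> \<longleftrightarrow> int q dvd int (\<Sum>i<n. e i * nat (v i))" by (rule int_dvd_int_iff[symmetric])
      also have "int (\<Sum>i<n. e i * nat (v i)) = dot (\<lambda>i. int (e i)) v"
        using v by (auto simp: dot_def intro!: sum.cong)
      finally show ?thesis .
    qed
    then show ?thesis by blast
  next
    case False
    have "power_residue q P (int (basis_prod v)) \<longleftrightarrow> int q dvd dot (\<lambda>_. 0) v" for v
      using power_residue_all[OF P(1) q False ndv] by (simp add: dot_def)
    then show ?thesis by blast
  qed
qed

text \<open>Let \<open>H\<close> be the kernel of \<open>dot m\<close> and \<open>Zs P\<close> the set of vectors \<open>v\<close> for which \<open>basis_prod v\<close> is a \<open>q\<close>-th power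
modulo \<open>P\<close>, a hyperplane or the whole space. If \<open>Zs P \<noteq> H\<close>, then \<open>Zs P\<close> is not contained in \<open>H\<close>, so exactly the proportion \<open>1/q\<close> of
\<open>Zs P\<close> lies in \<open>H\<close>. If that were so for all large \<open>P\<close>, the weighted sums \<open>R v\<close> would satisfy
\<open>q * (\<Sum>v\<in>H. R v) = (\<Sum>v. R v)\<close> up to a bounded error. But \<open>R v\<close> is \<open>1/q\<close> times \<open>S = split_sum q Z\<close> up to a
bounded error for \<open>v \<noteq> 0\<close>, and equal to \<open>S\<close> for \<open>v = 0\<close>. As \<open>card vecs = q * card H\<close>, the two sides differ by
\<open>(q - 1)\<^sup>2 / q * S\<close>, which is unbounded.\<close>

theorem prime_with_prescribed_kernel:
  assumes m: "\<exists>v\<in>vecs. \<not> int q dvd dot m v"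
  shows "\<exists>P>N0. prime P \<and> (\<forall>v\<in>vecs. power_residue q P (int (basis_prod v)) \<longleftrightarrow> int q dvd dot m v)"
proof (rule ccontr)
  assume neg: "\<not> ?thesis"
  \<comment> \<open>Beyond \<open>N1\<close> there is in particular none of the primes \<open>ps i\<close>.\<close>
  define N1 where "N1 = max N0 (\<Sum>i<n. ps i)"
  define H where "H = {v \<in> vecs. int q dvd dot m v}"
  define Zs where "Zs P = {v \<in> vecs. power_residue q P (int (basis_prod v))}" for P
  have sH: "subsp H" unfolding H_def by (rule subsp_kernel[OF subsp_vecs])
  have finH: "finite H" using finite_vecs by (simp add: H_def)
  obtain v0 where v0: "v0 \<in> vecs" "\<not> int q dvd dot m v0" using m by blast
  have cH: "q ^ n = q * card H" using card_kernel[OF subsp_vecs v0] card_vecs by (simp add: H_def)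
  have zero: "real q * real (card (H \<inter> Zs P)) - real (card (Zs P)) = 0" if P: "prime P" "P > N1" for P
  proof -
    have "P \<noteq> ps i" if "i < n" for i
      using member_le_sum[of i "{..<n}" ps] that P(2) by (auto simp: N1_def)
    then obtain l where l: "\<And>v. (\<forall>i<n. v i \<ge> 0) \<Longrightarrow> power_residue q P (int (basis_prod v)) \<longleftrightarrow> int q dvd dot l v"
      using residue_functional[OF P(1)] by blast
    have Zl: "Zs P = {v \<in> vecs. int q dvd dot l v}"
      unfolding Zs_def using l by (auto simp: vecs_def PiE_iff)
    have sZ: "subsp (Zs P)" unfolding Zl by (rule subsp_kernel[OF subsp_vecs])
    have HZ: "H \<inter> Zs P = {u \<in> Zs P. int q dvd dot m u}" by (auto simp: H_def Zs_def)
    show ?thesis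
    proof (cases "\<exists>u\<in>Zs P. \<not> int q dvd dot m u")
      case True
      then obtain u where "u \<in> Zs P" "\<not> int q dvd dot m u" by blast
      from card_kernel[OF sZ this] show ?thesis unfolding HZ by simp
    next
      case False
      then have sub: "Zs P \<subseteq> H" by (auto simp: H_def Zs_def)
      then obtain u where u: "u \<in> vecs" "\<not> int q dvd dot l u" using v0 by (auto simp: Zl H_def)
      have "card vecs = q * card (Zs P)" unfolding Zl by (rule card_kernel[OF subsp_vecs u])
      then have "q * card H = q * card (Zs P)" by (simp only: card_vecs cH)
      then have "Zs P = H" using sub finH q0 by (intro card_subset_eq) auto
      then have "\<forall>v\<in>vecs. power_residue q P (int (basis_prod v)) \<longleftrightarrow> int q dvd dot m v"
        by (auto simp: Zs_def H_def)
      then show ?thesis using neg P by (auto simp: N1_def)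
    qed
  qed
  define R where "R v Z = residue_sum q (basis_prod v) Z" for v Z
  define w where "w P = (if q dvd P - 1 then real q * real (card (H \<inter> Zs P)) - real (card (Zs P)) else 0) / real P" for P
  have identity: "(\<Sum>P | prime P \<and> P \<le> Z. w P) = real q * (\<Sum>v\<in>H. R v Z) - (\<Sum>v\<in>vecs. R v Z)" for Z
  proof -
    have 1: "(\<Sum>v\<in>A. R v Z) = (\<Sum>P | prime P \<and> P \<le> Z. if q dvd P - 1 then real (card (A \<inter> Zs P)) / real P else 0)"
      if A: "A \<subseteq> vecs" for A
    proof -
      have finA: "finite A" using finite_subset[OF A finite_vecs] .
      have "(\<Sum>v\<in>A. R v Z) = (\<Sum>P | prime P \<and> P \<le> Z. \<Sum>v\<in>A. if q dvd P - 1 \<and> power_residue q P (int (basis_prod v)) then 1 / real P else 0)"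
        unfolding R_def residue_sum_def by (rule sum.swap)
      also have "\<dots> = (\<Sum>P | prime P \<and> P \<le> Z. if q dvd P - 1 then real (card (A \<inter> Zs P)) / real P else 0)"
      proof (rule sum.cong[OF refl])
        fix P
        have "A \<inter> Zs P = {v \<in> A. power_residue q P (int (basis_prod v))}" using A by (auto simp: Zs_def)
        then have "(\<Sum>v\<in>A. if power_residue q P (int (basis_prod v)) then 1 / real P else 0) = (\<Sum>v\<in>A \<inter> Zs P. 1 / real P)"
          using sum.inter_filter[OF finA, of "\<lambda>_. 1 / real P" "\<lambda>v. power_residue q P (int (basis_prod v))"] by simp
        then show "(\<Sum>v\<in>A. if q dvd P - 1 \<and> power_residue q P (int (basis_prod v)) then 1 / real P else 0)
          = (if q dvd P - 1 then real (card (A \<inter> Zs P)) / real P else 0)" by simp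
      qed
      finally show ?thesis .
    qed
    have 2: "H \<subseteq> vecs" by (auto simp: H_def)
    have 3: "vecs \<inter> Zs P = Zs P" for P by (auto simp: Zs_def)
    show ?thesis unfolding 1[OF 2] 1[OF order_refl] 3 sum_distrib_left sum_subtractf[symmetric] w_def
      by (intro sum.cong) (auto simp: diff_divide_distrib)
  qed
  have "w P \<le> 0" if "prime P" "P > N1" for P by (simp add: w_def zero[OF that])
  from prime_sum_compare[of N1 w "\<lambda>_. 0", OF this] obtain D where D: "\<And>Z. (\<Sum>P | prime P \<and> P \<le> (Z::nat). w P) \<le> (\<Sum>P | prime P \<and> P \<le> Z. 0) + D"
    by blast
  have "\<forall>v\<in>vecs. \<exists>C. v \<noteq> vzero \<longrightarrow> (\<forall>Z\<ge>3. \<bar>real q * R v Z - split_sum q Z\<bar> \<le> C)"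
    using residue_sum_asymp[OF q basis_prod_pos basis_prod_not_power] unfolding R_def by blast
  then obtain C where C: "\<forall>v\<in>vecs. v \<noteq> vzero \<longrightarrow> (\<forall>Z\<ge>3. \<bar>real q * R v Z - split_sum q Z\<bar> \<le> C v)"
    using bchoice by metis
  have R0: "R vzero Z = split_sum q Z" for Z
  proof -
    have "basis_prod vzero = 1" by (simp add: basis_prod_def vzero_def)
    moreover have "power_residue q P (int 1)" for P
      unfolding power_residue_def by (rule exI[of _ 1]) simp
    ultimately show ?thesis unfolding R_def residue_sum_def split_sum_def by simp
  qed
  define CC where "CC = (\<Sum>v\<in>vecs. \<bar>C v\<bar>)"
  have vz: "vzero \<in> H" using sH by (simp add: subsp_def)
  have HV: "H \<subseteq> vecs" by (auto simp: H_def)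
  have bound: "(real q - 1)\<^sup>2 * split_sum q Z \<le> real q * D + real q * CC" if Z: "Z \<ge> 3" for Z
  proof -
    let ?S = "split_sum q Z"
    have dev: "\<bar>real q * R v Z - ?S\<bar> \<le> \<bar>C v\<bar>" if "v \<in> vecs - {vzero}" for v
    proof -
      have "\<bar>real q * R v Z - ?S\<bar> \<le> C v" using C that Z by blast
      then show ?thesis by linarith
    qed
    have q1: "real q \<ge> 1" using q0 by simp
    have h: "real (card (vecs - H)) = (real q - 1) * real (card H)"
    proof -
      have "card (vecs - H) = card vecs - card H" by (rule card_Diff_subset[OF finH HV])
      then have "card (vecs - H) + card H = q * card H" using cH card_vecs q0 by simp
      then have "real (card (vecs - H) + card H) = real (q * card H)" by (rule arg_cong)
      then show ?thesis by (simp add: algebra_simps)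
    qed
    have cH1: "real (card (H - {vzero})) = real (card H) - 1"
    proof -
      have "card H > 0" using vz finH by (auto simp: card_gt_0_iff)
      moreover have "card (H - {vzero}) = card H - 1" by (rule card_Diff_singleton[OF vz])
      ultimately show ?thesis by (simp add: of_nat_diff Suc_le_eq)
    qed
    have 1: "(\<Sum>v\<in>H - {vzero}. real q * R v Z) \<ge> (real (card H) - 1) * ?S - (\<Sum>v\<in>H - {vzero}. \<bar>C v\<bar>)"
    proof -
      have "(\<Sum>v\<in>H - {vzero}. ?S - \<bar>C v\<bar>) \<le> (\<Sum>v\<in>H - {vzero}. real q * R v Z)"
      proof (rule sum_mono)
        fix v assume "v \<in> H - {vzero}"
        then have "v \<in> vecs - {vzero}" using HV by blast
        from dev[OF this] show "?S - \<bar>C v\<bar> \<le> real q * R v Z" by linarith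
      qed
      then show ?thesis by (simp add: sum_subtractf cH1)
    qed
    have 2: "(\<Sum>v\<in>vecs - H. real q * R v Z) \<le> (real q - 1) * real (card H) * ?S + (\<Sum>v\<in>vecs - H. \<bar>C v\<bar>)"
    proof -
      have "(\<Sum>v\<in>vecs - H. real q * R v Z) \<le> (\<Sum>v\<in>vecs - H. ?S + \<bar>C v\<bar>)"
      proof (rule sum_mono)
        fix v assume "v \<in> vecs - H"
        then have "v \<in> vecs - {vzero}" using vz by blast
        from dev[OF this] show "real q * R v Z \<le> ?S + \<bar>C v\<bar>" by linarith
      qed
      then show ?thesis by (simp add: sum.distrib h)
    qed
    have 3: "(real q - 1) * (\<Sum>v\<in>H - {vzero}. \<bar>C v\<bar>) + (\<Sum>v\<in>vecs - H. \<bar>C v\<bar>) \<le> real q * CC"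
    proof -
      have a: "(\<Sum>v\<in>H - {vzero}. \<bar>C v\<bar>) \<le> CC" "(\<Sum>v\<in>vecs - H. \<bar>C v\<bar>) \<le> CC"
        unfolding CC_def using HV by (intro sum_mono2 finite_vecs; auto)+
      have "(real q - 1) * (\<Sum>v\<in>H - {vzero}. \<bar>C v\<bar>) \<le> (real q - 1) * CC" using a(1) q1 by (intro mult_left_mono) auto
      then show ?thesis using a(2) by (simp add: left_diff_distrib)
    qed
    have sH': "(\<Sum>v\<in>H. R v Z) = ?S + (\<Sum>v\<in>H - {vzero}. R v Z)"
      using sum.remove[OF finH vz, of "\<lambda>v. R v Z"] R0 by simp
    have sV: "(\<Sum>v\<in>vecs. R v Z) = (\<Sum>v\<in>H. R v Z) + (\<Sum>v\<in>vecs - H. R v Z)"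
      using sum.subset_diff[OF HV finite_vecs, of "\<lambda>v. R v Z"] by simp
    have "real q * (\<Sum>v\<in>H. R v Z) - (\<Sum>v\<in>vecs. R v Z) \<le> D"
      using D[of Z] identity[of Z] by simp
    then have "(real q - 1) * (?S + (\<Sum>v\<in>H - {vzero}. R v Z)) - (\<Sum>v\<in>vecs - H. R v Z) \<le> D"
      unfolding sV sH' by (simp add: algebra_simps)
    then have "real q * ((real q - 1) * (?S + (\<Sum>v\<in>H - {vzero}. R v Z)) - (\<Sum>v\<in>vecs - H. R v Z)) \<le> real q * D"
      using q1 by (intro mult_left_mono) auto
    then have 4: "(real q - 1) * (real q * ?S) + (real q - 1) * (\<Sum>v\<in>H - {vzero}. real q * R v Z)
       - (\<Sum>v\<in>vecs - H. real q * R v Z) \<le> real q * D"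
      by (simp add: sum_distrib_left[symmetric] algebra_simps)
    have 5: "(real q - 1) * ((real (card H) - 1) * ?S - (\<Sum>v\<in>H - {vzero}. \<bar>C v\<bar>)) \<le> (real q - 1) * (\<Sum>v\<in>H - {vzero}. real q * R v Z)"
      using 1 q1 by (intro mult_left_mono) auto
    have "(real q - 1) * (real q * ?S) + (real q - 1) * ((real (card H) - 1) * ?S) - (real q - 1) * real (card H) * ?S
      \<le> real q * D + ((real q - 1) * (\<Sum>v\<in>H - {vzero}. \<bar>C v\<bar>) + (\<Sum>v\<in>vecs - H. \<bar>C v\<bar>))"
      using 4 5 2 unfolding right_diff_distrib by linarith
    also have "(real q - 1) * (real q * ?S) + (real q - 1) * ((real (card H) - 1) * ?S) - (real q - 1) * real (card H) * ?S
      = (real q - 1)\<^sup>2 * ?S" by (simp add: algebra_simps power2_eq_square)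
    finally show ?thesis using 3 by linarith
  qed
  obtain E where E: "\<And>Z. Z \<ge> 3 \<Longrightarrow> ln (ln Z) - E \<le> real (q - 1) * split_sum q Z"
    using split_sum_unbounded[OF q odd] by blast
  have q1: "real (q - 1) = real q - 1" "real q - 1 \<ge> 0" using q0 by (simp_all add: of_nat_diff)
  have upper: "(real q - 1) * (ln (ln (real Z)) - E) \<le> real q * D + real q * CC" if "Z \<ge> 3" for Z :: nat
  proof -
    have "(real q - 1) * (ln (ln (real Z)) - E) \<le> (real q - 1) * (real (q - 1) * split_sum q Z)"
      using E[OF that] q1 by (intro mult_left_mono) auto
    also have "\<dots> = (real q - 1)\<^sup>2 * split_sum q Z" by (simp only: q1(1) power2_eq_square mult.assoc)
    also have "\<dots> \<le> real q * D + real q * CC" by (rule bound[OF that])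
    finally show ?thesis .
  qed
  have "filterlim (\<lambda>Z::nat. ln (ln (real Z))) at_top sequentially" by real_asymp
  then have "eventually (\<lambda>Z::nat. ln (ln (real Z)) \<ge> (real q * D + real q * CC) / (real q - 1) + E + 1) sequentially"
    by (simp add: filterlim_at_top)
  then have "eventually (\<lambda>Z::nat. Z \<ge> 3 \<and> ln (ln (real Z)) \<ge> (real q * D + real q * CC) / (real q - 1) + E + 1) sequentially"
    using eventually_ge_at_top[of 3] by eventually_elim simp
  then obtain Z :: nat where Z: "Z \<ge> 3" "ln (ln (real Z)) \<ge> (real q * D + real q * CC) / (real q - 1) + E + 1"
    using eventually_happens'[OF sequentially_bot] by blast
  have q2: "real q - 1 > 0" using prime_gt_1_nat[OF q] by simp
  have "(real q - 1) * ((real q * D + real q * CC) / (real q - 1) + 1) \<le> (real q - 1) * (ln (ln (real Z)) - E)"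
    using Z(2) q2 by (intro mult_left_mono) auto
  also have "\<dots> \<le> real q * D + real q * CC" by (rule upper[OF Z(1)])
  finally have le: "(real q - 1) * ((real q * D + real q * CC) / (real q - 1) + 1) \<le> real q * D + real q * CC" .
  have "t * (x / t + 1) = x + t" if "t > 0" for t x :: real using that by (simp add: field_simps)
  from this[OF q2] have "real q * D + real q * CC + (real q - 1) \<le> real q * D + real q * CC" using le by simp
  then show False using q2 by linarith
qed

end

section \<open>Subspaces and points of the projective space\<close>

lemma (in vectorspace) finite_fin_dim: "finite (carrier V) \<Longrightarrow> fin_dim"
proof -
  assume fin: "finite (carrier V)"
  have "carrier V \<subseteq> span (carrier V)" by (rule in_own_span) simp
  moreover have "span (carrier V) \<subseteq> carrier V" by (rule span_is_subset2) simp
  ultimately show ?thesis unfolding fin_dim_def using fin by blast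
qed

text \<open>Coordinates with respect to a basis.\<close>

lemma (in vectorspace) card_eq_power_dim:
  assumes fin: "finite (carrier V)"
  shows "card (carrier V) = card (carrier K) ^ dim"
proof -
  obtain \<beta> where \<beta>: "finite \<beta>" "basis \<beta>" using finite_basis_exists[OF finite_fin_dim[OF fin]] by blast
  have sub: "\<beta> \<subseteq> carrier V" using \<beta>(2) by (simp add: basis_def)
  have crit: "\<exists>!a. a \<in> \<beta> \<rightarrow>\<^sub>E carrier K \<and> lincomb a \<beta> = v" if "v \<in> carrier V" for v
    using basis_criterion[OF \<beta>(1) sub] \<beta>(2) that by blast
  have mem: "lincomb a \<beta> \<in> carrier V" if "a \<in> \<beta> \<rightarrow>\<^sub>E carrier K" for a
    using that by (intro lincomb_closed[OF sub]) auto
  have "bij_betw (\<lambda>a. lincomb a \<beta>) (\<beta> \<rightarrow>\<^sub>E carrier K) (carrier V)"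
    unfolding bij_betw_def
  proof
    show "inj_on (\<lambda>a. lincomb a \<beta>) (\<beta> \<rightarrow>\<^sub>E carrier K)"
      using crit mem by (intro inj_onI) metis
    show "(\<lambda>a. lincomb a \<beta>) ` (\<beta> \<rightarrow>\<^sub>E carrier K) = carrier V"
    proof
      show "(\<lambda>a. lincomb a \<beta>) ` (\<beta> \<rightarrow>\<^sub>E carrier K) \<subseteq> carrier V" using mem by blast
      show "carrier V \<subseteq> (\<lambda>a. lincomb a \<beta>) ` (\<beta> \<rightarrow>\<^sub>E carrier K)"
      proof
        fix v assume "v \<in> carrier V"
        then obtain a where "a \<in> \<beta> \<rightarrow>\<^sub>E carrier K" "lincomb a \<beta> = v" using crit by blast
        then show "v \<in> (\<lambda>a. lincomb a \<beta>) ` (\<beta> \<rightarrow>\<^sub>E carrier K)" by blast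
      qed
    qed
  qed
  then have "card (carrier V) = card (\<beta> \<rightarrow>\<^sub>E carrier K)" by (rule bij_betw_same_card[symmetric])
  also have "\<dots> = card (carrier K) ^ card \<beta>" using \<beta>(1) by (simp add: card_PiE)
  finally show ?thesis using dim_basis[OF \<beta>] by simp
qed

context prime_vectors
begin

abbreviation Fq where "Fq \<equiv> residue_ring (int q)"
abbreviation Fqn where "Fqn \<equiv> Fq_space q n"

lemma field_Fq: "field Fq"
proof -
  interpret residues_prime q Fq by unfold_locales (simp_all add: q)
  show ?thesis by (rule is_field)
qed

lemma ring_Fq: "ring Fq" using field_Fq by (simp add: field_def domain_def cring_def)

lemma carrier_Fq: "carrier Fq = {0..<int q}" by (auto simp: residue_ring_def)

lemma Fqn_eq: "carrier Fqn = vecs" "\<zero>\<^bsub>Fqn\<^esub> = vzero" "u \<oplus>\<^bsub>Fqn\<^esub> v = vadd u v" "c \<odot>\<^bsub>Fqn\<^esub> v = vscale c v"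
  unfolding Fq_space_def ring.func_space_def[OF ring_Fq] carrier_Fq vecs_def
  by (simp_all add: residue_ring_def vzero_def vadd_def vscale_def)

lemma vectorspace_Fqn: "vectorspace Fq Fqn"
proof -
  have "module Fq Fqn" unfolding Fq_space_def
    using field_Fq by (intro cring.func_space_is_module) (simp add: field_def domain_def)
  then show ?thesis using field_Fq by (simp add: vectorspace_def)
qed

lemma vscale_mod: "vscale (c mod int q) v = vscale c v"
  by (simp add: vscale_def mod_mult_left_eq)

lemma subspace_iff: "subspace Fq W Fqn \<longleftrightarrow> subsp W"
proof -
  have "module Fq Fqn" using vectorspace_Fqn by (simp add: vectorspace_def)
  then have "submodule Fq W Fqn \<longleftrightarrow> W \<subseteq> vecs \<and> (\<forall>v\<in>W. \<forall>w\<in>W. vadd v w \<in> W) \<and> vzero \<in> W \<and> (\<forall>c\<in>{0..<int q}. \<forall>v\<in>W. vscale c v \<in> W)"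
    unfolding submodule_def carrier_Fq by (auto simp: Fqn_eq)
  also have "\<dots> \<longleftrightarrow> subsp W"
  proof -
    have "vscale c v \<in> W" if "\<forall>c\<in>{0..<int q}. \<forall>v\<in>W. vscale c v \<in> W" "v \<in> W" for c v
    proof -
      have "c mod int q \<in> {0..<int q}" using q0 by simp
      then have "vscale (c mod int q) v \<in> W" using that by blast
      then show ?thesis by (simp only: vscale_mod)
    qed
    then show ?thesis unfolding subsp_def by blast
  qed
  finally show ?thesis using vectorspace_Fqn by (simp add: subspace_def)
qed

lemma card_subsp: assumes W: "subsp W" shows "card W = q ^ vectorspace.dim Fq (Fqn\<lparr>carrier := W\<rparr>)"
proof -
  interpret vectorspace Fq Fqn by (rule vectorspace_Fqn)
  have "vectorspace Fq (Fqn\<lparr>carrier := W\<rparr>)" using W by (intro subspace_is_vs) (simp add: subspace_iff)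
  then interpret U: vectorspace Fq "Fqn\<lparr>carrier := W\<rparr>" .
  have "card (carrier (Fqn\<lparr>carrier := W\<rparr>)) = card (carrier Fq) ^ U.dim"
    by (rule U.card_eq_power_dim) (simp add: subsp_finite[OF W])
  then show ?thesis by (simp add: carrier_Fq)
qed

lemma dim_Fqn: "vectorspace.dim Fq Fqn = n"
proof -
  interpret vectorspace Fq Fqn by (rule vectorspace_Fqn)
  have "card (carrier Fqn) = card (carrier Fq) ^ dim"
    by (rule card_eq_power_dim) (simp add: Fqn_eq finite_vecs)
  then have "q ^ n = q ^ dim" by (simp add: Fqn_eq card_vecs carrier_Fq)
  then show ?thesis using prime_gt_1_nat[OF q] by simp
qed

text \<open>Translates codimension into cardinality, in terms of which the linear algebra above is phrased.\<close>

lemma dim_subsp_iff: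
  assumes W: "subsp W" and k: "k \<le> n"
  shows "vectorspace.dim Fq (Fqn\<lparr>carrier := W\<rparr>) + k = vectorspace.dim Fq Fqn \<longleftrightarrow> card W = q ^ (n - k)"
  unfolding dim_Fqn card_subsp[OF W] using k prime_gt_1_nat[OF q] by auto

lemma proj_point_in_PG:
  assumes W: "subsp W" and v: "v \<in> vecs" "v \<noteq> vzero"
  shows "proj_point Fq Fqn v \<in> PG Fq (Fqn\<lparr>carrier := W\<rparr>) \<longleftrightarrow> v \<in> W"
proof -
  interpret vectorspace Fq Fqn by (rule vectorspace_Fqn)
  have cV: "carrier Fqn = vecs" by (simp add: Fqn_eq)
  have WS: "subspace Fq W Fqn" using W by (simp add: subspace_iff)
  then have WM: "submodule Fq W Fqn" by simp
  interpret U: vectorspace Fq "Fqn\<lparr>carrier := W\<rparr>" by (rule subspace_is_vs[OF WS])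
  have vL: "v \<in> span {v}" by (rule span_self) (simp add: cV v)
  show ?thesis
  proof
    assume "proj_point Fq Fqn v \<in> PG Fq (Fqn\<lparr>carrier := W\<rparr>)"
    then have "subspace Fq (span {v}) (Fqn\<lparr>carrier := W\<rparr>)" by (simp add: PG_def proj_point_def)
    then have "span {v} \<subseteq> W" by (auto simp: subspace_def submodule_def)
    then show "v \<in> W" using vL by blast
  next
    assume vW: "v \<in> W"
    have eqW: "U.span {v} = span {v}" by (rule span_li_not_depend(1)) (use vW WM in auto)
    have sub: "subspace Fq (span {v}) (Fqn\<lparr>carrier := W\<rparr>)"
      unfolding eqW[symmetric] by (rule U.span_is_subspace) (simp add: vW)
    have LS: "subspace Fq (span {v}) Fqn" by (rule span_is_subspace) (simp add: cV v)
    then have LM: "submodule Fq (span {v}) Fqn" by simp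
    interpret L: vectorspace Fq "Fqn\<lparr>carrier := span {v}\<rparr>" by (rule subspace_is_vs[OF LS])
    have eqL: "L.span {v} = span {v}" by (rule span_li_not_depend(1)) (use vL LM in auto)
    have "L.dim = 1"
      by (rule L.dim1I[of v]) (use vL v eqL in \<open>auto simp: Fqn_eq\<close>)
    moreover have "L.fin_dim" unfolding L.fin_dim_def by (rule exI[of _ "{v}"]) (use vL eqL in auto)
    ultimately show "proj_point Fq Fqn v \<in> PG Fq (Fqn\<lparr>carrier := W\<rparr>)" using sub by (simp add: PG_def proj_point_def)
  qed
qed

lemma proj_point_in_PG_Fqn:
  assumes "v \<in> vecs" "v \<noteq> vzero"
  shows "proj_point Fq Fqn v \<in> PG Fq Fqn"
proof -
  have "Fqn\<lparr>carrier := carrier Fqn\<rparr> = Fqn" by simp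
  then have "Fqn\<lparr>carrier := vecs\<rparr> = Fqn" by (simp only: Fqn_eq)
  then show ?thesis using proj_point_in_PG[OF subsp_vecs assms] assms(1) by simp
qed

end

section \<open>Powers modulo composite numbers\<close>

lemma power_residue_mult_power:
  assumes P: "prime P" "\<not> int P dvd u"
  shows "power_residue q P (b * u ^ q) \<longleftrightarrow> power_residue q P b"
proof
  assume "power_residue q P b"
  then obtain x where "[x ^ q = b] (mod int P)" by (auto simp: power_residue_def)
  then have "[x ^ q * u ^ q = b * u ^ q] (mod int P)" by (intro cong_mult cong_refl)
  then show "power_residue q P (b * u ^ q)"
    unfolding power_residue_def by (intro exI[of _ "x * u"]) (simp add: power_mult_distrib)
next
  assume "power_residue q P (b * u ^ q)"
  then obtain x where x: "[x ^ q = b * u ^ q] (mod int P)" by (auto simp: power_residue_def)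
  obtain w k where w: "w * u = 1 + int P * k" using prime_unit_mod[OF P] by blast
  have "[(x * w) ^ q = b * (w * u) ^ q] (mod int P)"
    using cong_mult[OF x cong_refl[of "w ^ q"]] by (simp add: power_mult_distrib mult_ac)
  also have "[b * (w * u) ^ q = b * 1 ^ q] (mod int P)"
    by (intro cong_mult cong_pow cong_refl) (simp add: w cong_iff_dvd_diff)
  finally show "power_residue q P b" unfolding power_residue_def by auto
qed

text \<open>Newton iteration: the derivative \<open>q * x ^ (q - 1)\<close> is invertible modulo \<open>P\<close>.\<close>

lemma hensel_power:
  assumes P: "prime P" "\<not> P dvd q" "\<not> int P dvd s" and q0: "q > 0" and r: "power_residue q P s"
  shows "\<exists>x. [x ^ q = s] (mod int P ^ Suc e)"
proof (induction e)
  case 0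
  then show ?case using r by (simp add: power_residue_def)
next
  case (Suc e)
  then obtain x where "[x ^ q = s] (mod int P ^ Suc e)" by blast
  then have "int P ^ Suc e dvd x ^ q - s" by (simp add: cong_iff_dvd_diff)
  then obtain a where a: "x ^ q - s = int P ^ Suc e * a" by (elim dvdE)
  let ?f = "monom 1 q - [:s:]"
  have f: "poly ?f z = z ^ q - s" "poly (pderiv ?f) z = int q * z ^ (q - 1)" for z
    by (simp_all add: poly_monom pderiv_diff pderiv_monom pderiv_pCons)
  have "\<not> int P dvd int q * x ^ (q - 1)"
  proof
    assume "int P dvd int q * x ^ (q - 1)"
    then have "int P dvd x" using P prime_dvd_power[of "int P" x "q - 1"] by (auto simp: prime_dvd_mult_iff)
    then have "int P dvd x ^ q" using q0 by (meson dvd_power dvd_trans)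
    moreover have "int P dvd int P ^ Suc e * a" by simp
    ultimately have "int P dvd x ^ q - int P ^ Suc e * a" by (rule dvd_diff)
    also have "x ^ q - int P ^ Suc e * a = s" using a by linarith
    finally show False using P(3) by simp
  qed
  then obtain u k where u: "u * (int q * x ^ (q - 1)) = 1 + int P * k" using prime_unit_mod[OF P(1)] by blast
  define h where "h = int P ^ Suc e * (- a * u)"
  obtain g where g: "poly ?f (x + h) = poly ?f x + h * poly (pderiv ?f) x + h\<^sup>2 * g" using poly_taylor by blast
  have "(x + h) ^ q - s = int P ^ Suc e * a + h * (int q * x ^ (q - 1)) + h\<^sup>2 * g"
    using g unfolding f by (simp add: a)
  also have "h * (int q * x ^ (q - 1)) = int P ^ Suc e * (- a) * (u * (int q * x ^ (q - 1)))" by (simp add: h_def)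
  also have "int P ^ Suc e * a + \<dots> + h\<^sup>2 * g = int P ^ Suc (Suc e) * (- a * k) + h\<^sup>2 * g"
    unfolding u by (simp add: algebra_simps)
  also have "h\<^sup>2 = int P ^ Suc (Suc e) * (int P ^ e * (a * u)\<^sup>2)"
    by (simp add: h_def power2_eq_square power_mult_distrib algebra_simps)
  finally have "int P ^ Suc (Suc e) dvd (x + h) ^ q - s" by (simp add: mult.assoc dvd_add)
  then show ?case by (intro exI[of _ "x + h"]) (simp add: cong_iff_dvd_diff)
qed

text \<open>Split off the full power of one prime at a time; the Chinese remainder theorem combines the two solutions.\<close>

lemma power_mod_composite:
  assumes q0: "q > 0" and N: "N > 0" and P: "\<And>P. prime P \<Longrightarrow> P dvd N \<Longrightarrow> \<not> P dvd q \<and> \<not> int P dvd s \<and> power_residue q P s"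
  shows "\<exists>x. [x ^ q = s] (mod int N)"
  using N P
proof (induction N rule: less_induct)
  case (less N)
  show ?case
  proof (cases "N = 1")
    case True
    then show ?thesis by simp
  next
    case False
    then obtain P where Pp: "prime P" "P dvd N" using prime_factor_nat by blast
    define e where "e = multiplicity P N"
    have e: "e > 0" unfolding e_def using Pp less.prems(1) prime_multiplicity_gt_zero_iff[of P N] by simp
    have "N \<noteq> 0" "\<not> is_unit P" using less.prems(1) Pp(1) by auto
    then obtain M where M: "N = P ^ e * M" "\<not> P dvd M"
      unfolding e_def by (rule multiplicity_decompose')
    have M0: "M > 0" using M less.prems(1) by (cases M) auto
    have "P ^ e > 1" using e prime_gt_1_nat[OF Pp(1)] by (intro one_less_power) auto
    then have MN: "M < N" using M(1) M0 by simp
    obtain x where x: "[x ^ q = s] (mod int M)"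
      using less.IH[OF MN M0] less.prems(2) M(1) by (metis dvd_mult)
    obtain e' where "e = Suc e'" using e by (cases e) auto
    then obtain y where y: "[y ^ q = s] (mod int P ^ e)"
      using hensel_power[OF Pp(1) _ _ q0, of s e'] less.prems(2)[OF Pp] by blast
    have cop: "coprime (int P ^ e) (int M)"
      using prime_imp_coprime[OF Pp(1) M(2)] by simp
    obtain z where z: "[z = y] (mod int P ^ e)" "[z = x] (mod int M)"
      using binary_chinese_remainder_int[OF cop] by blast
    have "[z ^ q = s] (mod int P ^ e)" "[z ^ q = s] (mod int M)"
      using cong_trans[OF cong_pow[OF z(1)] y] cong_trans[OF cong_pow[OF z(2)] x] .
    then have "[z ^ q = s] (mod int P ^ e * int M)" using cop by (rule coprime_cong_mult)
    then show ?thesis using M(1) by auto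
  qed
qed

lemma Omega_mult: "a > 0 \<Longrightarrow> b > 0 \<Longrightarrow> Omega (a * b) = Omega a + Omega b"
  by (simp add: Omega_def prime_factorization_mult)

lemma Omega_prime: "prime p \<Longrightarrow> Omega p = 1"
  by (simp add: Omega_def prime_factorization_prime)

lemma Omega_prod_primes:
  assumes "finite A" "\<And>j. j \<in> A \<Longrightarrow> prime (P j)"
  shows "Omega (\<Prod>j\<in>A. P j) = card A"
  using assms
proof (induction A rule: finite_induct)
  case empty
  then show ?case by (simp add: Omega_def)
next
  case (insert a A)
  have "(\<Prod>j\<in>A. P j) > 0" using insert.prems by (intro prod_pos) (auto intro: prime_gt_0_nat)
  then show ?case using insert prime_gt_0_nat[of "P a"] by (simp add: Omega_mult Omega_prime)
qed

lemma card_prime_factors_le_Omega: "card (prime_factors N) \<le> Omega N"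
proof -
  have "card (prime_factors N) = (\<Sum>p\<in>prime_factors N. 1)" by simp
  also have "\<dots> \<le> (\<Sum>p\<in>prime_factors N. count (prime_factorization N) p)"
    by (intro sum_mono) (simp add: Suc_le_eq)
  finally show ?thesis unfolding Omega_def size_multiset_overloaded_eq by simp
qed

context prime_basis
begin

text \<open>Each prime is chosen beyond the sum of the previous ones. The functionals may coincide, which is
why infinitely many primes are needed for each of them.\<close>

lemma distinct_primes_with_kernels:
  fixes k :: nat
  assumes "\<And>j. j < k \<Longrightarrow> \<exists>v\<in>vecs. \<not> int q dvd dot (m j) v"
  shows "\<exists>P. inj_on P {..<k} \<and> (\<forall>j<k. prime (P j) \<and> P j > N0 \<and>
    (\<forall>v\<in>vecs. power_residue q (P j) (int (basis_prod v)) \<longleftrightarrow> int q dvd dot (m j) v))"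
  using assms
proof (induction k)
  case 0
  then show ?case by simp
next
  case (Suc k)
  then obtain P where P: "inj_on P {..<k}" "\<And>j. j < k \<Longrightarrow> prime (P j) \<and> P j > N0 \<and>
    (\<forall>v\<in>vecs. power_residue q (P j) (int (basis_prod v)) \<longleftrightarrow> int q dvd dot (m j) v)" by auto
  obtain p where p: "p > N0 + (\<Sum>j<k. P j)" "prime p" "\<forall>v\<in>vecs. power_residue q p (int (basis_prod v)) \<longleftrightarrow> int q dvd dot (m k) v"
    using prime_with_prescribed_kernel[OF Suc.prems[of k], of "N0 + (\<Sum>j<k. P j)"] by auto
  have ne: "P j < p" if "j < k" for j
    using member_le_sum[of j "{..<k}" P] that p(1) by simp
  define P' where "P' = P(k := p)"
  have "inj_on P' {..<Suc k}"
  proof (rule inj_onI)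
    fix i j assume "i \<in> {..<Suc k}" "j \<in> {..<Suc k}" "P' i = P' j"
    then show "i = j" using ne[of i] ne[of j] inj_onD[OF P(1), of i j]
      by (auto simp: P'_def less_Suc_eq split: if_splits)
  qed
  moreover have "\<forall>j<Suc k. prime (P' j) \<and> P' j > N0 \<and>
    (\<forall>v\<in>vecs. power_residue q (P' j) (int (basis_prod v)) \<longleftrightarrow> int q dvd dot (m j) v)"
    using P(2) p by (auto simp: P'_def less_Suc_eq)
  ultimately show ?case by blast
qed

end

section \<open>Blocking sets and powers modulo almost every number\<close>

lemma rad_pos: "rad q r > 0"
  unfolding rad_def by (intro prod_pos) (auto intro!: prime_gt_0_nat)

lemma multiplicity_rad:
  assumes "r > 0" "prime p"
  shows "multiplicity p (rad q r) = multiplicity p r mod q"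
proof (cases "p \<in> prime_factors r")
  case True
  then show ?thesis unfolding rad_def using assms by (subst multiplicity_prod_prime_powers) auto
next
  case False
  then have "\<not> p dvd r" using assms by (auto simp: prime_factors_dvd)
  then have "multiplicity p r = 0" by (rule not_dvd_imp_multiplicity_0)
  then show ?thesis unfolding rad_def using assms False by (subst multiplicity_prod_prime_powers) auto
qed

lemma rad_decompose:
  assumes "r > 0"
  shows "\<exists>t. r = rad q r * t ^ q"
proof -
  have "r = (\<Prod>p\<in>prime_factors r. p ^ multiplicity p r)" using prod_prime_factors[of r] assms by simp
  also have "\<dots> = (\<Prod>p\<in>prime_factors r. p ^ (multiplicity p r mod q) * (p ^ (multiplicity p r div q)) ^ q)"
  proof (rule prod.cong[OF refl])
    fix p
    have "multiplicity p r = multiplicity p r mod q + multiplicity p r div q * q" by simp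
    then have "p ^ multiplicity p r = p ^ (multiplicity p r mod q + multiplicity p r div q * q)" by simp
    then show "p ^ multiplicity p r = p ^ (multiplicity p r mod q) * (p ^ (multiplicity p r div q)) ^ q"
      by (simp only: power_add power_mult)
  qed
  also have "\<dots> = rad q r * (\<Prod>p\<in>prime_factors r. p ^ (multiplicity p r div q)) ^ q"
    unfolding rad_def by (simp add: prod.distrib prod_power_distrib)
  finally show ?thesis by blast
qed

locale power_free_set =
  fixes q :: nat and S :: "int set"
  assumes prime_q: "prime q" and odd_q: "odd q" and finS: "finite S"
    and not_power: "\<And>s. s \<in> S \<Longrightarrow> \<not> perfect_power q s"
begin

definition n where "n = card (rad_primes q S)"
definition ps :: "nat \<Rightarrow> nat" where "ps i = sorted_list_of_set (rad_primes q S) ! i"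

lemma finite_rad_primes: "finite (rad_primes q S)"
proof -
  have "(\<Prod>s\<in>S. rad q (nat \<bar>s\<bar>)) > 0" by (intro prod_pos) (simp add: rad_pos)
  then have "finite {d. d dvd (\<Prod>s\<in>S. rad q (nat \<bar>s\<bar>))}" by (rule finite_divisors_nat)
  then show ?thesis unfolding rad_primes_def by (rule rev_finite_subset) blast
qed

lemma ps_image: "ps ` {..<n} = rad_primes q S" and ps_inj: "inj_on ps {..<n}"
proof -
  let ?L = "sorted_list_of_set (rad_primes q S)"
  have len: "length ?L = n" by (simp add: n_def)
  have "ps ` {..<n} = set ?L" unfolding len[symmetric] ps_def by (auto simp: set_conv_nth)
  then show "ps ` {..<n} = rad_primes q S" using finite_rad_primes by simp
  show "inj_on ps {..<n}" unfolding ps_def using len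
    by (intro inj_onI) (metis distinct_sorted_list_of_set lessThan_iff nth_eq_iff_index_eq)
qed

sublocale prime_basis q n ps
proof
  show "prime (ps i)" if "i < n" for i
  proof -
    have "ps i \<in> rad_primes q S" using ps_image that by blast
    then show ?thesis by (simp add: rad_primes_def)
  qed
qed (use prime_q odd_q ps_inj in auto)

abbreviation ev where "ev \<equiv> exponent_vector q S"

lemma ev_eq: "i < n \<Longrightarrow> ev s i = int (multiplicity (ps i) (rad q (nat \<bar>s\<bar>)))"
  by (simp add: exponent_vector_def ps_def n_def)

lemma nonzero: "s \<in> S \<Longrightarrow> nat \<bar>s\<bar> > 0"
proof -
  assume s: "s \<in> S"
  have "s \<noteq> 0"
  proof
    assume "s = 0"
    then have "(of_int s :: rat) = 0 ^ q" using q0 by simp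
    then show False using not_power[OF s] unfolding perfect_power_def by blast
  qed
  then show ?thesis by simp
qed

lemma ev_vecs: "s \<in> S \<Longrightarrow> ev s \<in> vecs"
proof -
  assume s: "s \<in> S"
  have "int (multiplicity (ps i) (rad q (nat \<bar>s\<bar>))) \<in> {0..<int q}" if "i < n" for i
    using multiplicity_rad[OF nonzero[OF s] ps[OF that]] q0 by simp
  then show ?thesis unfolding vecs_def exponent_vector_def n_def[symmetric] ps_def[symmetric]
    by (intro restrict_PiE_iff[THEN iffD2]) simp
qed

lemma basis_prod_ev: assumes s: "s \<in> S" shows "basis_prod (ev s) = rad q (nat \<bar>s\<bar>)"
proof (rule multiplicity_eq_nat)
  show "basis_prod (ev s) > 0" by (rule basis_prod_pos)
  show "rad q (nat \<bar>s\<bar>) > 0" by (rule rad_pos)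
  fix p :: nat assume p: "prime p"
  show "multiplicity p (basis_prod (ev s)) = multiplicity p (rad q (nat \<bar>s\<bar>))"
  proof (cases "p \<in> rad_primes q S")
    case True
    then obtain i where i: "i < n" "p = ps i" using ps_image by blast
    then show ?thesis by (simp add: basis_prod_multiplicity ev_eq)
  next
    case False
    have "\<not> p dvd rad q (nat \<bar>s\<bar>)"
    proof
      assume "p dvd rad q (nat \<bar>s\<bar>)"
      then have "p dvd (\<Prod>s\<in>S. rad q (nat \<bar>s\<bar>))" using s finS by (meson dvd_prodI dvd_trans)
      then show False using False p by (simp add: rad_primes_def)
    qed
    moreover have "\<not> p dvd basis_prod (ev s)"
    proof
      assume "p dvd basis_prod (ev s)"
      then obtain i where i: "i < n" "p dvd ps i ^ nat (ev s i)"
        unfolding basis_prod_def using prime_dvd_prod_iff[of "{..<n}" p] p by auto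
      then have "p dvd ps i" using p prime_dvd_power by blast
      then have "p = ps i" using primes_dvd_imp_eq[OF p ps[OF i(1)]] by simp
      then show False using False ps_image i(1) by blast
    qed
    ultimately show ?thesis by (simp add: not_dvd_imp_multiplicity_0)
  qed
qed

lemma sgn_power: "(sgn (s::int)) ^ q = sgn s"
  using odd_q q0 by (simp add: sgn_if)

lemma ev_nonzero: assumes s: "s \<in> S" shows "ev s \<noteq> vzero"
proof
  assume "ev s = vzero"
  then have "rad q (nat \<bar>s\<bar>) = 1" using basis_prod_ev[OF s] by (simp add: basis_prod_def vzero_def)
  then obtain t where "nat \<bar>s\<bar> = t ^ q" using rad_decompose[OF nonzero[OF s], of q] by auto
  then have "int (nat \<bar>s\<bar>) = int t ^ q" by simp
  then have "\<bar>s\<bar> = int t ^ q" by simp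
  then have "s = (sgn s * int t) ^ q" using mult_sgn_abs[of s] by (simp add: power_mult_distrib sgn_power)
  then have "(of_int s :: rat) = (of_int (sgn s * int t)) ^ q" by (metis of_int_power)
  then show False using not_power[OF s] unfolding perfect_power_def by blast
qed

text \<open>An integer differs from the \<open>q\<close>-free part of its absolute value by a \<open>q\<close>-th power, the sign being one because \<open>q\<close> is odd.\<close>

lemma power_residue_ev:
  assumes s: "s \<in> S" and P: "prime P" "\<not> P dvd nat \<bar>s\<bar>"
  shows "power_residue q P s \<longleftrightarrow> power_residue q P (int (basis_prod (ev s)))"
proof -
  obtain t where t: "nat \<bar>s\<bar> = rad q (nat \<bar>s\<bar>) * t ^ q" using rad_decompose[OF nonzero[OF s], of q] by blast
  have "int (nat \<bar>s\<bar>) = int (rad q (nat \<bar>s\<bar>) * t ^ q)" by (rule arg_cong[OF t])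
  then have "\<bar>s\<bar> = int (rad q (nat \<bar>s\<bar>)) * int t ^ q" by simp
  then have seq: "s = int (rad q (nat \<bar>s\<bar>)) * (sgn s * int t) ^ q"
    using mult_sgn_abs[of s] by (simp add: power_mult_distrib sgn_power mult.left_commute)
  have "\<not> P dvd t"
  proof
    assume "P dvd t"
    then have "P dvd t ^ q" using q0 by (meson dvd_power dvd_trans)
    then have "P dvd rad q (nat \<bar>s\<bar>) * t ^ q" by simp
    then show False using t P(2) by simp
  qed
  moreover have "s \<noteq> 0" using nonzero[OF s] by simp
  ultimately have "\<not> int P dvd sgn s * int t" by (auto simp: sgn_if)
  then have "power_residue q P (int (rad q (nat \<bar>s\<bar>)) * (sgn s * int t) ^ q) \<longleftrightarrow> power_residue q P (int (rad q (nat \<bar>s\<bar>)))"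
    by (rule power_residue_mult_power[OF P(1)])
  then show ?thesis using seq basis_prod_ev[OF s] by simp
qed

text \<open>A projective point lies in \<open>PG W\<close> exactly if its representative lies in \<open>W\<close>, so the condition can be stated with
exponent vectors and cardinalities.\<close>

lemma k_blocking_set_iff:
  assumes k: "k \<ge> 1"
  shows "k_blocking_set q n k (associated_points q S) \<longleftrightarrow>
    k < n \<and> (\<forall>W. subsp W \<and> card W = q ^ (n - k) \<longrightarrow> (\<exists>s\<in>S. ev s \<in> W))"
proof (cases "k < n")
  case True
  have pts: "associated_points q S = (\<lambda>s. proj_point Fq Fqn (ev s)) ` S"
    by (simp add: associated_points_def n_def)
  have "associated_points q S \<subseteq> PG Fq Fqn"
    unfolding pts using proj_point_in_PG_Fqn ev_vecs ev_nonzero by blast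
  moreover have "(subspace Fq W Fqn \<and> vectorspace.dim Fq (Fqn\<lparr>carrier := W\<rparr>) + k = vectorspace.dim Fq Fqn \<longrightarrow>
      PG Fq (Fqn\<lparr>carrier := W\<rparr>) \<inter> associated_points q S \<noteq> {}) \<longleftrightarrow>
      (subsp W \<and> card W = q ^ (n - k) \<longrightarrow> (\<exists>s\<in>S. ev s \<in> W))" for W
  proof (cases "subsp W")
    case sub: True
    have "PG Fq (Fqn\<lparr>carrier := W\<rparr>) \<inter> associated_points q S \<noteq> {} \<longleftrightarrow> (\<exists>s\<in>S. ev s \<in> W)"
      unfolding pts using proj_point_in_PG[OF sub ev_vecs ev_nonzero] by blast
    then show ?thesis using sub dim_subsp_iff[OF sub, of k] True by (simp add: subspace_iff)
  qed (simp add: subspace_iff)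
  ultimately show ?thesis using True k unfolding k_blocking_set_def by simp
qed (simp add: k_blocking_set_def)

text \<open>Apply the hypothesis to a product of distinct large primes, one for each of the functionals.\<close>

lemma hits_common_kernel:
  assumes T: "S \<in> T_collection k q" and k': "k' \<le> k"
    and m: "\<And>j. j < k' \<Longrightarrow> \<exists>v\<in>vecs. \<not> int q dvd dot (m j) v"
  shows "\<exists>s\<in>S. \<forall>j<k'. int q dvd dot (m j) (ev s)"
proof -
  obtain \<Delta> where \<Delta>: "\<Delta> > 0" "\<And>N. N > 0 \<Longrightarrow> Omega N \<le> k \<Longrightarrow> coprime N \<Delta> \<Longrightarrow> contains_power_mod q S N"
    using T unfolding T_collection_def contains_power_mod_almost_every_def by blast
  obtain P where P: "inj_on P {..<k'}" "\<And>j. j < k' \<Longrightarrow> prime (P j)" "\<And>j. j < k' \<Longrightarrow> P j > \<Delta> + (\<Sum>s\<in>S. nat \<bar>s\<bar>)"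
    "\<And>j v. j < k' \<Longrightarrow> v \<in> vecs \<Longrightarrow> power_residue q (P j) (int (basis_prod v)) \<longleftrightarrow> int q dvd dot (m j) v"
    using distinct_primes_with_kernels[of k' m "\<Delta> + (\<Sum>s\<in>S. nat \<bar>s\<bar>)", OF m] by auto
  define N where "N = (\<Prod>j<k'. P j)"
  have "N > 0" unfolding N_def by (intro prod_pos) (auto intro: prime_gt_0_nat P(2))
  moreover have "Omega N \<le> k" unfolding N_def using Omega_prod_primes[of "{..<k'}" P] P(2) k' by simp
  moreover have "coprime N \<Delta>" unfolding N_def
  proof (rule prod_coprime_left)
    fix j assume "j \<in> {..<k'}"
    then have j: "j < k'" by simp
    have "\<not> P j dvd \<Delta>" using P(3)[OF j] \<Delta>(1) by (intro nat_dvd_not_less) linarith+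
    then show "coprime (P j) \<Delta>" by (rule prime_imp_coprime[OF P(2)[OF j]])
  qed
  ultimately have "contains_power_mod q S N" by (rule \<Delta>(2))
  then obtain s x where s: "s \<in> S" and x: "[x ^ q = s] (mod int N)" unfolding contains_power_mod_def by blast
  have "int q dvd dot (m j) (ev s)" if j: "j < k'" for j
  proof -
    have "P j dvd N" unfolding N_def using j by (intro dvd_prodI) auto
    then have "int (P j) dvd int N" by simp
    with x have "[x ^ q = s] (mod int (P j))" by (rule cong_dvd_modulus)
    then have res: "power_residue q (P j) s" unfolding power_residue_def by blast
    have "nat \<bar>s\<bar> \<le> (\<Sum>s\<in>S. nat \<bar>s\<bar>)" using member_le_sum[of s S "\<lambda>s. nat \<bar>s\<bar>"] s finS by simp
    then have "nat \<bar>s\<bar> < P j" using P(3)[OF j] by linarith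
    then have "\<not> P j dvd nat \<bar>s\<bar>" using nonzero[OF s] by (intro nat_dvd_not_less)
    then show ?thesis using res power_residue_ev[OF s P(2)[OF j]] P(4)[OF j ev_vecs[OF s]] by blast
  qed
  then show ?thesis using s by blast
qed

text \<open>If \<open>n \<le> k\<close>, the coordinate functionals are among the admissible choices, and an exponent vector in all their kernels would be
zero. Otherwise a subspace of codimension \<open>k\<close> is written as a common kernel.\<close>

lemma T_collection_imp_blocking:
  assumes T: "S \<in> T_collection k q" and k: "k \<ge> 1"
  shows "k_blocking_set q n k (associated_points q S)"
  unfolding k_blocking_set_iff[OF k]
proof (intro conjI allI impI)
  show kn: "k < n"
  proof (rule ccontr)
    assume "\<not> k < n"
    define m where "m j = (\<lambda>i. if i = j then 1 else 0 :: int)" for j :: nat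
    have dot: "dot (m j) v = v j" if "j < n" for j v
    proof -
      have "dot (m j) v = (\<Sum>i<n. if i = j then v i else 0)" unfolding dot_def m_def by (intro sum.cong) auto
      then show ?thesis using that by simp
    qed
    have "\<exists>v\<in>vecs. \<not> int q dvd dot (m j) v" if j: "j < n" for j
    proof
      show "(\<lambda>i\<in>{..<n}. 1) \<in> vecs" using prime_gt_1_nat[OF q] by (auto simp: vecs_def)
      show "\<not> int q dvd dot (m j) (\<lambda>i\<in>{..<n}. 1)" using j prime_gt_1_nat[OF q] by (simp add: dot)
    qed
    with T obtain s where s: "s \<in> S" "\<And>j. j < n \<Longrightarrow> int q dvd dot (m j) (ev s)"
      using hits_common_kernel[of k n m] \<open>\<not> k < n\<close> by auto
    have "ev s = vzero"
      by (rule vecs_ext[OF ev_vecs[OF s(1)] vzero_vecs]) (use s(2) dot in \<open>simp add: vzero_def cong_0_iff\<close>)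
    then show False using ev_nonzero[OF s(1)] by simp
  qed
  fix W assume W: "subsp W \<and> card W = q ^ (n - k)"
  obtain m where m: "W = {v \<in> vecs. \<forall>j<k. int q dvd dot (m j) v}" "\<And>j. j < k \<Longrightarrow> \<exists>v\<in>vecs. \<not> int q dvd dot (m j) v"
    using subspace_as_kernels[of W k] W kn by auto
  obtain s where s: "s \<in> S" "\<forall>j<k. int q dvd dot (m j) (ev s)"
    using hits_common_kernel[of k k m, OF T order_refl] m(2) by blast
  then have "ev s \<in> W" using ev_vecs[OF s(1)] unfolding m(1) by simp
  then show "\<exists>s\<in>S. ev s \<in> W" using s(1) by blast
qed

text \<open>Excluding the prime divisors of \<open>q\<close> and of the elements of \<open>S\<close> makes Hensel's lemma and the residue functionals available at every prime
dividing \<open>N\<close>. There are at most \<open>k\<close> of these.\<close>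

lemma blocking_imp_T_collection:
  assumes bl: "k_blocking_set q n k (associated_points q S)" and k: "k \<ge> 1"
  shows "S \<in> T_collection k q"
proof -
  have kn: "k < n" and hit: "\<And>W. subsp W \<Longrightarrow> card W = q ^ (n - k) \<Longrightarrow> \<exists>s\<in>S. ev s \<in> W"
    using bl unfolding k_blocking_set_iff[OF k] by blast+
  define \<Delta> where "\<Delta> = q * (\<Prod>s\<in>S. nat \<bar>s\<bar>)"
  have "(\<Prod>s\<in>S. nat \<bar>s\<bar>) > 0" by (rule prod_pos) (use nonzero in blast)
  then have \<Delta>0: "\<Delta> > 0" using q0 by (simp add: \<Delta>_def)
  have "contains_power_mod q S N" if N: "N > 0" "Omega N \<le> k" "coprime N \<Delta>" for N
  proof -
    have nd: "\<not> P dvd \<Delta>" if "prime P" "P dvd N" for P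
    proof
      assume "P dvd \<Delta>"
      then have "P dvd gcd N \<Delta>" using that(2) by simp
      then show False using N(3) that(1) by simp
    qed
    have ndq: "\<not> P dvd q" if "prime P" "P dvd N" for P using nd[OF that] by (auto simp: \<Delta>_def)
    have nds: "\<not> P dvd nat \<bar>s\<bar>" if "prime P" "P dvd N" "s \<in> S" for P s
    proof
      assume "P dvd nat \<bar>s\<bar>"
      moreover have "nat \<bar>s\<bar> dvd (\<Prod>s\<in>S. nat \<bar>s\<bar>)" using that(3) finS by (intro dvd_prodI) auto
      ultimately have "P dvd \<Delta>" unfolding \<Delta>_def by (meson dvd_mult dvd_trans)
      then show False using nd[OF that(1,2)] by simp
    qed
    have ndp: "P \<noteq> ps i" if P: "prime P" "P dvd N" and i: "i < n" for P i
    proof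
      assume "P = ps i"
      then have "P \<in> rad_primes q S" using ps_image i by blast
      then have "P dvd (\<Prod>s\<in>S. rad q (nat \<bar>s\<bar>))" by (simp add: rad_primes_def)
      then obtain s where s: "s \<in> S" "P dvd rad q (nat \<bar>s\<bar>)"
        unfolding prime_dvd_prod_iff[OF finS P(1)] by (rule bexE)
      obtain t where "nat \<bar>s\<bar> = rad q (nat \<bar>s\<bar>) * t ^ q" using rad_decompose[OF nonzero[OF s(1)], of q] by blast
      then have "rad q (nat \<bar>s\<bar>) dvd nat \<bar>s\<bar>" by (rule dvdI)
      with s(2) have "P dvd nat \<bar>s\<bar>" by (rule dvd_trans)
      with nds[OF P s(1)] show False by (rule notE)
    qed
    have "\<forall>P\<in>prime_factors N. \<exists>l. \<forall>v. (\<forall>i<n. v i \<ge> 0) \<longrightarrow> (power_residue q P (int (basis_prod v)) \<longleftrightarrow> int q dvd dot l v)"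
    proof
      fix P assume "P \<in> prime_factors N"
      then have P: "prime P" "P dvd N" by auto
      show "\<exists>l. \<forall>v. (\<forall>i<n. v i \<ge> 0) \<longrightarrow> (power_residue q P (int (basis_prod v)) \<longleftrightarrow> int q dvd dot l v)"
        by (rule residue_functional[OF P(1)]) (use ndp[OF P] in blast)
    qed
    from bchoice[OF this] obtain l where l: "\<And>P v. P \<in> prime_factors N \<Longrightarrow> (\<forall>i<n. v i \<ge> 0) \<Longrightarrow>
        power_residue q P (int (basis_prod v)) \<longleftrightarrow> int q dvd dot (l P) v" by blast
    \<comment> \<open>The entries \<open>Ls ! j\<close> with \<open>j\<close> beyond the length of \<open>Ls\<close> are arbitrary; the functionals attached to them
do no harm, because the common kernel only has to be large enough.\<close>
    define Ls where "Ls = sorted_list_of_set (prime_factors N)"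
    have Ls: "set Ls = prime_factors N" "length Ls \<le> k"
      using card_prime_factors_le_Omega[of N] N(2) by (simp_all add: Ls_def)
    obtain W where W: "subsp W" "card W = q ^ (n - k)" "\<forall>j<k. \<forall>w\<in>W. int q dvd dot (l (Ls ! j)) w"
      using kernels_contain_subspace[of k "\<lambda>j. l (Ls ! j)"] kn by auto
    obtain s where s: "s \<in> S" "ev s \<in> W" using hit[OF W(1,2)] by blast
    have pos: "\<forall>i<n. ev s i \<ge> 0" by (simp add: ev_eq)
    have "\<exists>x. [x ^ q = s] (mod int N)"
    proof (rule power_mod_composite[OF q0 N(1)])
      fix P assume P: "prime P" "P dvd N"
      then have PN: "P \<in> prime_factors N" using N(1) by (simp add: prime_factors_dvd)
      then obtain j where j: "j < length Ls" "P = Ls ! j" using Ls(1) by (metis in_set_conv_nth)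
      have "int q dvd dot (l P) (ev s)" using W(3) s(2) j Ls(2) by auto
      then have "power_residue q P (int (basis_prod (ev s)))" using l[OF PN pos] by simp
      then have "power_residue q P s" using power_residue_ev[OF s(1) P(1) nds[OF P s(1)]] by simp
      moreover have "\<not> int P dvd s" using nds[OF P s(1)] by (simp add: nat_abs_dvd_iff int_dvd_int_iff[symmetric])
      ultimately show "\<not> P dvd q \<and> \<not> int P dvd s \<and> power_residue q P s" using ndq[OF P] by simp
    qed
    then show ?thesis unfolding contains_power_mod_def using s(1) by blast
  qed
  then show ?thesis unfolding T_collection_def contains_power_mod_almost_every_def using finS \<Delta>0 by blast
qed

end

theorem theorem1p2:
  fixes q k n :: nat and S :: "int set"
  assumes "prime q" and "odd q" and "k \<ge> 1"
    and "finite S" and "\<forall>s\<in>S. \<not> perfect_power q s"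
    and "n = card {p::nat. prime p \<and> p dvd (\<Prod>s\<in>S. rad q (nat \<bar>s\<bar>))}"
  shows "S \<in> T_collection k q \<longleftrightarrow> k_blocking_set q n k (associated_points q S)"
proof -
  interpret power_free_set q S by unfold_locales (use assms in auto)
  have "n = card (rad_primes q S)" by (simp add: assms(6) rad_primes_def)
  then show ?thesis
    using T_collection_imp_blocking[OF _ assms(3)] blocking_imp_T_collection[OF _ assms(3)] n_def by auto
qed

end
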